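(* Let $\{X_t\}_{t\in\mathbb Z}$ be the CEStGM process (see context) with interaction kernel $R$, and suppose $R$ is Hilbert–Schmidt, i.e. $\int_{\mathcal X\times\mathcal X}R(x,y)^2\,\mu(dx)\mu(dy)<\infty$. Let $\mathcal G=(V,E)$ be the undirected graph with $V=[p]$ and $(a,b)\in E$ iff $b\in\mathcal N_a$. Then for all subsets $A,B,S\subseteq V$ such that $S$ separates $A$ from $B$ in $\mathcal G$ (written $A\perp_{\mathcal G}B\mid S$), $$\mathcal F^A\perp\!\!\!\perp\mathcal F^B\mid\mathcal F^S.$$
   Context: Setting. Let $p\ge1$, $[p]=\{1,\ldots,p\}$. For $a\in[p]$ let $\mathcal X^{(a)}\subseteq\mathbb R$ be measurable with a sigma-finite measure $\mu_a$; $\mathcal X=\prod_a\mathcal X^{(a)}$, $\mu=\otimes_a\mu_a$. For each $a$ let $K_a\ge1$, $\mathbf s^{(a)}:\mathcal X^{(a)}\to\mathbb R^{K_a}$ and $c^{(a)}:\mathcal X^{(a)}\to\mathbb R$ be measurable, $\boldsymbol\theta^{(a)}\in\mathbb R^{K_a}$, and let $\Phi_\ell^{(a,b)}$ ($\ell\in\{-1,0,1\}$) be real $K_a\times K_b$ matrices with $\Phi_0^{(a,a)}=0$, $(\Phi_0^{(a,b)})^\top=\Phi_0^{(b,a)}$, $(\Phi_{-1}^{(a,b)})^\top=\Phi_1^{(b,a)}$. Let $\Psi_\ell=(\Phi_\ell^{(a,b)})_{a,b\in[p]}$ be the block matrices, $\mathbf s(x)$ the concatenation of $\mathbf s^{(1)}(x^{(1)}),\ldots,\mathbf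 s^{(p)}(x^{(p)})$, and $\boldsymbol\theta$ the concatenation of $\boldsymbol\theta^{(1)},\ldots,\boldsymbol\theta^{(p)}$. Interaction kernel: $R(x,y)=G(x)^{1/2}H(x,y)G(y)^{1/2}$ with $G(x)=\exp\big(\boldsymbol\theta^\top\mathbf s(x)+\tfrac12\mathbf s(x)^\top\Psi_0\mathbf s(x)+\sum_{a}c^{(a)}(x^{(a)})\big)$, $H(x,y)=\exp(\mathbf s(x)^\top\Psi_1\mathbf s(y))$. Let $T(f)[y]=\int R(x,y)f(x)\mu(dx)$ on $L^2(\mathcal X,\mu)$. (The Hilbert–Schmidt condition implies $T$ is compact.) CEStGM process: when $T$ is compact, the unique (in law) strictly stationary process $X_t=(X_t^{(1)},\ldots,X_t^{(p)})$, $t\in\mathbb Z$, whose joint density for $(X_m,\ldots,X_{m+n-1})$ (any $m\in\mathbb Z$, $n\ge1$) with respect to the $n$-fold product of $\mu$ is $r^{-(n-1)}v(x_1)\prod_{t=2}^nR(x_{t-1},x_t)\,w(x_n)$, where $r>0$ is the spectral radius of $T$ and $v,w$ are the a.e. positive eigenfunctions of $T$ and $T^*$ for the eigenvalue $r$ (unique up to scaling, by Krein–Rutman), scaled so that $\langle v,w\rangle=1$. It satisfies: the conditional density of $X_t^{(a)}$ given all other $X_\tau^{(b)}$, $(b,\tau)\ne(a,t)$, is proportional to $\exp\big(\mathbf s^{(a)}(x_t^{(a)})^\top\boldsymbol\Theta_a+c^{(a)}(x_t^{(a)})\big)$ with $\boldsymbol\Theta_a=\boldsymbol\theta^{(a)}+\sum_{b\ne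 a}\Phi_0^{(a,b)}\mathbf s^{(b)}(x_t^{(b)})+\sum_{b\in[p]}[\Phi_{-1}^{(a,b)}\mathbf s^{(b)}(x_{t-1}^{(b)})+\Phi_1^{(a,b)}\mathbf s^{(b)}(x_{t+1}^{(b)})]$. The basic natural exponential model with conditional densities proportional to $\exp(\theta^{(a)}s_a(x_t^{(a)})+x_t^{(a)}\Theta_a+c_a(x_t^{(a)}))$, where $\Theta_a$ is linear in the neighbours $x_\tau^{(b)}$ with scalar coefficients $\Phi_\ell^{(a,b)}$, is the special case in which only the statistic $x$ interacts. Neighbourhoods: $\mathcal N_a=\{b\in[p]\setminus\{a\}:\Phi_0^{(a,b)}\ne0\text{ or }\Phi_1^{(a,b)}\ne0\text{ or }\Phi_{-1}^{(a,b)}\ne0\}$ (so $b\in\mathcal N_a$ iff $a\in\mathcal N_b$). Separation: $S$ is a separator of two disjoint subsets $A,B\subset V$ if all paths in $\mathcal G$ from $A$ to $B$ are blocked by $S$ (i.e. pass through $S$). Sigma-algebras: for $K\subseteq[p]$, $\mathcal F^K=\sigma(X_t^{(b)}:t\in\mathbb Z,b\in K)$. Conditional independence $\mathcal G_1\perp\!\!\!\perp\mathcal G_2\mid\mathcal G_3$ means $\mathrm E[m_1m_2\mid\mathcal G_3]=\mathrm E[m_1\mid\mathcal G_3]\,\mathrm E[m_2\mid\mathcal G_3]$ a.s. for all bounded positive $\mathcal G_i$-measurable $m_i$, $i=1,2$. *)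

theory Defs
  imports
    "HOL-Probability.Probability"
    "Graph_Theory.Pair_Digraph"
    "Graph_Theory.Vertex_Walk"
begin

section \<open>The interaction kernel\<close>

text \<open>
  A state is a function \<open>x :: nat \<Rightarrow> real\<close> on the component set \<open>{1..p}\<close>. Since the dimensions
  \<open>K a\<close> of the sufficient statistics vary with \<open>a\<close>, vectors and matrices are functions of indices
  below these dimensions: \<open>s a u i\<close> is the \<open>i\<close>-th entry of the statistic of component \<open>a\<close> at \<open>u\<close>,
  and \<open>\<Phi> l a b i j\<close> is the entry at \<open>(i, j)\<close> of the \<open>K a \<times> K b\<close> matrix with lag \<open>l \<in> {-1, 0, 1}\<close>.
  Concatenated vectors and block matrices are indexed by the pairs \<open>(a, i)\<close> in \<open>stacked_index p K\<close>.
\<close>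

definition stacked_index :: "nat \<Rightarrow> (nat \<Rightarrow> nat) \<Rightarrow> (nat \<times> nat) set" where
  "stacked_index p K = (SIGMA a:{1..p}. {..<K a})"

definition stacked_stat ::
    "(nat \<Rightarrow> real \<Rightarrow> nat \<Rightarrow> real) \<Rightarrow> (nat \<Rightarrow> real) \<Rightarrow> nat \<times> nat \<Rightarrow> real" where
  "stacked_stat s x = (\<lambda>(a, i). s a (x a) i)"

definition stacked_theta :: "(nat \<Rightarrow> nat \<Rightarrow> real) \<Rightarrow> nat \<times> nat \<Rightarrow> real" where
  "stacked_theta \<theta> = (\<lambda>(a, i). \<theta> a i)"

definition block_matrix ::
    "(int \<Rightarrow> nat \<Rightarrow> nat \<Rightarrow> nat \<Rightarrow> nat \<Rightarrow> real) \<Rightarrow> int \<Rightarrow> nat \<times> nat \<Rightarrow> nat \<times> nat \<Rightarrow> real" where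
  "block_matrix \<Phi> l = (\<lambda>(a, i) (b, j). \<Phi> l a b i j)"

definition dot_on :: "'i set \<Rightarrow> ('i \<Rightarrow> real) \<Rightarrow> ('i \<Rightarrow> real) \<Rightarrow> real" where
  "dot_on I u v = (\<Sum>i\<in>I. u i * v i)"

definition bilinear_on ::
    "'i set \<Rightarrow> ('i \<Rightarrow> real) \<Rightarrow> ('i \<Rightarrow> 'i \<Rightarrow> real) \<Rightarrow> ('i \<Rightarrow> real) \<Rightarrow> real" where
  "bilinear_on I u A v = (\<Sum>i\<in>I. \<Sum>j\<in>I. u i * A i j * v j)"

definition kernel_G where
  "kernel_G p K s c \<theta> \<Phi> x =
     exp (dot_on (stacked_index p K) (stacked_theta \<theta>) (stacked_stat s x)
        + 1 / 2 * bilinear_on (stacked_index p K)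
            (stacked_stat s x) (block_matrix \<Phi> 0) (stacked_stat s x)
        + (\<Sum>a\<in>{1..p}. c a (x a)) :: real)"

definition kernel_H where
  "kernel_H p K s \<Phi> x y =
     exp (bilinear_on (stacked_index p K)
            (stacked_stat s x) (block_matrix \<Phi> 1) (stacked_stat s y))"

definition interaction_kernel ::
    "nat \<Rightarrow> (nat \<Rightarrow> nat) \<Rightarrow> (nat \<Rightarrow> real \<Rightarrow> nat \<Rightarrow> real) \<Rightarrow> (nat \<Rightarrow> real \<Rightarrow> real) \<Rightarrow> (nat \<Rightarrow> nat \<Rightarrow> real)
      \<Rightarrow> (int \<Rightarrow> nat \<Rightarrow> nat \<Rightarrow> nat \<Rightarrow> nat \<Rightarrow> real) \<Rightarrow> (nat \<Rightarrow> real) \<Rightarrow> (nat \<Rightarrow> real) \<Rightarrow> real" where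
  "interaction_kernel p K s c \<theta> \<Phi> x y =
     sqrt (kernel_G p K s c \<theta> \<Phi> x) * kernel_H p K s \<Phi> x y * sqrt (kernel_G p K s c \<theta> \<Phi> y)"

definition hilbert_schmidt_kernel :: "'x measure \<Rightarrow> ('x \<Rightarrow> 'x \<Rightarrow> real) \<Rightarrow> bool" where
  "hilbert_schmidt_kernel N R \<longleftrightarrow>
     (\<integral>\<^sup>+ z. ennreal ((R (fst z) (snd z))\<^sup>2) \<partial>(N \<Otimes>\<^sub>M N)) < \<infinity>"


section \<open>The operator on square-integrable functions\<close>

text \<open>
  Elements of the Hilbert space are represented by functions; equality in the Hilbert space is
  almost everywhere equality. The range is kept general because eigenfunctions are real valued,
  whereas the spectrum is that of the operator on complex-valued functions.
\<close>

definition L2_fun :: "'x measure \<Rightarrow> ('x \<Rightarrow> 'b::{banach, second_countable_topology}) set" where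
  "L2_fun N = {f \<in> borel_measurable N. integrable N (\<lambda>x. (norm (f x))\<^sup>2)}"

definition L2_fun_norm :: "'x measure \<Rightarrow> ('x \<Rightarrow> 'b::{banach, second_countable_topology}) \<Rightarrow> real" where
  "L2_fun_norm N f = sqrt (LINT x|N. (norm (f x))\<^sup>2)"

definition L2_fun_inner :: "'x measure \<Rightarrow> ('x \<Rightarrow> real) \<Rightarrow> ('x \<Rightarrow> real) \<Rightarrow> real" where
  "L2_fun_inner N f g = (LINT x|N. f x * g x)"

definition kernel_operator ::
    "'x measure \<Rightarrow> ('x \<Rightarrow> 'x \<Rightarrow> real) \<Rightarrow> ('x \<Rightarrow> 'b::{banach, second_countable_topology}) \<Rightarrow> 'x \<Rightarrow> 'b" where
  "kernel_operator N R f y = (LINT x|N. R x y *\<^sub>R f x)"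

text \<open>As for \<^const>\<open>adjoint\<close> in the library; the choice is unique up to null sets.\<close>

definition L2_adjoint :: "'x measure \<Rightarrow> (('x \<Rightarrow> real) \<Rightarrow> ('x \<Rightarrow> real)) \<Rightarrow> ('x \<Rightarrow> real) \<Rightarrow> ('x \<Rightarrow> real)" where
  "L2_adjoint N T g =
     (SOME h. h \<in> L2_fun N \<and> (\<forall>f\<in>L2_fun N. L2_fun_inner N (T f) g = L2_fun_inner N f h))"

definition L2_eigenfunction ::
    "'x measure \<Rightarrow> (('x \<Rightarrow> real) \<Rightarrow> ('x \<Rightarrow> real)) \<Rightarrow> real \<Rightarrow> ('x \<Rightarrow> real) \<Rightarrow> bool" where
  "L2_eigenfunction N T r f \<longleftrightarrow>
     f \<in> L2_fun N \<and> \<not> (AE x in N. f x = 0) \<and> (AE x in N. T f x = r * f x)"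

text \<open>
  \<open>z\<close> is in the resolvent set iff \<open>z I - T\<close> is onto and bounded below, that is, bijective on
  almost everywhere classes with bounded inverse.
\<close>

definition L2_resolvent_set :: "'x measure \<Rightarrow> (('x \<Rightarrow> complex) \<Rightarrow> ('x \<Rightarrow> complex)) \<Rightarrow> complex set" where
  "L2_resolvent_set N T =
     {z. (\<forall>g\<in>L2_fun N. \<exists>f\<in>L2_fun N. AE x in N. z * f x - T f x = g x) \<and>
         (\<exists>C. \<forall>f\<in>L2_fun N. L2_fun_norm N f \<le> C * L2_fun_norm N (\<lambda>x. z * f x - T f x))}"

definition L2_spectral_radius :: "'x measure \<Rightarrow> (('x \<Rightarrow> complex) \<Rightarrow> ('x \<Rightarrow> complex)) \<Rightarrow> real" where
  "L2_spectral_radius N T = Sup (cmod ` (- L2_resolvent_set N T))"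

definition principal_eigendata ::
    "'x measure \<Rightarrow> ('x \<Rightarrow> 'x \<Rightarrow> real) \<Rightarrow> real \<Rightarrow> ('x \<Rightarrow> real) \<Rightarrow> ('x \<Rightarrow> real) \<Rightarrow> bool" where
  "principal_eigendata N R r v w \<longleftrightarrow>
     r = L2_spectral_radius N (kernel_operator N R) \<and> 0 < r \<and>
     L2_eigenfunction N (kernel_operator N R) r v \<and> (AE x in N. 0 < v x) \<and>
     L2_eigenfunction N (L2_adjoint N (kernel_operator N R)) r w \<and> (AE x in N. 0 < w x) \<and>
     L2_fun_inner N v w = 1"


section \<open>The stationary process\<close>

text \<open>The random vector \<open>(X\<^sub>m, \<dots>, X\<^bsub>m+n-1\<^esub>)\<close>, indexed by \<open>{1..n}\<close>.\<close>

definition process_block :: "(int \<Rightarrow> 'w \<Rightarrow> 'x) \<Rightarrow> int \<Rightarrow> nat \<Rightarrow> 'w \<Rightarrow> nat \<Rightarrow> 'x" where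
  "process_block X m n \<omega> = (\<lambda>t\<in>{1..n}. X (m + int t - 1) \<omega>)"

definition strictly_stationary :: "'w measure \<Rightarrow> 'x measure \<Rightarrow> (int \<Rightarrow> 'w \<Rightarrow> 'x) \<Rightarrow> bool" where
  "strictly_stationary M N X \<longleftrightarrow>
     (\<forall>m k. \<forall>n\<ge>1. distr M (\<Pi>\<^sub>M t\<in>{1..n}. N) (process_block X (m + k) n) =
                    distr M (\<Pi>\<^sub>M t\<in>{1..n}. N) (process_block X m n))"

definition block_density ::
    "('x \<Rightarrow> 'x \<Rightarrow> real) \<Rightarrow> real \<Rightarrow> ('x \<Rightarrow> real) \<Rightarrow> ('x \<Rightarrow> real) \<Rightarrow> nat \<Rightarrow> (nat \<Rightarrow> 'x) \<Rightarrow> real" where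
  "block_density R r v w n x =
     1 / r ^ (n - 1) * v (x 1) * (\<Prod>t\<in>{2..n}. R (x (t - 1)) (x t)) * w (x n)"

definition cestgm_process ::
    "'w measure \<Rightarrow> 'x measure \<Rightarrow> ('x \<Rightarrow> 'x \<Rightarrow> real) \<Rightarrow> (int \<Rightarrow> 'w \<Rightarrow> 'x) \<Rightarrow> bool" where
  "cestgm_process M N R X \<longleftrightarrow>
     prob_space M \<and> (\<forall>t. X t \<in> measurable M N) \<and> strictly_stationary M N X \<and>
     (\<exists>r v w. principal_eigendata N R r v w \<and>
        (\<forall>m. \<forall>n\<ge>1. distributed M (\<Pi>\<^sub>M t\<in>{1..n}. N) (process_block X m n)
           (\<lambda>x. ennreal (block_density R r v w n x))))"


section \<open>Graph, separation, conditional independence\<close>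

definition neighbourhood ::
    "nat \<Rightarrow> (nat \<Rightarrow> nat) \<Rightarrow> (int \<Rightarrow> nat \<Rightarrow> nat \<Rightarrow> nat \<Rightarrow> nat \<Rightarrow> real) \<Rightarrow> nat \<Rightarrow> nat set" where
  "neighbourhood p K \<Phi> a =
     {b \<in> {1..p} - {a}. \<exists>l\<in>{-1, 0, 1}. \<exists>i<K a. \<exists>j<K b. \<Phi> l a b i j \<noteq> 0}"

definition cestgm_graph ::
    "nat \<Rightarrow> (nat \<Rightarrow> nat) \<Rightarrow> (int \<Rightarrow> nat \<Rightarrow> nat \<Rightarrow> nat \<Rightarrow> nat \<Rightarrow> real) \<Rightarrow> nat pair_pre_digraph" where
  "cestgm_graph p K \<Phi> =
     \<lparr>pverts = {1..p}, parcs = {(a, b). a \<in> {1..p} \<and> b \<in> neighbourhood p K \<Phi> a}\<rparr>"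

text \<open>The arc relation is symmetric, so the graph is undirected.\<close>

lemma sym_parcs_cestgm_graph:
  assumes "\<And>a b i j. \<lbrakk>a \<in> {1..p}; b \<in> {1..p}; i < K a; j < K b\<rbrakk> \<Longrightarrow> \<Phi> 0 a b i j = \<Phi> 0 b a j i"
    and "\<And>a b i j. \<lbrakk>a \<in> {1..p}; b \<in> {1..p}; i < K a; j < K b\<rbrakk> \<Longrightarrow> \<Phi> (-1) a b i j = \<Phi> 1 b a j i"
  shows "sym (parcs (cestgm_graph p K \<Phi>))"
proof (rule symI)
  fix a b assume ab: "(a, b) \<in> parcs (cestgm_graph p K \<Phi>)"
  then obtain l i j where h: "a \<in> {1..p}" "b \<in> {1..p}" "b \<noteq> a" "l \<in> {-1, 0, 1 :: int}"
      "i < K a" "j < K b" "\<Phi> l a b i j \<noteq> 0"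
    by (auto simp: cestgm_graph_def neighbourhood_def)
  have "\<Phi> (- l) b a j i \<noteq> 0"
    using h assms(1)[of a b i j] assms(2)[of a b i j] assms(2)[of b a j i] by auto
  moreover have "- l \<in> {-1, 0, 1}" using h by auto
  ultimately have "\<exists>l\<in>{-1, 0, 1}. \<exists>j<K b. \<exists>i<K a. \<Phi> l b a j i \<noteq> 0"
    using h by blast
  then show "(b, a) \<in> parcs (cestgm_graph p K \<Phi>)"
    using h(1-3) by (simp add: cestgm_graph_def neighbourhood_def)
qed

text \<open>
  Endpoints count as lying on a path, and the separator may meet the sets it separates.
\<close>

definition separates :: "('a, 'b) pre_digraph \<Rightarrow> 'a set \<Rightarrow> 'a set \<Rightarrow> 'a set \<Rightarrow> bool" where
  "separates G S A B \<longleftrightarrow>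
     A \<subseteq> verts G \<and> B \<subseteq> verts G \<and> S \<subseteq> verts G \<and> A \<inter> B = {} \<and>
     (\<forall>q. vpath q G \<and> hd q \<in> A \<and> last q \<in> B \<longrightarrow> set q \<inter> S \<noteq> {})"

definition component_sigma ::
    "'w measure \<Rightarrow> (nat \<Rightarrow> real measure) \<Rightarrow> (int \<Rightarrow> 'w \<Rightarrow> nat \<Rightarrow> real) \<Rightarrow> nat set \<Rightarrow> 'w measure" where
  "component_sigma M \<mu> X A =
     sigma (space M) {(\<lambda>\<omega>. X t \<omega> b) -` U \<inter> space M | t b U. b \<in> A \<and> U \<in> sets (\<mu> b)}"

definition cond_indep :: "'w measure \<Rightarrow> 'w measure \<Rightarrow> 'w measure \<Rightarrow> 'w measure \<Rightarrow> bool" where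
  "cond_indep M F1 F2 F3 \<longleftrightarrow>
     (\<forall>m1 \<in> borel_measurable F1. \<forall>m2 \<in> borel_measurable F2.
        (\<exists>C. \<forall>\<omega>\<in>space M. 0 \<le> m1 \<omega> \<and> m1 \<omega> \<le> C) \<longrightarrow> (\<exists>C. \<forall>\<omega>\<in>space M. 0 \<le> m2 \<omega> \<and> m2 \<omega> \<le> C) \<longrightarrow>
        (AE \<omega> in M. real_cond_exp M F3 (\<lambda>\<omega>. m1 \<omega> * m2 \<omega>) \<omega> =
                     real_cond_exp M F3 m1 \<omega> * real_cond_exp M F3 m2 \<omega>))"

end

theory Submission
  imports Defs
begin

text \<open>
  Only the strict positivity of the kernel and the explicit block densities matter. Let \<open>A'\<close> be the
  set of components that can be reached from \<open>A\<close> without meeting \<open>S\<close>. The kernel factorizes into a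
  function of the components in \<open>A' \<union> S\<close> and a function of those outside \<open>A'\<close>, so in a finite window
  conditional independence holds given \<open>S\<close> and all that happens outside the window; the eigenfunctions
  \<open>v\<close> and \<open>w\<close>, which need not factorize, enter only at the boundary. The window must then grow, and
  the exchange of limits \<open>\<Inter>\<^sub>n (\<F>\<^sup>S \<or> \<F>\<^bsub>|t| \<ge> n\<^esub>) = \<F>\<^sup>S\<close> is the heart of the matter. For it, consider
  \<open>y\<^sub>n = E[Y | \<C> \<or> \<F>\<^bsub>t \<ge> n\<^esub>]\<close>, where \<open>\<C>\<close> is generated by any set of coordinates. Its increments tend
  to \<open>0\<close>, and by the Markov property \<open>y\<^sub>n\<close> depends on \<open>X\<^sub>n\<close> and the coordinates in \<open>\<C>\<close> only. An
  equivalent measure with density \<open>r w(X\<^sub>n) v(X\<^bsub>n+1\<^esub>) / R(X\<^sub>n, X\<^bsub>n+1\<^esub>)\<close> cuts the chain into independent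
  halves. Under it \<open>y\<^sub>n\<close> and \<open>y\<^bsub>n+1\<^esub>\<close> are conditionally independent given \<open>\<C>\<close>, hence, being close to
  each other, both are close to a \<open>\<C>\<close>-measurable function. By stationarity the cut densities are
  identically distributed, so this closeness carries over to the original measure.
\<close>

section \<open>Conditionally independent sub-sigma-algebras\<close>

lemma (in prob_space) sigma_finite_subalgebraI:
  "subalgebra M F \<Longrightarrow> sigma_finite_subalgebra M F"
  by (intro finite_measure_subalgebra_is_sigma_finite finite_measure_subalgebra.intro
        finite_measure_subalgebra_axioms.intro) unfold_locales

lemma subalgebra_density: "subalgebra (density M f) F \<longleftrightarrow> subalgebra M F"
  by (simp add: subalgebra_def)

lemma subalgebra_trans: "subalgebra M F \<Longrightarrow> subalgebra F G \<Longrightarrow> subalgebra M G"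
  by (auto simp: subalgebra_def)

text \<open>Two densities that agree on the sets of \<open>F\<close> define the same measure on
  \<open>F\<close>, and the integral of an \<open>F\<close>-measurable function sees only that
  measure.\<close>

lemma nn_integral_mult_eq_of_subalgebra:
  fixes f g Y :: "'a \<Rightarrow> ennreal"
  assumes F: "subalgebra M F"
    and [measurable]: "f \<in> borel_measurable M" "g \<in> borel_measurable M"
    and eq: "\<And>A. A \<in> sets F \<Longrightarrow> (\<integral>\<^sup>+x\<in>A. f x \<partial>M) = (\<integral>\<^sup>+x\<in>A. g x \<partial>M)"
    and Y: "Y \<in> borel_measurable F"
  shows "(\<integral>\<^sup>+x. Y x * f x \<partial>M) = (\<integral>\<^sup>+x. Y x * g x \<partial>M)"
proof -
  have FM: "A \<in> sets M" if "A \<in> sets F" for A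
    using that F by (auto simp: subalgebra_def)
  have Fd: "subalgebra (density M h) F" for h
    using F by (simp add: subalgebra_density)
  have [measurable]: "Y \<in> borel_measurable M"
    by (rule measurable_from_subalg[OF F Y])
  have "restr_to_subalg (density M f) F = restr_to_subalg (density M g) F"
  proof (rule measure_eqI)
    show "sets (restr_to_subalg (density M f) F) = sets (restr_to_subalg (density M g) F)"
      by (simp add: sets_restr_to_subalg[OF Fd])
  next
    fix A assume "A \<in> sets (restr_to_subalg (density M f) F)"
    then have A: "A \<in> sets F" by (simp add: sets_restr_to_subalg[OF Fd])
    show "emeasure (restr_to_subalg (density M f) F) A = emeasure (restr_to_subalg (density M g) F) A"
      using FM[OF A] eq[OF A] by (simp add: emeasure_restr_to_subalg[OF Fd A] emeasure_density)
  qed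
  then have "(\<integral>\<^sup>+x. Y x \<partial>density M f) = (\<integral>\<^sup>+x. Y x \<partial>density M g)"
    by (metis nn_integral_subalgebra2[OF Fd Y])
  then show ?thesis
    by (simp add: nn_integral_density mult.commute)
qed

text \<open>Uniqueness of measures on an intersection-stable generator, applied to the measures with
  densities \<open>f\<close> and \<open>g\<close>. By \<open>fin\<close> they are finite on the
  generator set \<open>space M\<close>, which serves as a constant exhausting sequence.\<close>

lemma set_nn_integral_eq_of_generator:
  fixes f g :: "'a \<Rightarrow> ennreal"
  assumes F: "subalgebra M F" "sets F = sigma_sets (space M) E"
    and E: "Int_stable E" "E \<subseteq> Pow (space M)" "space M \<in> E"
    and [measurable]: "f \<in> borel_measurable M" "g \<in> borel_measurable M"
    and fin: "(\<integral>\<^sup>+x. f x \<partial>M) \<noteq> \<infinity>"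
    and eq: "\<And>A. A \<in> E \<Longrightarrow> (\<integral>\<^sup>+x\<in>A. f x \<partial>M) = (\<integral>\<^sup>+x\<in>A. g x \<partial>M)"
    and A: "A \<in> sets F"
  shows "(\<integral>\<^sup>+x\<in>A. f x \<partial>M) = (\<integral>\<^sup>+x\<in>A. g x \<partial>M)"
proof -
  have FM: "A \<in> sets M" if "A \<in> sets F" for A
    using that F by (auto simp: subalgebra_def)
  have Fd: "subalgebra (density M h) F" for h
    using F by (simp add: subalgebra_density)
  have EF: "A \<in> sets F" if "A \<in> E" for A
    using that F(2) by auto
  have *: "emeasure (restr_to_subalg (density M h) F) B = (\<integral>\<^sup>+x\<in>B. h x \<partial>M)"
    if "B \<in> sets F" "h \<in> borel_measurable M" for B h
    using FM[OF that(1)] that by (simp add: emeasure_restr_to_subalg[OF Fd] emeasure_density)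
  have "restr_to_subalg (density M f) F = restr_to_subalg (density M g) F"
  proof (rule measure_eqI_generator_eq[OF E(1,2), where A="\<lambda>_. space M"])
    show "emeasure (restr_to_subalg (density M f) F) X = emeasure (restr_to_subalg (density M g) F) X"
      if "X \<in> E" for X
      using eq[OF that] EF[OF that] by (simp add: *)
    show "emeasure (restr_to_subalg (density M f) F) (space M) \<noteq> \<infinity>"
      using fin EF[OF E(3)] by (simp add: * nn_set_integral_space)
  qed (use E(3) F(2) in \<open>auto simp: sets_restr_to_subalg[OF Fd]\<close>)
  then show ?thesis
    using *[OF A] by (metis assms(6) assms(7))
qed

text \<open>Conditional independence in its Markov form, with the conditioning algebra contained in
  both sides: beyond \<open>G\<close>, the algebra \<open>F2\<close> contributes nothing to the
  prediction of \<open>F1\<close>. Functions with values in \<open>ennreal\<close> spare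
  integrability conditions, so unbounded densities can be inserted for \<open>Y\<close>.\<close>

definition cond_indep_alg :: "'a measure \<Rightarrow> 'a measure \<Rightarrow> 'a measure \<Rightarrow> 'a measure \<Rightarrow> bool" where
  "cond_indep_alg M F1 F2 G \<longleftrightarrow>
     subalgebra M F1 \<and> subalgebra M F2 \<and> subalgebra F1 G \<and> subalgebra F2 G \<and>
     (\<forall>Y\<in>borel_measurable F1. AE x in M. nn_cond_exp M F2 Y x = nn_cond_exp M G Y x)"

text \<open>The right-hand side of \<open>eq\<close> is the integral over \<open>A\<close> of the
  conditional probability of \<open>B\<close> given \<open>G\<close>. Hence both sides are measures
  in \<open>A\<close> and extend from \<open>E1\<close> to \<open>F1\<close>; after the conditioning
  has been moved from \<open>B\<close> to \<open>A\<close>, they extend in \<open>B\<close> from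
  \<open>E2\<close> to \<open>F2\<close>. Since \<open>G\<close> lies in both algebras, its sets are
  tested along with the others.\<close>

lemma (in prob_space) cond_indep_algI_generator:
  assumes F1: "subalgebra M F1" "sets F1 = sigma_sets (space M) E1"
    and F2: "subalgebra M F2" "sets F2 = sigma_sets (space M) E2"
    and G: "subalgebra F1 G" "subalgebra F2 G"
    and E1: "Int_stable E1" "E1 \<subseteq> Pow (space M)" "space M \<in> E1"
    and E2: "Int_stable E2" "E2 \<subseteq> Pow (space M)" "space M \<in> E2"
    and eq: "\<And>A B. A \<in> E1 \<Longrightarrow> B \<in> E2 \<Longrightarrow> emeasure M (A \<inter> B) =
      (\<integral>\<^sup>+x. nn_cond_exp M G (indicator A) x * nn_cond_exp M G (indicator B) x \<partial>M)"
  shows "cond_indep_alg M F1 F2 G"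
proof -
  have GM: "subalgebra M G" by (rule subalgebra_trans[OF F1(1) G(1)])
  interpret G: sigma_finite_subalgebra M G by (rule sigma_finite_subalgebraI[OF GM])
  interpret F2: sigma_finite_subalgebra M F2 by (rule sigma_finite_subalgebraI[OF F2(1)])
  have F1M: "A \<in> events" if "A \<in> sets F1" for A using that F1 by (auto simp: subalgebra_def)
  have F2M: "A \<in> events" if "A \<in> sets F2" for A using that F2 by (auto simp: subalgebra_def)
  have E1F: "A \<in> sets F1" if "A \<in> E1" for A using that F1(2) by auto
  have E2F: "A \<in> sets F2" if "A \<in> E2" for A using that F2(2) by auto
  have swap: "(\<integral>\<^sup>+x. f x * nn_cond_exp M G g x \<partial>M) = (\<integral>\<^sup>+x. nn_cond_exp M G f x * g x \<partial>M)"
    and mid: "(\<integral>\<^sup>+x. f x * nn_cond_exp M G g x \<partial>M) =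
      (\<integral>\<^sup>+x. nn_cond_exp M G f x * nn_cond_exp M G g x \<partial>M)"
    if [measurable]: "f \<in> borel_measurable M" "g \<in> borel_measurable M" for f g
    using G.nn_cond_exp_intg[of "nn_cond_exp M G f" g] G.nn_cond_exp_intg[of "nn_cond_exp M G g" f]
    by (simp_all add: mult.commute)
  have step1: "(\<integral>\<^sup>+x\<in>A. indicator B x \<partial>M) = (\<integral>\<^sup>+x\<in>A. nn_cond_exp M G (indicator B) x \<partial>M)"
    if A: "A \<in> sets F1" and B: "B \<in> E2" for A B
  proof (rule set_nn_integral_eq_of_generator[OF F1 E1 _ _ _ _ A])
    have [measurable]: "B \<in> events" by (rule F2M[OF E2F[OF B]])
    show "indicator B \<in> borel_measurable M" "nn_cond_exp M G (indicator B) \<in> borel_measurable M"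
      by measurable
    show "(\<integral>\<^sup>+ x. indicator B x \<partial>M) \<noteq> \<infinity>" by simp
    fix A assume A: "A \<in> E1"
    have [measurable]: "A \<in> events" by (rule F1M[OF E1F[OF A]])
    have "(\<integral>\<^sup>+x\<in>A. indicator B x \<partial>M) = emeasure M (A \<inter> B)"
      by (simp add: indicator_inter_arith[symmetric] Int_commute)
    then show "(\<integral>\<^sup>+x\<in>A. indicator B x \<partial>M) = (\<integral>\<^sup>+x\<in>A. nn_cond_exp M G (indicator B) x \<partial>M)"
      using eq[OF A B] mid[of "indicator A" "indicator B"] by (simp add: mult.commute)
  qed
  have step2: "(\<integral>\<^sup>+x\<in>B. indicator A x \<partial>M) = (\<integral>\<^sup>+x\<in>B. nn_cond_exp M G (indicator A) x \<partial>M)"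
    if A: "A \<in> sets F1" and B: "B \<in> sets F2" for A B
  proof (rule set_nn_integral_eq_of_generator[OF F2 E2 _ _ _ _ B])
    have [measurable]: "A \<in> events" by (rule F1M[OF A])
    show "indicator A \<in> borel_measurable M" "nn_cond_exp M G (indicator A) \<in> borel_measurable M"
      by measurable
    show "(\<integral>\<^sup>+ x. indicator A x \<partial>M) \<noteq> \<infinity>" by simp
    fix B assume B: "B \<in> E2"
    have [measurable]: "B \<in> events" by (rule F2M[OF E2F[OF B]])
    show "(\<integral>\<^sup>+x\<in>B. indicator A x \<partial>M) = (\<integral>\<^sup>+x\<in>B. nn_cond_exp M G (indicator A) x \<partial>M)"
      using step1[OF A B] swap[of "indicator A" "indicator B"] by (simp add: mult.commute)
  qed
  have "AE x in M. nn_cond_exp M F2 Y x = nn_cond_exp M G Y x" if Y: "Y \<in> borel_measurable F1" for Y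
  proof -
    have [measurable]: "Y \<in> borel_measurable M" by (rule measurable_from_subalg[OF F1(1) Y])
    have "AE x in M. nn_cond_exp M G Y x = nn_cond_exp M F2 Y x"
    proof (rule F2.nn_cond_exp_charact)
      show "nn_cond_exp M G Y \<in> borel_measurable F2"
        by (rule measurable_from_subalg[OF G(2)]) simp
      fix B assume B: "B \<in> sets F2"
      have [measurable]: "B \<in> events" by (rule F2M[OF B])
      have "(\<integral>\<^sup>+x. Y x * indicator B x \<partial>M) = (\<integral>\<^sup>+x. Y x * nn_cond_exp M G (indicator B) x \<partial>M)"
      proof (rule nn_integral_mult_eq_of_subalgebra[OF F1(1) _ _ _ Y])
        fix A assume A: "A \<in> sets F1"
        have [measurable]: "A \<in> events" by (rule F1M[OF A])
        show "(\<integral>\<^sup>+x\<in>A. indicator B x \<partial>M) = (\<integral>\<^sup>+x\<in>A. nn_cond_exp M G (indicator B) x \<partial>M)"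
          using step2[OF A B] swap[of "indicator A" "indicator B"] by (simp add: mult.commute)
      qed auto
      then show "(\<integral>\<^sup>+x\<in>B. Y x \<partial>M) = (\<integral>\<^sup>+x\<in>B. nn_cond_exp M G Y x \<partial>M)"
        using swap[of Y "indicator B"] by simp
    qed auto
    then show ?thesis by auto
  qed
  then show ?thesis
    using F1 F2 G by (auto simp: cond_indep_alg_def)
qed

text \<open>Bayes' formula in product form, which is meaningful even where the conditional
  expectation of \<open>K\<close> is 0 or infinite.\<close>

lemma (in prob_space) nn_cond_exp_Bayes:
  assumes G: "subalgebra M G"
    and [measurable]: "K \<in> borel_measurable M" "Y \<in> borel_measurable M"
    and P: "prob_space (density M K)"
  shows "AE x in M. nn_cond_exp (density M K) G Y x * nn_cond_exp M G K x =
    nn_cond_exp M G (\<lambda>x. Y x * K x) x"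
proof -
  interpret P: prob_space "density M K" by (rule P)
  have GP: "subalgebra (density M K) G" using G by (simp add: subalgebra_density)
  interpret G: sigma_finite_subalgebra M G by (rule sigma_finite_subalgebraI[OF G])
  interpret GP: sigma_finite_subalgebra "density M K" G by (rule P.sigma_finite_subalgebraI[OF GP])
  define Z where "Z = nn_cond_exp (density M K) G Y"
  have ZG[measurable]: "Z \<in> borel_measurable G" by (simp add: Z_def)
  have [measurable]: "Z \<in> borel_measurable M" by (rule measurable_from_subalg[OF G ZG])
  show ?thesis unfolding Z_def[symmetric]
  proof (rule G.nn_cond_exp_charact)
    fix A assume A[measurable]: "A \<in> sets G"
    have [measurable]: "A \<in> sets M" using A G by (auto simp: subalgebra_def)
    have "(\<integral>\<^sup>+x\<in>A. (Z x * nn_cond_exp M G K x) \<partial>M) = (\<integral>\<^sup>+x. (indicator A x * Z x) * nn_cond_exp M G K x \<partial>M)"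
      by (simp add: ac_simps)
    also have "\<dots> = (\<integral>\<^sup>+x. (indicator A x * Z x) * K x \<partial>M)"
      by (rule G.nn_cond_exp_intg) measurable
    also have "\<dots> = (\<integral>\<^sup>+x. indicator A x * Z x \<partial>density M K)"
      by (subst nn_integral_density) (auto simp: ac_simps)
    also have "\<dots> = (\<integral>\<^sup>+x. indicator A x * Y x \<partial>density M K)"
      unfolding Z_def by (rule GP.nn_cond_exp_intg) measurable
    also have "\<dots> = (\<integral>\<^sup>+x\<in>A. (Y x * K x) \<partial>M)"
      by (subst nn_integral_density) (auto simp: ac_simps)
    finally show "(\<integral>\<^sup>+x\<in>A. (Y x * K x) \<partial>M) = (\<integral>\<^sup>+x\<in>A. (Z x * nn_cond_exp M G K x) \<partial>M)" ..
  qed measurable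
qed

text \<open>The set where the conditional expectation vanishes belongs to \<open>F\<close>, so
  \<open>K\<close> has integral 0 over it; as \<open>K\<close> is positive, this set is
  null.\<close>

lemma (in sigma_finite_subalgebra) nn_cond_exp_pos:
  assumes [measurable]: "K \<in> borel_measurable M" and pos: "AE x in M. 0 < K x"
  shows "AE x in M. 0 < nn_cond_exp M F K x"
proof -
  define A where "A = {x\<in>space M. nn_cond_exp M F K x = 0}"
  have A[measurable]: "A \<in> sets F"
  proof -
    have "space M = space F" using subalg by (simp add: subalgebra_def)
    then show ?thesis unfolding A_def by simp measurable
  qed
  have AM[measurable]: "A \<in> sets M" using A subalg by (auto simp: subalgebra_def)
  have "(\<integral>\<^sup>+x. indicator A x * K x \<partial>M) = (\<integral>\<^sup>+x. indicator A x * nn_cond_exp M F K x \<partial>M)"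
    by (rule nn_cond_exp_intg[symmetric]) measurable
  also have "\<dots> = (\<integral>\<^sup>+x. 0 \<partial>M)"
    by (rule nn_integral_cong) (auto simp: A_def indicator_def)
  finally have "AE x in M. indicator A x * K x = 0"
    by (simp add: nn_integral_0_iff_AE)
  then have "AE x in M. x \<notin> A"
    using pos by eventually_elim (auto simp: indicator_def split: if_splits)
  then show ?thesis
    using AE_space by eventually_elim (auto simp: A_def zero_less_iff_neq_zero)
qed

text \<open>
  By Bayes' formula a conditional expectation given \<open>F2\<close> under the new measure is a quotient from
  which the factor \<open>K2\<close> cancels.
\<close>

lemma (in prob_space) cond_indep_alg_density:
  assumes ci: "cond_indep_alg M F1 F2 G"
    and K1: "K1 \<in> borel_measurable F1" and K2: "K2 \<in> borel_measurable F2"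
    and pos: "\<And>x. x \<in> space M \<Longrightarrow> 0 < K1 x" "\<And>x. x \<in> space M \<Longrightarrow> 0 < K2 x"
    and fin: "\<And>x. x \<in> space M \<Longrightarrow> K2 x < \<infinity>"
    and P: "prob_space (density M (\<lambda>x. K1 x * K2 x))"
  shows "cond_indep_alg (density M (\<lambda>x. K1 x * K2 x)) F1 F2 G"
proof -
  let ?P = "density M (\<lambda>x. K1 x * K2 x)"
  interpret P: prob_space ?P by (rule P)
  have sub: "subalgebra M F1" "subalgebra M F2" "subalgebra F1 G" "subalgebra F2 G"
    and ciY: "\<And>Y. Y \<in> borel_measurable F1 \<Longrightarrow> AE x in M. nn_cond_exp M F2 Y x = nn_cond_exp M G Y x"
    using ci by (auto simp: cond_indep_alg_def)
  have GM: "subalgebra M G" by (rule subalgebra_trans[OF sub(1,3)])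
  have subP: "subalgebra ?P F1" "subalgebra ?P F2" "subalgebra ?P G"
    using sub GM by (auto simp: subalgebra_density)
  interpret F2: sigma_finite_subalgebra M F2 by (rule sigma_finite_subalgebraI[OF sub(2)])
  interpret G: sigma_finite_subalgebra M G by (rule sigma_finite_subalgebraI[OF GM])
  interpret F2P: sigma_finite_subalgebra ?P F2 by (rule P.sigma_finite_subalgebraI[OF subP(2)])
  interpret GP: sigma_finite_subalgebra ?P G by (rule P.sigma_finite_subalgebraI[OF subP(3)])
  have [measurable]: "K1 \<in> borel_measurable M" "K2 \<in> borel_measurable M"
    using measurable_from_subalg[OF sub(1) K1] measurable_from_subalg[OF sub(2) K2] .
  have "AE x in ?P. nn_cond_exp ?P F2 Y x = nn_cond_exp ?P G Y x" if Y: "Y \<in> borel_measurable F1" for Y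
  proof -
    have [measurable]: "Y \<in> borel_measurable M" by (rule measurable_from_subalg[OF sub(1) Y])
    define Z where "Z = (\<lambda>x. nn_cond_exp M G (\<lambda>x. Y x * K1 x) x / nn_cond_exp M G K1 x)"
    have Z: "Z \<in> borel_measurable G" unfolding Z_def by measurable
    have ZF2: "Z \<in> borel_measurable F2" by (rule measurable_from_subalg[OF sub(4) Z])
    have [measurable]: "Z \<in> borel_measurable M" by (rule measurable_from_subalg[OF GM Z])
    have 1: "AE x in M. nn_cond_exp ?P F2 Y x * nn_cond_exp M F2 (\<lambda>x. K1 x * K2 x) x =
        nn_cond_exp M F2 (\<lambda>x. Y x * (K1 x * K2 x)) x"
      by (rule nn_cond_exp_Bayes[OF sub(2) _ _ P]) measurable
    have 2: "AE x in M. K2 x * nn_cond_exp M F2 K1 x = nn_cond_exp M F2 (\<lambda>x. K1 x * K2 x) x"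
      using F2.nn_cond_exp_prod[OF K2, of K1] by (simp add: mult.commute)
    have 3: "AE x in M. K2 x * nn_cond_exp M F2 (\<lambda>x. Y x * K1 x) x =
        nn_cond_exp M F2 (\<lambda>x. Y x * (K1 x * K2 x)) x"
      using F2.nn_cond_exp_prod[OF K2, of "\<lambda>x. Y x * K1 x"] by (simp add: ac_simps)
    have YK1: "(\<lambda>x. Y x * K1 x) \<in> borel_measurable F1"
      using Y K1 by measurable
    have 4: "AE x in M. 0 < nn_cond_exp M G K1 x"
      by (rule G.nn_cond_exp_pos) (use pos in auto)
    \<comment> \<open>The conditional expectation of the density has integral 1 and is therefore
      finite almost everywhere. This makes \<open>k\<close> finite below, as the division by it
      requires.\<close>
    have "(\<integral>\<^sup>+x. nn_cond_exp M F2 (\<lambda>x. K1 x * K2 x) x \<partial>M) = (\<integral>\<^sup>+x. K1 x * K2 x \<partial>M)"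
      using F2.nn_cond_exp_intg[of "\<lambda>_. 1" "\<lambda>x. K1 x * K2 x"] by simp
    also have "\<dots> = emeasure ?P (space ?P)"
      by (simp add: emeasure_density nn_set_integral_space)
    also have "\<dots> = 1" using P.emeasure_space_1 by simp
    finally have 5: "AE x in M. nn_cond_exp M F2 (\<lambda>x. K1 x * K2 x) x \<noteq> \<infinity>"
      by (intro nn_integral_PInf_AE) auto
    have "AE x in M. nn_cond_exp ?P F2 Y x = Z x"
      using 1 2 3 4 5 ciY[OF K1] ciY[OF YK1] AE_space
    proof eventually_elim
      case (elim x)
      define k where "k = nn_cond_exp M G K1 x"
      define a where "a = nn_cond_exp M G (\<lambda>x. Y x * K1 x) x"
      define z where "z = nn_cond_exp ?P F2 Y x"
      have k0: "k \<noteq> 0" using elim by (simp add: k_def)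
      have K2: "K2 x \<noteq> 0" "K2 x \<noteq> \<infinity>" using elim pos(2)[of x] fin[of x] by auto
      have "K2 x * k \<noteq> \<infinity>" using elim by (simp add: k_def)
      then have kf: "k \<noteq> \<infinity>" using K2 by (auto simp: ennreal_mult_eq_top_iff)
      have "z * (K2 x * k) = K2 x * a"
        using elim by (simp add: k_def a_def z_def)
      then have "(z * k) * K2 x = a * K2 x" by (simp add: ac_simps)
      then have "z * k = a"
        using K2 by (metis ennreal_mult_divide_eq infinity_ennreal_def)
      then have "z = a / k"
        using k0 kf ennreal_mult_divide_eq[of k z] by auto
      then show ?case by (simp add: z_def a_def k_def Z_def)
    qed
    then have *: "AE x in ?P. nn_cond_exp ?P F2 Y x = Z x"
      by (subst AE_density) auto
    \<comment> \<open>The quotient \<open>Z\<close> is already \<open>G\<close>-measurable, so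
      conditioning once more on \<open>G\<close> leaves it unchanged, and the tower property
      identifies it with the conditional expectation given \<open>G\<close>.\<close>
    have "AE x in ?P. nn_cond_exp ?P G Y x = nn_cond_exp ?P G (nn_cond_exp ?P F2 Y) x"
      by (rule GP.nn_cond_exp_nested_subalg[OF subP(2) sub(4)]) measurable
    moreover have "AE x in ?P. nn_cond_exp ?P G (nn_cond_exp ?P F2 Y) x = nn_cond_exp ?P G Z x"
      by (rule GP.nn_cond_exp_cong[OF *]) measurable
    moreover have "AE x in ?P. Z x = nn_cond_exp ?P G Z x"
      by (rule GP.nn_cond_exp_F_meas[OF Z])
    ultimately show ?thesis using * by eventually_elim simp
  qed
  then show ?thesis using subP sub by (auto simp: cond_indep_alg_def)
qed

lemma cond_indep_alg_nn_cond_exp: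
  "cond_indep_alg M F1 F2 G \<Longrightarrow> Y \<in> borel_measurable F1 \<Longrightarrow>
    AE x in M. nn_cond_exp M F2 Y x = nn_cond_exp M G Y x"
  by (auto simp: cond_indep_alg_def)

lemma cond_indep_alg_real_cond_exp:
  assumes "cond_indep_alg M F1 F2 G" and [measurable]: "Y \<in> borel_measurable F1"
  shows "AE x in M. real_cond_exp M F2 Y x = real_cond_exp M G Y x"
  using cond_indep_alg_nn_cond_exp[OF assms(1), of "\<lambda>x. ennreal (Y x)"]
    cond_indep_alg_nn_cond_exp[OF assms(1), of "\<lambda>x. ennreal (- Y x)"]
  by (auto simp: real_cond_exp_def)

text \<open>Condition on \<open>F2\<close> first: \<open>g\<close> can be taken out, and what
  remains of \<open>f\<close> is its conditional expectation given \<open>G\<close>. Then condition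
  on \<open>G\<close>, where that factor can be taken out in turn.\<close>

lemma (in prob_space) real_cond_exp_prod_of_cond_indep_alg:
  fixes f g :: "'a \<Rightarrow> real"
  assumes ci: "cond_indep_alg M F1 F2 G"
    and f: "f \<in> borel_measurable F1" and g: "g \<in> borel_measurable F2"
    and bdd: "\<And>x. x \<in> space M \<Longrightarrow> \<bar>f x\<bar> \<le> C" "\<And>x. x \<in> space M \<Longrightarrow> \<bar>g x\<bar> \<le> C'"
  shows "AE x in M. real_cond_exp M G (\<lambda>x. f x * g x) x = real_cond_exp M G f x * real_cond_exp M G g x"
proof -
  have sub: "subalgebra M F1" "subalgebra M F2" "subalgebra F1 G" "subalgebra F2 G"
    using ci by (auto simp: cond_indep_alg_def)
  have GM: "subalgebra M G" by (rule subalgebra_trans[OF sub(1,3)])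
  interpret F2: sigma_finite_subalgebra M F2 by (rule sigma_finite_subalgebraI[OF sub(2)])
  interpret G: sigma_finite_subalgebra M G by (rule sigma_finite_subalgebraI[OF GM])
  have [measurable]: "f \<in> borel_measurable M" "g \<in> borel_measurable M"
    using measurable_from_subalg[OF sub(1) f] measurable_from_subalg[OF sub(2) g] .
  have intg: "integrable M g"
    by (rule integrable_const_bound[where B=C']) (use bdd in auto)
  have intf: "integrable M f"
    by (rule integrable_const_bound[where B=C]) (use bdd in auto)
  have intfg: "integrable M (\<lambda>x. f x * g x)"
  proof (rule integrable_const_bound[where B="C * C'"])
    show "AE x in M. norm (f x * g x) \<le> C * C'"
    proof (rule AE_I2)
      fix x assume x: "x \<in> space M"
      then have "0 \<le> C" using bdd(1)[OF x] by linarith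
      then show "norm (f x * g x) \<le> C * C'"
        using bdd[OF x] by (simp add: abs_mult mult_mono)
    qed
  qed measurable
  have "AE x in M. real_cond_exp M G (\<lambda>x. f x * g x) x =
      real_cond_exp M G (real_cond_exp M F2 (\<lambda>x. f x * g x)) x"
    using G.real_cond_exp_nested_subalg[OF sub(2,4) intfg] by auto
  moreover have "AE x in M. real_cond_exp M F2 (\<lambda>x. f x * g x) x = g x * real_cond_exp M G f x"
  proof -
    have "AE x in M. real_cond_exp M F2 (\<lambda>x. g x * f x) x = g x * real_cond_exp M F2 f x"
      by (rule F2.real_cond_exp_mult[OF g]) (use intfg in \<open>auto simp: mult.commute\<close>)
    then show ?thesis
      using cond_indep_alg_real_cond_exp[OF ci f] by eventually_elim (simp add: mult.commute)
  qed
  then have "AE x in M. real_cond_exp M G (real_cond_exp M F2 (\<lambda>x. f x * g x)) x =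
      real_cond_exp M G (\<lambda>x. g x * real_cond_exp M G f x) x"
    by (rule G.real_cond_exp_cong) auto
  moreover have "AE x in M. real_cond_exp M G (\<lambda>x. real_cond_exp M G f x * g x) x =
      real_cond_exp M G f x * real_cond_exp M G g x"
  proof (rule G.real_cond_exp_mult)
    have "AE x in M. real_cond_exp M G f x \<ge> - C"
      by (rule G.real_cond_exp_ge_c[OF intf]) (rule AE_I2, use bdd in fastforce)
    moreover have "AE x in M. real_cond_exp M G f x \<le> C"
      by (rule G.real_cond_exp_le_c[OF intf]) (rule AE_I2, use bdd in fastforce)
    ultimately have "AE x in M. norm (real_cond_exp M G f x * g x) \<le> C * \<bar>C'\<bar>"
      using AE_space
    proof eventually_elim
      case (elim x)
      then have "\<bar>real_cond_exp M G f x\<bar> \<le> C" "\<bar>g x\<bar> \<le> \<bar>C'\<bar>"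
        using bdd(2)[of x] by auto
      then show ?case by (simp add: abs_mult mult_mono')
    qed
    then show "integrable M (\<lambda>x. real_cond_exp M G f x * g x)"
      by (intro integrable_const_bound) auto
  qed auto
  ultimately show ?thesis
    by eventually_elim (simp add: mult.commute)
qed

section \<open>Sigma-algebras generated by parts of a family of random variables\<close>

text \<open>Finite-dimensional rectangles instead of single preimages: they are stable under
  intersection and split along a union of index sets, which suits the product formulas for
  independent coordinates.\<close>

definition cylinder_events ::
    "'w set \<Rightarrow> ('i \<Rightarrow> 'v measure) \<Rightarrow> ('i \<Rightarrow> 'w \<Rightarrow> 'v) \<Rightarrow> 'i set \<Rightarrow> 'w set set" where
  "cylinder_events \<Omega> \<nu> \<xi> I =
     {{\<omega>\<in>\<Omega>. \<forall>i\<in>J. \<xi> i \<omega> \<in> U i} | J U. finite J \<and> J \<subseteq> I \<and> (\<forall>i\<in>J. U i \<in> sets (\<nu> i))}"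

definition generated_alg ::
    "'w set \<Rightarrow> ('i \<Rightarrow> 'v measure) \<Rightarrow> ('i \<Rightarrow> 'w \<Rightarrow> 'v) \<Rightarrow> 'i set \<Rightarrow> 'w measure" where
  "generated_alg \<Omega> \<nu> \<xi> I = sigma \<Omega> (cylinder_events \<Omega> \<nu> \<xi> I)"

lemma cylinder_eventsI:
  "finite J \<Longrightarrow> J \<subseteq> I \<Longrightarrow> (\<And>i. i \<in> J \<Longrightarrow> U i \<in> sets (\<nu> i)) \<Longrightarrow>
    A = {\<omega>\<in>\<Omega>. \<forall>i\<in>J. \<xi> i \<omega> \<in> U i} \<Longrightarrow> A \<in> cylinder_events \<Omega> \<nu> \<xi> I"
  unfolding cylinder_events_def by (rule CollectI, rule exI[of _ J], rule exI[of _ U]) auto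

lemma cylinder_eventsE:
  assumes "A \<in> cylinder_events \<Omega> \<nu> \<xi> I"
  obtains J U where "A = {\<omega>\<in>\<Omega>. \<forall>i\<in>J. \<xi> i \<omega> \<in> U i}" "finite J" "J \<subseteq> I" "\<And>i. i \<in> J \<Longrightarrow> U i \<in> sets (\<nu> i)"
proof -
  from assms have "\<exists>J U. A = {\<omega>\<in>\<Omega>. \<forall>i\<in>J. \<xi> i \<omega> \<in> U i} \<and> finite J \<and> J \<subseteq> I \<and> (\<forall>i\<in>J. U i \<in> sets (\<nu> i))"
    unfolding cylinder_events_def by (rule CollectD)
  then show thesis by (elim exE conjE) (rule that, auto)
qed

lemma cylinder_events_subset: "cylinder_events \<Omega> \<nu> \<xi> I \<subseteq> Pow \<Omega>"
  by (auto simp: cylinder_events_def)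

lemma space_in_cylinder_events: "\<Omega> \<in> cylinder_events \<Omega> \<nu> \<xi> I"
  by (rule cylinder_eventsI[of "{}"]) auto

lemma cylinder_events_mono: "I \<subseteq> I' \<Longrightarrow> cylinder_events \<Omega> \<nu> \<xi> I \<subseteq> cylinder_events \<Omega> \<nu> \<xi> I'"
  unfolding cylinder_events_def by blast

lemma Int_stable_cylinder_events: "Int_stable (cylinder_events \<Omega> \<nu> \<xi> I)"
proof (rule Int_stableI)
  fix A B assume AB: "A \<in> cylinder_events \<Omega> \<nu> \<xi> I" "B \<in> cylinder_events \<Omega> \<nu> \<xi> I"
  obtain J U where
      A: "A = {\<omega>\<in>\<Omega>. \<forall>i\<in>J. \<xi> i \<omega> \<in> U i}" "finite J" "J \<subseteq> I" "\<And>i. i \<in> J \<Longrightarrow> U i \<in> sets (\<nu> i)"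
    using AB(1) by (rule cylinder_eventsE) blast
  obtain J' U' where
      B: "B = {\<omega>\<in>\<Omega>. \<forall>i\<in>J'. \<xi> i \<omega> \<in> U' i}" "finite J'" "J' \<subseteq> I" "\<And>i. i \<in> J' \<Longrightarrow> U' i \<in> sets (\<nu> i)"
    using AB(2) by (rule cylinder_eventsE) blast
  define W where "W = (\<lambda>i. if i \<in> J then (if i \<in> J' then U i \<inter> U' i else U i) else U' i)"
  show "A \<inter> B \<in> cylinder_events \<Omega> \<nu> \<xi> I"
  proof (rule cylinder_eventsI[of "J \<union> J'" _ W])
    show "A \<inter> B = {\<omega>\<in>\<Omega>. \<forall>i\<in>J \<union> J'. \<xi> i \<omega> \<in> W i}"
      unfolding A(1) B(1) W_def by (auto split: if_splits)
  qed (use A B in \<open>auto simp: W_def\<close>)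
qed

lemma space_generated_alg [simp]: "space (generated_alg \<Omega> \<nu> \<xi> I) = \<Omega>"
  by (simp add: generated_alg_def space_measure_of_conv)

lemma sets_generated_alg:
  "sets (generated_alg \<Omega> \<nu> \<xi> I) = sigma_sets \<Omega> (cylinder_events \<Omega> \<nu> \<xi> I)"
  by (simp add: generated_alg_def cylinder_events_subset)

lemma cylinder_in_generated_alg:
  "A \<in> cylinder_events \<Omega> \<nu> \<xi> I \<Longrightarrow> A \<in> sets (generated_alg \<Omega> \<nu> \<xi> I)"
  by (simp add: sets_generated_alg)

lemma generated_alg_mono: "I \<subseteq> I' \<Longrightarrow> subalgebra (generated_alg \<Omega> \<nu> \<xi> I') (generated_alg \<Omega> \<nu> \<xi> I)"
  by (simp add: subalgebra_def sets_generated_alg sigma_sets_subseteq cylinder_events_mono)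

lemma sets_generated_alg_least:
  assumes "space F = \<Omega>" and \<xi>: "\<And>i. i \<in> I \<Longrightarrow> \<xi> i \<in> measurable F (\<nu> i)"
  shows "sets (generated_alg \<Omega> \<nu> \<xi> I) \<subseteq> sets F"
proof -
  have "A \<in> sets F" if A_cyl: "A \<in> cylinder_events \<Omega> \<nu> \<xi> I" for A
  proof -
    obtain J U where A: "A = {\<omega>\<in>\<Omega>. \<forall>i\<in>J. \<xi> i \<omega> \<in> U i}" "finite J" "J \<subseteq> I" "\<And>i. i \<in> J \<Longrightarrow> U i \<in> sets (\<nu> i)"
      using A_cyl by (rule cylinder_eventsE) blast
    have "{\<omega>\<in>space F. \<forall>i\<in>J. \<xi> i \<omega> \<in> U i} \<in> sets F"
    proof (rule sets.sets_Collect_finite_All[OF _ A(2)])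
      show "{\<omega>\<in>space F. \<xi> i \<omega> \<in> U i} \<in> sets F" if "i \<in> J" for i
        using measurable_sets[OF \<xi>[of i], of "U i"] that A by (auto simp: vimage_def Int_def conj_commute)
    qed
    then show ?thesis using A(1) assms(1) by simp
  qed
  then show ?thesis
    using assms(1) sets.sigma_sets_subset[of "cylinder_events \<Omega> \<nu> \<xi> I" F]
    by (auto simp: sets_generated_alg)
qed

lemma measurable_generated_alg:
  assumes "i \<in> I" "\<xi> i \<in> \<Omega> \<rightarrow> space (\<nu> i)"
  shows "\<xi> i \<in> measurable (generated_alg \<Omega> \<nu> \<xi> I) (\<nu> i)"
proof (rule measurableI)
  fix A assume A: "A \<in> sets (\<nu> i)"
  have "\<xi> i -` A \<inter> \<Omega> = {\<omega>\<in>\<Omega>. \<forall>j\<in>{i}. \<xi> j \<omega> \<in> A}" by auto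
  also have "\<dots> \<in> cylinder_events \<Omega> \<nu> \<xi> I"
    by (rule cylinder_eventsI[of "{i}" _ "\<lambda>_. A"]) (use assms A in auto)
  finally show "\<xi> i -` A \<inter> space (generated_alg \<Omega> \<nu> \<xi> I) \<in> sets (generated_alg \<Omega> \<nu> \<xi> I)"
    using cylinder_in_generated_alg by simp
qed (use assms in auto)

lemma cylinder_events_split:
  assumes "A \<in> cylinder_events \<Omega> \<nu> \<xi> (I \<union> I')"
  obtains B C where "A = B \<inter> C" "B \<in> cylinder_events \<Omega> \<nu> \<xi> I" "C \<in> cylinder_events \<Omega> \<nu> \<xi> I'"
proof -
  obtain J U where A: "A = {\<omega>\<in>\<Omega>. \<forall>i\<in>J. \<xi> i \<omega> \<in> U i}" "finite J" "J \<subseteq> I \<union> I'"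
      "\<And>i. i \<in> J \<Longrightarrow> U i \<in> sets (\<nu> i)"
    using assms by (rule cylinder_eventsE) blast
  show thesis
  proof (rule that)
    show "A = {\<omega>\<in>\<Omega>. \<forall>i\<in>J \<inter> I. \<xi> i \<omega> \<in> U i} \<inter> {\<omega>\<in>\<Omega>. \<forall>i\<in>J \<inter> I'. \<xi> i \<omega> \<in> U i}"
      using A(3) unfolding A(1) by blast
    show "{\<omega>\<in>\<Omega>. \<forall>i\<in>J \<inter> I. \<xi> i \<omega> \<in> U i} \<in> cylinder_events \<Omega> \<nu> \<xi> I"
      by (rule cylinder_eventsI[of "J \<inter> I" _ U]) (use A in auto)
    show "{\<omega>\<in>\<Omega>. \<forall>i\<in>J \<inter> I'. \<xi> i \<omega> \<in> U i} \<in> cylinder_events \<Omega> \<nu> \<xi> I'"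
      by (rule cylinder_eventsI[of "J \<inter> I'" _ U]) (use A in auto)
  qed
qed

section \<open>Independent blocks of coordinates and the conditional independence that they
  entail\<close>

definition indep_alg :: "'a measure \<Rightarrow> 'a measure \<Rightarrow> 'a measure \<Rightarrow> bool" where
  "indep_alg M F H \<longleftrightarrow> subalgebra M F \<and> subalgebra M H \<and>
     (\<forall>A\<in>sets F. \<forall>B\<in>sets H. emeasure M (A \<inter> B) = emeasure M A * emeasure M B)"

lemma indep_alg_commute: "indep_alg M F H \<longleftrightarrow> indep_alg M H F"
  unfolding indep_alg_def by (metis Int_commute mult.commute)

text \<open>Extension in two stages: from sets to \<open>f\<close> with a set of \<open>H\<close>
  held fixed, then from sets to \<open>g\<close> with \<open>f\<close> held fixed.\<close>

lemma nn_integral_indep_alg: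
  assumes ind: "indep_alg M F H" and f: "f \<in> borel_measurable F" and g: "g \<in> borel_measurable H"
  shows "(\<integral>\<^sup>+x. f x * g x \<partial>M) = (\<integral>\<^sup>+x. f x \<partial>M) * (\<integral>\<^sup>+x. g x \<partial>M)"
proof -
  have F: "subalgebra M F" and H: "subalgebra M H"
    and eq: "\<And>A B. A \<in> sets F \<Longrightarrow> B \<in> sets H \<Longrightarrow> emeasure M (A \<inter> B) = emeasure M A * emeasure M B"
    using ind by (auto simp: indep_alg_def)
  have [measurable]: "f \<in> borel_measurable M" "g \<in> borel_measurable M"
    using measurable_from_subalg[OF F f] measurable_from_subalg[OF H g] .
  have 1: "(\<integral>\<^sup>+x. f x * indicator B x \<partial>M) = (\<integral>\<^sup>+x. f x * emeasure M B \<partial>M)" if B: "B \<in> sets H" for B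
  proof (rule nn_integral_mult_eq_of_subalgebra[OF F _ _ _ f])
    have [measurable]: "B \<in> sets M" using B H by (auto simp: subalgebra_def)
    show "indicator B \<in> borel_measurable M" by measurable
    fix A assume A: "A \<in> sets F"
    then have [measurable]: "A \<in> sets M" using F by (auto simp: subalgebra_def)
    have "(\<integral>\<^sup>+x\<in>A. indicator B x \<partial>M) = emeasure M (A \<inter> B)"
      by (simp add: indicator_inter_arith[symmetric] Int_commute)
    then show "(\<integral>\<^sup>+x\<in>A. indicator B x \<partial>M) = (\<integral>\<^sup>+x\<in>A. emeasure M B \<partial>M)"
      using eq[OF A B] by (simp add: nn_integral_cmult_indicator mult.commute[of "emeasure M A"])
  qed auto
  have "(\<integral>\<^sup>+x. g x * f x \<partial>M) = (\<integral>\<^sup>+x. g x * (\<integral>\<^sup>+x. f x \<partial>M) \<partial>M)"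
  proof (rule nn_integral_mult_eq_of_subalgebra[OF H _ _ _ g])
    fix B assume B: "B \<in> sets H"
    then have [measurable]: "B \<in> sets M" using H by (auto simp: subalgebra_def)
    show "(\<integral>\<^sup>+x\<in>B. f x \<partial>M) = (\<integral>\<^sup>+x\<in>B. (\<integral>\<^sup>+x. f x \<partial>M) \<partial>M)"
      using 1[OF B] by (simp add: nn_integral_multc nn_integral_cmult_indicator)
  qed auto
  then show ?thesis
    by (simp add: nn_integral_multc mult.commute)
qed

locale rv_family = prob_space M for M :: "'w measure" +
  fixes \<nu> :: "'i \<Rightarrow> 'v measure" and \<xi> :: "'i \<Rightarrow> 'w \<Rightarrow> 'v" and T :: "'i set"
  assumes rv: "\<And>i. i \<in> T \<Longrightarrow> \<xi> i \<in> measurable M (\<nu> i)"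
begin

abbreviation alg :: "'i set \<Rightarrow> 'w measure" where
  "alg \<equiv> generated_alg (space M) \<nu> \<xi>"

abbreviation cyl :: "'i set \<Rightarrow> 'w set set" where
  "cyl \<equiv> cylinder_events (space M) \<nu> \<xi>"

lemma subalgebra_alg: "I \<subseteq> T \<Longrightarrow> subalgebra M (alg I)"
  unfolding subalgebra_def using sets_generated_alg_least[of M "space M" I \<xi> \<nu>] rv by auto

lemma rv_measurable_alg: "i \<in> I \<Longrightarrow> I \<subseteq> T \<Longrightarrow> \<xi> i \<in> measurable (alg I) (\<nu> i)"
  using rv[of i] by (intro measurable_generated_alg) (auto simp: measurable_def)

lemma cyl_events: "A \<in> cyl I \<Longrightarrow> I \<subseteq> T \<Longrightarrow> A \<in> events"
  using subalgebra_alg[of I] cylinder_in_generated_alg[of A "space M" \<nu> \<xi> I] by (auto simp: subalgebra_def)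

lemma indep_algI_cyl:
  assumes L: "L \<subseteq> T" and H: "H \<subseteq> T"
    and eq: "\<And>A B. A \<in> cyl L \<Longrightarrow> B \<in> cyl H \<Longrightarrow> emeasure M (A \<inter> B) = emeasure M A * emeasure M B"
  shows "indep_alg M (alg L) (alg H)"
proof -
  have ev: "cyl L \<subseteq> events" "cyl H \<subseteq> events" using cyl_events L H by auto
  have "indep_set (cyl L) (cyl H)"
  proof (rule indep_setI[OF ev])
    fix a b assume ab: "a \<in> cyl L" "b \<in> cyl H"
    show "prob (a \<inter> b) = prob a * prob b"
      using eq[OF ab] by (simp add: measure_def enn2real_mult)
  qed
  then have *: "indep_set (sigma_sets (space M) (cyl L)) (sigma_sets (space M) (cyl H))"
    by (rule indep_set_sigma_sets) (rule Int_stable_cylinder_events)+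
  have "emeasure M (A \<inter> B) = emeasure M A * emeasure M B" if "A \<in> sets (alg L)" "B \<in> sets (alg H)" for A B
    using indep_setD[OF *, of A B] that
    by (simp add: sets_generated_alg emeasure_eq_measure ennreal_mult)
  then show ?thesis
    using subalgebra_alg L H by (simp add: indep_alg_def)
qed

text \<open>Information \<open>H0\<close> from the independent side does not change the prediction
  of \<open>A\<close>. On a rectangle \<open>C \<inter> E\<close> the probability of
  \<open>E\<close> splits off, the defining property of the conditional expectation given
  \<open>alg L0\<close> applies to \<open>C\<close>, and the factor of \<open>E\<close> is merged
  again.\<close>

lemma nn_cond_exp_indep_alg:
  assumes ind: "indep_alg M (alg L) (alg H)" and L0: "L0 \<subseteq> L" and H0: "H0 \<subseteq> H" and T: "L \<subseteq> T" "H \<subseteq> T"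
    and A: "A \<in> sets (alg L)"
  shows "AE x in M. nn_cond_exp M (alg L0) (indicator A) x = nn_cond_exp M (alg (L0 \<union> H0)) (indicator A) x"
proof -
  have T0: "L0 \<union> H0 \<subseteq> T" "L0 \<subseteq> T" using L0 H0 T by auto
  interpret LH: sigma_finite_subalgebra M "alg (L0 \<union> H0)"
    by (rule sigma_finite_subalgebraI[OF subalgebra_alg[OF T0(1)]])
  interpret L: sigma_finite_subalgebra M "alg L0"
    by (rule sigma_finite_subalgebraI[OF subalgebra_alg[OF T0(2)]])
  have [measurable]: "A \<in> events" using A subalgebra_alg[OF T(1)] by (auto simp: subalgebra_def)
  let ?u = "nn_cond_exp M (alg L0) (indicator A)"
  have uL: "?u \<in> borel_measurable (alg L)"
    by (rule measurable_from_subalg[OF generated_alg_mono[OF L0]]) simp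
  show ?thesis
  proof (rule LH.nn_cond_exp_charact)
    show "?u \<in> borel_measurable (alg (L0 \<union> H0))"
      by (rule measurable_from_subalg[OF generated_alg_mono[of L0]]) auto
    fix S assume S: "S \<in> sets (alg (L0 \<union> H0))"
    show "(\<integral>\<^sup>+x\<in>S. indicator A x \<partial>M) = (\<integral>\<^sup>+x\<in>S. ?u x \<partial>M)"
    proof (rule set_nn_integral_eq_of_generator[OF subalgebra_alg[OF T0(1)] sets_generated_alg
          Int_stable_cylinder_events cylinder_events_subset space_in_cylinder_events _ _ _ _ S])
      fix S assume "S \<in> cyl (L0 \<union> H0)"
      then obtain C E where S: "S = C \<inter> E" and C: "C \<in> cyl L0" and E: "E \<in> cyl H0"
        by (rule cylinder_events_split)
      have [measurable]: "C \<in> events" "E \<in> events"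
        using cyl_events[OF C] cyl_events[OF E] T0 by auto
      have CL0: "C \<in> sets (alg L0)" and CL: "C \<in> sets (alg L)"
        using C cylinder_events_mono[OF L0] by (auto intro!: cylinder_in_generated_alg)
      have EH: "E \<in> sets (alg H)"
        using E cylinder_events_mono[OF H0] by (auto intro!: cylinder_in_generated_alg)
      have "(\<integral>\<^sup>+x\<in>S. indicator A x \<partial>M) = (\<integral>\<^sup>+x. (indicator A x * indicator C x) * indicator E x \<partial>M)"
        unfolding S by (simp add: indicator_inter_arith ac_simps)
      also have "\<dots> = (\<integral>\<^sup>+x. indicator A x * indicator C x \<partial>M) * (\<integral>\<^sup>+x. indicator E x \<partial>M)"
        by (rule nn_integral_indep_alg[OF ind]) (use A CL EH in measurable)
      also have "(\<integral>\<^sup>+x. indicator A x * indicator C x \<partial>M) = (\<integral>\<^sup>+x. indicator C x * ?u x \<partial>M)"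
        by (subst L.nn_cond_exp_intg) (use CL0 in \<open>auto simp: mult.commute\<close>)
      also have "(\<integral>\<^sup>+x. indicator C x * ?u x \<partial>M) * (\<integral>\<^sup>+x. indicator E x \<partial>M) =
          (\<integral>\<^sup>+x. (indicator C x * ?u x) * indicator E x \<partial>M)"
        by (rule nn_integral_indep_alg[OF ind, symmetric]) (use uL CL EH in measurable)
      also have "\<dots> = (\<integral>\<^sup>+x\<in>S. ?u x \<partial>M)"
        unfolding S by (simp add: indicator_inter_arith ac_simps)
      finally show "(\<integral>\<^sup>+x\<in>S. indicator A x \<partial>M) = (\<integral>\<^sup>+x\<in>S. ?u x \<partial>M)" .
    qed auto
  qed auto
qed

text \<open>Both index sets may reach into both independent blocks. What matters is that their
  surpluses over the common part lie in different blocks; these surpluses are then independent once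
  the common part is given.\<close>

lemma cond_indep_alg_of_indep_alg:
  assumes ind: "indep_alg M (alg L) (alg H)" and T: "L \<subseteq> T" "H \<subseteq> T" and LH: "L \<inter> H = {}"
    and I: "I1 \<subseteq> L \<union> H" "I2 \<subseteq> L \<union> H" "I1 - I2 \<subseteq> L" "I2 - I1 \<subseteq> H"
  shows "cond_indep_alg M (alg I1) (alg I2) (alg (I1 \<inter> I2))"
proof -
  \<comment> \<open>These are the traces of the common part on the two blocks: as
    \<open>I2 - I1\<close> avoids \<open>L\<close>, the set \<open>I2 \<inter> L\<close> is
    contained in \<open>I1\<close>, and likewise \<open>I1 \<inter> H\<close> in
    \<open>I2\<close>.\<close>
  define L0 H0 where "L0 = I2 \<inter> L" and "H0 = I1 \<inter> H"
  have I0: "I1 \<inter> I2 = L0 \<union> H0" and I1: "I1 = (I1 \<inter> L) \<union> H0" and I2: "I2 = L0 \<union> (I2 \<inter> H)"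
    using I LH by (auto simp: L0_def H0_def)
  have IT: "I1 \<subseteq> T" "I2 \<subseteq> T" "I1 \<inter> I2 \<subseteq> T" using I T by auto
  interpret G: sigma_finite_subalgebra M "alg (I1 \<inter> I2)"
    by (rule sigma_finite_subalgebraI[OF subalgebra_alg[OF IT(3)]])
  interpret L: sigma_finite_subalgebra M "alg L0"
    by (rule sigma_finite_subalgebraI[OF subalgebra_alg]) (use T in \<open>auto simp: L0_def\<close>)
  interpret H: sigma_finite_subalgebra M "alg H0"
    by (rule sigma_finite_subalgebraI[OF subalgebra_alg]) (use T in \<open>auto simp: H0_def\<close>)
  show ?thesis
  proof (rule cond_indep_algI_generator[OF subalgebra_alg[OF IT(1)] sets_generated_alg
        subalgebra_alg[OF IT(2)] sets_generated_alg generated_alg_mono generated_alg_mono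
        Int_stable_cylinder_events cylinder_events_subset space_in_cylinder_events
        Int_stable_cylinder_events cylinder_events_subset space_in_cylinder_events])
    fix S1 S2 assume S: "S1 \<in> cyl I1" "S2 \<in> cyl I2"
    obtain A B where S1: "S1 = A \<inter> B" and A: "A \<in> cyl (I1 \<inter> L)" and B: "B \<in> cyl H0"
      using S(1) I1 cylinder_events_split by metis
    obtain C E where S2: "S2 = C \<inter> E" and C: "C \<in> cyl L0" and E: "E \<in> cyl (I2 \<inter> H)"
      using S(2) I2 cylinder_events_split by metis
    have [measurable]: "A \<in> events" "B \<in> events" "C \<in> events" "E \<in> events"
      using cyl_events[OF A] cyl_events[OF B] cyl_events[OF C] cyl_events[OF E] T
      by (auto simp: L0_def H0_def)
    have meas: "A \<in> sets (alg L)" "C \<in> sets (alg L)" "B \<in> sets (alg H)" "E \<in> sets (alg H)"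
        "C \<in> sets (alg L0)" "B \<in> sets (alg H0)" "B \<in> sets (alg (I1 \<inter> I2))" "C \<in> sets (alg (I1 \<inter> I2))"
      using A B C E cylinder_events_mono[of "I1 \<inter> L" L "space M" \<nu> \<xi>] cylinder_events_mono[of L0 L "space M" \<nu> \<xi>]
        cylinder_events_mono[of H0 H "space M" \<nu> \<xi>] cylinder_events_mono[of "I2 \<inter> H" H "space M" \<nu> \<xi>]
        cylinder_events_mono[of H0 "L0 \<union> H0" "space M" \<nu> \<xi>] cylinder_events_mono[of L0 "L0 \<union> H0" "space M" \<nu> \<xi>]
      unfolding I0 by (intro cylinder_in_generated_alg; auto simp: L0_def H0_def)+
    let ?u = "nn_cond_exp M (alg L0) (indicator A)" and ?e = "nn_cond_exp M (alg H0) (indicator E)"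
    have uL: "?u \<in> borel_measurable (alg L)"
      by (rule measurable_from_subalg[OF generated_alg_mono[of L0 L]]) (auto simp: L0_def)
    have eH: "?e \<in> borel_measurable (alg H)"
      by (rule measurable_from_subalg[OF generated_alg_mono[of H0 H]]) (auto simp: H0_def)
    have u: "AE x in M. ?u x = nn_cond_exp M (alg (I1 \<inter> I2)) (indicator A) x"
      unfolding I0 by (rule nn_cond_exp_indep_alg[OF ind]) (use T meas in \<open>auto simp: L0_def H0_def\<close>)
    have e: "AE x in M. ?e x = nn_cond_exp M (alg (I1 \<inter> I2)) (indicator E) x"
      unfolding I0 Un_commute[of L0]
      by (rule nn_cond_exp_indep_alg[OF ind[unfolded indep_alg_commute[of M "alg L"]]])
        (use T meas in \<open>auto simp: L0_def H0_def\<close>)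
    have S12: "indicator S1 = (\<lambda>x. indicator B x * indicator A x :: ennreal)"
        "indicator S2 = (\<lambda>x. indicator C x * indicator E x :: ennreal)"
      by (auto simp: fun_eq_iff S1 S2 indicator_def)
    have 1: "AE x in M. indicator B x * nn_cond_exp M (alg (I1 \<inter> I2)) (indicator A) x =
        nn_cond_exp M (alg (I1 \<inter> I2)) (indicator S1) x"
      using G.nn_cond_exp_prod[of "indicator B" "indicator A"] meas
      by (simp add: S12)
    have 2: "AE x in M. indicator C x * nn_cond_exp M (alg (I1 \<inter> I2)) (indicator E) x =
        nn_cond_exp M (alg (I1 \<inter> I2)) (indicator S2) x"
      using G.nn_cond_exp_prod[of "indicator C" "indicator E"] meas
      by (simp add: S12)
    \<comment> \<open>Regroup the four events by independent blocks, integrate within each block,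
      and regroup the result by the algebras \<open>I1\<close> and \<open>I2\<close>.\<close>
    have "emeasure M (S1 \<inter> S2) = emeasure M ((A \<inter> C) \<inter> (B \<inter> E))"
      unfolding S1 S2 by (simp add: ac_simps)
    also have "\<dots> = emeasure M (A \<inter> C) * emeasure M (B \<inter> E)"
      using ind meas by (auto simp: indep_alg_def)
    also have "emeasure M (A \<inter> C) = (\<integral>\<^sup>+x. indicator C x * indicator A x \<partial>M)"
      by (simp add: indicator_inter_arith[symmetric] Int_commute)
    also have "\<dots> = (\<integral>\<^sup>+x. indicator C x * ?u x \<partial>M)"
      by (rule L.nn_cond_exp_intg[symmetric]) (use meas in auto)
    also have "emeasure M (B \<inter> E) = (\<integral>\<^sup>+x. indicator B x * indicator E x \<partial>M)"
      by (simp add: indicator_inter_arith[symmetric])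
    also have "\<dots> = (\<integral>\<^sup>+x. indicator B x * ?e x \<partial>M)"
      by (rule H.nn_cond_exp_intg[symmetric]) (use meas in auto)
    also have "(\<integral>\<^sup>+x. indicator C x * ?u x \<partial>M) * \<dots> = (\<integral>\<^sup>+x. (indicator C x * ?u x) * (indicator B x * ?e x) \<partial>M)"
      by (rule nn_integral_indep_alg[OF ind, symmetric]) (use uL eH meas in measurable)
    also have "\<dots> = (\<integral>\<^sup>+x. nn_cond_exp M (alg (I1 \<inter> I2)) (indicator S1) x *
        nn_cond_exp M (alg (I1 \<inter> I2)) (indicator S2) x \<partial>M)"
    proof (rule nn_integral_cong_AE)
      have swap: "(c * u) * (b * e) = (b * u) * (c * e)" for b c u e :: ennreal
        by (simp only: ac_simps)
      show "AE x in M. (indicator C x * ?u x) * (indicator B x * ?e x) =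
          nn_cond_exp M (alg (I1 \<inter> I2)) (indicator S1) x * nn_cond_exp M (alg (I1 \<inter> I2)) (indicator S2) x"
        using u e 1 2 by eventually_elim (simp only: swap)
    qed
    finally show "emeasure M (S1 \<inter> S2) = \<dots>" .
  qed auto
qed

end

section \<open>Convergence of conditional expectations along a cut family\<close>

lemma (in sigma_finite_subalgebra) integral_abs_real_cond_exp_le:
  assumes "integrable M f"
  shows "(\<integral>x. \<bar>real_cond_exp M F f x\<bar> \<partial>M) \<le> (\<integral>x. \<bar>f x\<bar> \<partial>M)"
proof -
  have abs_int: "integrable M (\<lambda>x. \<bar>f x\<bar>)" using assms by auto
  have "AE x in M. real_cond_exp M F f x \<le> real_cond_exp M F (\<lambda>x. \<bar>f x\<bar>) x"
    by (rule real_cond_exp_mono) (use assms abs_int in auto)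
  moreover have "AE x in M. real_cond_exp M F (\<lambda>x. (- 1) * f x) x \<le> real_cond_exp M F (\<lambda>x. \<bar>f x\<bar>) x"
    by (rule real_cond_exp_mono) (use assms abs_int in auto)
  ultimately have "AE x in M. \<bar>real_cond_exp M F f x\<bar> \<le> real_cond_exp M F (\<lambda>x. \<bar>f x\<bar>) x"
    using real_cond_exp_cmult[OF assms, of "- 1"] by eventually_elim linarith
  then have "(\<integral>x. \<bar>real_cond_exp M F f x\<bar> \<partial>M) \<le> (\<integral>x. real_cond_exp M F (\<lambda>x. \<bar>f x\<bar>) x \<partial>M)"
    using assms abs_int by (intro integral_mono_AE) (auto intro: real_cond_exp_int(1))
  then show ?thesis using real_cond_exp_int(2)[OF abs_int] by simp
qed

text \<open>Up to a factor 2 the conditional expectation is a best approximation in L1 too: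
  \<open>f - E f = (f - g) - E (f - g)\<close>, and conditioning is a contraction. It is the tool
  for turning closeness to some measurable function into closeness to the conditional
  expectation.\<close>

lemma (in sigma_finite_subalgebra) integral_abs_diff_real_cond_exp_le:
  assumes f: "integrable M f" and g: "integrable M g" "g \<in> borel_measurable F"
  shows "(\<integral>x. \<bar>f x - real_cond_exp M F f x\<bar> \<partial>M) \<le> 2 * (\<integral>x. \<bar>f x - g x\<bar> \<partial>M)"
proof -
  let ?h = "\<lambda>x. f x - g x"
  have h: "integrable M ?h" using f g by auto
  have eh: "integrable M (real_cond_exp M F ?h)" by (rule real_cond_exp_int(1)[OF h])
  have "AE x in M. \<bar>f x - real_cond_exp M F f x\<bar> \<le> \<bar>?h x\<bar> + \<bar>real_cond_exp M F ?h x\<bar>"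
    using real_cond_exp_diff[OF f g(1)] real_cond_exp_F_meas[OF g] by eventually_elim linarith
  then have "(\<integral>x. \<bar>f x - real_cond_exp M F f x\<bar> \<partial>M) \<le> (\<integral>x. \<bar>?h x\<bar> + \<bar>real_cond_exp M F ?h x\<bar> \<partial>M)"
    using f h eh real_cond_exp_int(1)[OF f] by (intro integral_mono_AE) auto
  also have "\<dots> = (\<integral>x. \<bar>?h x\<bar> \<partial>M) + (\<integral>x. \<bar>real_cond_exp M F ?h x\<bar> \<partial>M)"
    using h eh by simp
  finally show ?thesis using integral_abs_real_cond_exp_le[OF h] by linarith
qed

lemma (in prob_space) abs_real_cond_exp_le:
  assumes F: "subalgebra M F" and [measurable]: "f \<in> borel_measurable M" and bdd: "AE x in M. \<bar>f x\<bar> \<le> C"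
  shows "AE x in M. \<bar>real_cond_exp M F f x\<bar> \<le> C"
proof -
  interpret F: sigma_finite_subalgebra M F by (rule sigma_finite_subalgebraI[OF F])
  have int: "integrable M f"
    by (rule integrable_const_bound[where B=C]) (use bdd in auto)
  have "AE x in M. real_cond_exp M F f x \<ge> - C"
    by (rule F.real_cond_exp_ge_c[OF int]) (use bdd in eventually_elim, linarith)
  moreover have "AE x in M. real_cond_exp M F f x \<le> C"
    by (rule F.real_cond_exp_le_c[OF int]) (use bdd in eventually_elim, linarith)
  ultimately show ?thesis by eventually_elim linarith
qed

text \<open>
  The squared norms of a reverse martingale decrease, and their differences are the squared norms
  of its increments.
\<close>

lemma (in prob_space) reverse_martingale_increments:
  fixes Y :: "'a \<Rightarrow> real" and F :: "nat \<Rightarrow> 'a measure"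
  assumes F: "\<And>n. subalgebra M (F n)" "\<And>n. subalgebra (F n) (F (Suc n))"
    and [measurable]: "Y \<in> borel_measurable M" and bdd: "AE x in M. \<bar>Y x\<bar> \<le> 1"
  shows "(\<lambda>n. \<integral>x. \<bar>real_cond_exp M (F n) Y x - real_cond_exp M (F (Suc n)) Y x\<bar> \<partial>M) \<longlonglongrightarrow> 0"
proof -
  define y where "y n = real_cond_exp M (F n) Y" for n
  have [measurable]: "y n \<in> borel_measurable M" for n by (simp add: y_def)
  have y1: "AE x in M. \<bar>y n x\<bar> \<le> 1" for n
    unfolding y_def by (rule abs_real_cond_exp_le[OF F(1) _ bdd]) simp
  have intY: "integrable M Y"
    by (rule integrable_const_bound[where B=1]) (use bdd in auto)
  have bi: "integrable M f" if [measurable]: "f \<in> borel_measurable M" and "AE x in M. \<bar>f x\<bar> \<le> C" for f :: "'a \<Rightarrow> real" and C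
    by (rule integrable_const_bound[where B=C]) (use that in auto)
  have iy: "integrable M (y n)" for n by (rule bi[OF _ y1]) simp
  have iyy: "integrable M (\<lambda>x. y n x * y m x)" for n m
  proof (rule bi)
    show "AE x in M. \<bar>y n x * y m x\<bar> \<le> 1"
      using y1[of n] y1[of m] by eventually_elim (simp add: abs_mult mult_le_one)
  qed simp
  define a where "a n = (\<integral>x. y n x * y n x \<partial>M)" for n
  \<comment> \<open>The algebras decrease, so \<open>y (Suc n)\<close> is the orthogonal projection
    of \<open>y n\<close>.\<close>
  have cross: "(\<integral>x. y (Suc n) x * y n x \<partial>M) = a (Suc n)" for n
  proof -
    interpret S: sigma_finite_subalgebra M "F (Suc n)" by (rule sigma_finite_subalgebraI[OF F(1)])
    have "(\<integral>x. y (Suc n) x * y n x \<partial>M) = (\<integral>x. y (Suc n) x * real_cond_exp M (F (Suc n)) (y n) x \<partial>M)"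
      by (rule S.real_cond_exp_intg(2)[symmetric]) (auto simp: iyy, simp add: y_def)
    also have "\<dots> = (\<integral>x. y (Suc n) x * y (Suc n) x \<partial>M)"
    proof (rule integral_cong_AE)
      show "AE x in M. y (Suc n) x * real_cond_exp M (F (Suc n)) (y n) x = y (Suc n) x * y (Suc n) x"
        using S.real_cond_exp_nested_subalg[OF F(1) F(2) intY] by eventually_elim (simp add: y_def)
    qed auto
    finally show ?thesis by (simp add: a_def)
  qed
  have sq: "(\<integral>x. (y n x - y (Suc n) x)\<^sup>2 \<partial>M) = a n - a (Suc n)" for n
  proof -
    have "(\<integral>x. (y n x - y (Suc n) x)\<^sup>2 \<partial>M) =
        (\<integral>x. y n x * y n x - 2 * (y (Suc n) x * y n x) + y (Suc n) x * y (Suc n) x \<partial>M)"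
      by (rule Bochner_Integration.integral_cong) (auto simp: power2_eq_square algebra_simps)
    also have "\<dots> = a n - 2 * a (Suc n) + a (Suc n)"
      using iyy cross[of n] by (simp add: a_def)
    finally show ?thesis by simp
  qed
  have "decseq a"
  proof (rule decseq_SucI)
    show "a (Suc n) \<le> a n" for n
      using sq[of n] integral_nonneg_AE[of "\<lambda>x. (y n x - y (Suc n) x)\<^sup>2" M] by simp
  qed
  moreover have "0 \<le> a n" for n unfolding a_def by simp
  ultimately obtain l where "a \<longlonglongrightarrow> l"
    using decseq_convergent[of a 0] by blast
  then have d0: "(\<lambda>n. a n - a (Suc n)) \<longlonglongrightarrow> 0"
    using tendsto_diff[OF _ LIMSEQ_Suc, of a l a l] by simp
  show ?thesis unfolding y_def[symmetric]
  proof (rule LIMSEQ_I)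
    fix e :: real assume e: "0 < e"
    obtain N where N: "\<And>n. n \<ge> N \<Longrightarrow> norm (a n - a (Suc n) - 0) < (e / 2) * (e / 2)"
      using LIMSEQ_D[OF d0, of "(e/2) * (e/2)"] e by auto
    show "\<exists>N. \<forall>n\<ge>N. norm ((\<integral>x. \<bar>y n x - y (Suc n) x\<bar> \<partial>M) - 0) < e"
    proof (intro exI allI impI)
      fix n assume n: "n \<ge> N"
      have t: "a n - a (Suc n) < (e / 2) * (e / 2)"
        using N[OF n] unfolding diff_0_right real_norm_def abs_less_iff by blast
      have isq: "integrable M (\<lambda>x. (y n x - y (Suc n) x)\<^sup>2)"
      proof (rule bi)
        show "AE x in M. \<bar>(y n x - y (Suc n) x)\<^sup>2\<bar> \<le> 4"
          using y1[of n] y1[of "Suc n"]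
        proof eventually_elim
          case (elim x)
          then have "\<bar>y n x - y (Suc n) x\<bar> \<le> 2" by linarith
          then have "\<bar>y n x - y (Suc n) x\<bar>\<^sup>2 \<le> 2\<^sup>2" by (intro power_mono) auto
          then show ?case by simp
        qed
      qed simp
      \<comment> \<open>From L2 to L1 by the pointwise inequality
        \<open>d \<le> e / 2 + (2 / e) * d\<^sup>2\<close>: either \<open>d \<le> e / 2\<close>, or
        \<open>d * (e / 2) \<le> d * d\<close>. A squared norm below
        \<open>(e / 2) * (e / 2)\<close> then adds up to less than \<open>e\<close>.\<close>
      have "(\<integral>x. \<bar>y n x - y (Suc n) x\<bar> \<partial>M) \<le> (\<integral>x. e / 2 + (2 / e) * (y n x - y (Suc n) x)\<^sup>2 \<partial>M)"
      proof (rule integral_mono_AE)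
        show "AE x in M. \<bar>y n x - y (Suc n) x\<bar> \<le> e / 2 + (2 / e) * (y n x - y (Suc n) x)\<^sup>2"
        proof (rule AE_I2)
          fix x
          define d where "d = \<bar>y n x - y (Suc n) x\<bar>"
          have "d \<le> e / 2 + (2 / e) * d\<^sup>2"
          proof (cases "d \<le> e / 2")
            case True then show ?thesis using e by (simp add: add_increasing2)
          next
            case False
            then have "d * (e / 2) \<le> d * d" by (intro mult_left_mono) (auto simp: d_def)
            then have "d \<le> (2 / e) * d\<^sup>2" using e by (simp add: field_simps power2_eq_square)
            then show ?thesis using e by (simp add: add_increasing)
          qed
          then show "\<bar>y n x - y (Suc n) x\<bar> \<le> e / 2 + (2 / e) * (y n x - y (Suc n) x)\<^sup>2"
            by (simp add: d_def)
        qed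
      qed (use iy isq in auto)
      also have "\<dots> = e / 2 + (2 / e) * (a n - a (Suc n))"
        using isq by (simp add: sq[symmetric] prob_space)
      also have "\<dots> < e / 2 + (2 / e) * ((e / 2) * (e / 2))"
        using t e by (intro add_strict_left_mono mult_strict_left_mono) auto
      also have "\<dots> = e" using e by (simp add: field_simps)
      finally show "norm ((\<integral>x. \<bar>y n x - y (Suc n) x\<bar> \<partial>M) - 0) < e"
        by simp
    qed
  qed
qed

text \<open>An abstract cut, so that one argument serves both directions of time. \<open>D n\<close>
  severs \<open>B (Suc n)\<close> from its complement and depends only on the two layers next to
  this cut, one on either side.\<close>

locale cut_family = rv_family M \<nu> \<xi> T
  for M :: "'w measure" and \<nu> :: "'i \<Rightarrow> 'v measure" and \<xi> and T +
  fixes B :: "nat \<Rightarrow> 'i set" and D :: "nat \<Rightarrow> 'w \<Rightarrow> real"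
  assumes B_mono: "\<And>n. B n \<subseteq> B (Suc n)" and B_T: "\<And>n. B n \<subseteq> T"
    and D_pos: "\<And>n x. x \<in> space M \<Longrightarrow> 0 < D n x"
    and D_meas: "\<And>n. D n \<in> borel_measurable (alg (B (Suc (Suc n)) - B n))"
    and D_dist: "\<And>n. distr M borel (D n) = distr M borel (D 0)"
    and D_prob: "\<And>n. prob_space (density M (\<lambda>x. ennreal (D n x)))"
    and D_indep: "\<And>n. indep_alg (density M (\<lambda>x. ennreal (D n x))) (alg (B (Suc n))) (alg (T - B (Suc n)))"
begin

abbreviation cutm :: "nat \<Rightarrow> 'w measure" where
  "cutm n \<equiv> density M (\<lambda>x. ennreal (D n x))"

lemma D_measurable [measurable]: "D n \<in> borel_measurable M"
  by (rule measurable_from_subalg[OF subalgebra_alg D_meas]) (use B_T in blast)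

lemma rv_family_cutm: "rv_family (cutm n) \<nu> \<xi> T"
  by (intro rv_family.intro D_prob rv_family_axioms.intro) (simp add: rv)

lemma AE_cutm: "(AE x in cutm n. P x) \<longleftrightarrow> (AE x in M. P x)"
proof -
  have "(AE x in cutm n. P x) \<longleftrightarrow> (AE x in M. 0 < D n x \<longrightarrow> P x)"
    by (subst AE_density) auto
  also have "\<dots> \<longleftrightarrow> (AE x in M. P x)"
    by (rule AE_cong) (simp add: D_pos)
  finally show ?thesis .
qed

text \<open>Both claims come from the same cut. In the second one the left algebra is enlarged by
  one layer beyond the cut, so that it contains the density \<open>D n\<close> and the statement can
  be transferred back to \<open>M\<close>.\<close>

lemma cond_indep_alg_cutm:
  assumes C: "C \<subseteq> T"
  shows "cond_indep_alg (cutm n) (alg (B (Suc n))) (alg (C \<union> (T - B (Suc n)))) (alg (B (Suc n) \<inter> C))"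
    and "cond_indep_alg (cutm n) (alg (B (Suc (Suc n)))) (alg (C \<union> (T - B (Suc n))))
      (alg (B (Suc (Suc n)) \<inter> (C \<union> (T - B (Suc n)))))"
proof -
  interpret Q: rv_family "cutm n" \<nu> \<xi> T by (rule rv_family_cutm)
  have ind: "indep_alg (cutm n) (Q.alg (B (Suc n))) (Q.alg (T - B (Suc n)))"
    using D_indep[of n] by simp
  have eq: "B (Suc n) \<inter> (C \<union> (T - B (Suc n))) = B (Suc n) \<inter> C" by blast
  show "cond_indep_alg (cutm n) (alg (B (Suc n))) (alg (C \<union> (T - B (Suc n)))) (alg (B (Suc n) \<inter> C))"
    using Q.cond_indep_alg_of_indep_alg[OF ind, of "B (Suc n)" "C \<union> (T - B (Suc n))"] B_T C
    unfolding eq by auto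
  show "cond_indep_alg (cutm n) (alg (B (Suc (Suc n)))) (alg (C \<union> (T - B (Suc n))))
      (alg (B (Suc (Suc n)) \<inter> (C \<union> (T - B (Suc n)))))"
    using Q.cond_indep_alg_of_indep_alg[OF ind, of "B (Suc (Suc n))" "C \<union> (T - B (Suc n))"] B_T C B_mono
    by fastforce
qed

lemma density_cutm: "density (cutm n) (\<lambda>x. ennreal (1 / D n x)) = M"
proof -
  have "density (cutm n) (\<lambda>x. ennreal (1 / D n x)) = density M (\<lambda>x. 1)"
  proof (subst density_density_eq)
    show "density M (\<lambda>x. ennreal (D n x) * ennreal (1 / D n x)) = density M (\<lambda>x. 1)"
    proof (rule density_cong)
      show "AE x in M. ennreal (D n x) * ennreal (1 / D n x) = 1"
      proof (rule AE_I2)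
        fix x assume "x \<in> space M"
        then have "0 < D n x" by (rule D_pos)
        then show "ennreal (D n x) * ennreal (1 / D n x) = 1"
          by (simp add: ennreal_mult[symmetric])
      qed
    qed auto
  qed auto
  then show ?thesis by (simp add: density_1)
qed

text \<open>The cut is undone by the density \<open>1 / D n\<close>, which is measurable on the left
  side, so conditional independence survives. The result is the Markov property in the presence of
  the extra coordinates \<open>C\<close>.\<close>

lemma Markov_cut:
  assumes C: "C \<subseteq> T"
  shows "cond_indep_alg M (alg (B (Suc (Suc n)))) (alg (C \<union> (T - B (Suc n))))
    (alg (B (Suc (Suc n)) \<inter> (C \<union> (T - B (Suc n)))))"
proof -
  interpret Q: prob_space "cutm n" by (rule D_prob)
  have [measurable]: "D n \<in> borel_measurable (alg (B (Suc (Suc n))))"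
    by (rule measurable_from_subalg[OF generated_alg_mono D_meas]) auto
  have K: "(\<lambda>x. ennreal (1 / D n x)) \<in> borel_measurable (alg (B (Suc (Suc n))))"
    by measurable
  have "cond_indep_alg (density (cutm n) (\<lambda>x. ennreal (1 / D n x) * 1))
      (alg (B (Suc (Suc n)))) (alg (C \<union> (T - B (Suc n)))) (alg (B (Suc (Suc n)) \<inter> (C \<union> (T - B (Suc n)))))"
    by (rule Q.cond_indep_alg_density[OF cond_indep_alg_cutm(2)[OF C] K])
      (use D_pos prob_space_axioms in \<open>auto simp: density_cutm\<close>)
  then show ?thesis by (simp add: density_cutm)
qed

lemma integrable_D: "integrable M (D n)"
proof (rule integrableI_nonneg)
  show "AE x in M. 0 \<le> D n x" by (rule AE_I2) (simp add: D_pos less_imp_le)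
  have "(\<integral>\<^sup>+x. ennreal (D n x) \<partial>M) = emeasure (cutm n) (space (cutm n))"
    by (simp add: emeasure_density nn_set_integral_space)
  also have "\<dots> = 1" using D_prob[of n] by (rule prob_space.emeasure_space_1)
  finally show "(\<integral>\<^sup>+x. ennreal (D n x) \<partial>M) < \<infinity>" by simp
qed simp

text \<open>Both quantities depend on \<open>D n\<close> only through its law, hence not on
  \<open>n\<close>. For \<open>D 0\<close> they are made small by positivity, which makes small
  values rare, and by integrability, which makes the contribution of large values small.\<close>

lemma D_uniform:
  assumes "0 < (e::real)"
  obtains d c where "0 < d" "0 < c" "\<And>n. prob {x\<in>space M. D n x < d} \<le> e"
    "\<And>n. (\<integral>x. D n x * indicator {c<..} (D n x) \<partial>M) \<le> e"
proof -
  have transfer: "(\<integral>x. f (D n x) \<partial>M) = (\<integral>x. f (D 0 x) \<partial>M)" if [measurable]: "f \<in> borel_measurable borel"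
    for f :: "real \<Rightarrow> real" and n
    using D_dist[of n] integral_distr[of "D n" M borel f] integral_distr[of "D 0" M borel f] by simp
  note int = integrable_D[of 0]
  have prob_eq: "prob {x\<in>space M. D n x < d} = (\<integral>x. indicator {..<d} (D n x) \<partial>M)" for n d
  proof -
    have "(\<integral>x. indicator {..<d} (D n x) \<partial>M) = (\<integral>x. (indicator {x\<in>space M. D n x < d} x :: real) \<partial>M)"
      by (rule Bochner_Integration.integral_cong) (auto simp: indicator_def)
    then show ?thesis by simp
  qed
  have "(\<lambda>m. \<integral>x. (indicator {..<1 / Suc m} (D 0 x) :: real) \<partial>M) \<longlonglongrightarrow> (\<integral>x. 0 \<partial>M)"
  proof (rule integral_dominated_convergence[where w="\<lambda>_. 1"])
    show "AE x in M. (\<lambda>m. indicator {..<1 / Suc m} (D 0 x)) \<longlonglongrightarrow> (0::real)"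
    proof (rule AE_I2)
      fix x assume "x \<in> space M"
      then have "0 < D 0 x" by (rule D_pos)
      then have "\<forall>\<^sub>F m in sequentially. 1 / Suc m < D 0 x"
        using order_tendstoD(2)[OF LIMSEQ_inverse_real_of_nat, of "D 0 x"] by (simp add: inverse_eq_divide)
      then have "\<forall>\<^sub>F m in sequentially. indicator {..<1 / Suc m} (D 0 x) = (0::real)"
        by eventually_elim (simp add: indicator_def)
      then show "(\<lambda>m. indicator {..<1 / Suc m} (D 0 x)) \<longlonglongrightarrow> (0::real)"
        by (rule tendsto_eventually)
    qed
  qed (auto simp: indicator_def)
  then have "\<forall>\<^sub>F m in sequentially. (\<integral>x. indicator {..<1 / Suc m} (D 0 x) \<partial>M) < e"
    using assms by (intro order_tendstoD(2)[where y=0]) auto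
  then obtain m where m: "(\<integral>x. indicator {..<1 / Suc m} (D 0 x) \<partial>M) < e"
    using eventually_happens'[OF sequentially_bot] by blast
  have "(\<lambda>m. \<integral>x. D 0 x * indicator {real (Suc m)<..} (D 0 x) \<partial>M) \<longlonglongrightarrow> (\<integral>x. 0 \<partial>M)"
  proof (rule integral_dominated_convergence[where w="D 0"])
    show "AE x in M. (\<lambda>m. D 0 x * indicator {real (Suc m)<..} (D 0 x)) \<longlonglongrightarrow> 0"
    proof (rule AE_I2)
      fix x
      have "\<forall>\<^sub>F m in sequentially. D 0 x < real (Suc m)"
        by (rule eventually_sequentiallyI[of "nat \<lceil>D 0 x\<rceil>"]) linarith
      then have "\<forall>\<^sub>F m in sequentially. D 0 x * indicator {real (Suc m)<..} (D 0 x) = 0"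
        by eventually_elim (simp add: indicator_def)
      then show "(\<lambda>m. D 0 x * indicator {real (Suc m)<..} (D 0 x)) \<longlonglongrightarrow> 0"
        by (rule tendsto_eventually)
    qed
    show "AE x in M. norm (D 0 x * indicator {real (Suc m)<..} (D 0 x)) \<le> D 0 x" for m
      by (rule AE_I2) (auto simp: indicator_def D_pos less_imp_le)
  qed (use int in auto)
  then have "\<forall>\<^sub>F m in sequentially. (\<integral>x. D 0 x * indicator {real (Suc m)<..} (D 0 x) \<partial>M) < e"
    using assms by (intro order_tendstoD(2)[where y=0]) auto
  then obtain m' where m': "(\<integral>x. D 0 x * indicator {real (Suc m')<..} (D 0 x) \<partial>M) < e"
    using eventually_happens'[OF sequentially_bot] by blast
  show thesis
  proof (rule that[of "1 / Suc m" "real (Suc m')"])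
    show "prob {x\<in>space M. D n x < 1 / Suc m} \<le> e" for n
      using m transfer[of "indicator {..<1 / Suc m}" n] by (simp add: prob_eq)
    show "(\<integral>x. D n x * indicator {real (Suc m')<..} (D n x) \<partial>M) \<le> e" for n
      using m' transfer[of "\<lambda>y. y * indicator {real (Suc m')<..} y" n] by simp
  qed auto
qed

text \<open>Where \<open>D n\<close> exceeds \<open>c\<close>, use the bound 2 on \<open>f\<close>;
  elsewhere replace the density by \<open>c\<close>. The bound 2 is that of a difference of two
  functions with values between -1 and 1.\<close>

lemma integral_cutm_le:
  assumes [measurable]: "f \<in> borel_measurable M" and bdd: "AE x in M. \<bar>f x\<bar> \<le> 2" and c: "0 < c"
  shows "(\<integral>x. \<bar>f x\<bar> \<partial>cutm n) \<le>
    2 * (\<integral>x. D n x * indicator {c<..} (D n x) \<partial>M) + c * (\<integral>x. \<bar>f x\<bar> \<partial>M)"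
proof -
  have D0: "AE x in M. 0 \<le> D n x" by (rule AE_I2) (simp add: D_pos less_imp_le)
  have intf: "integrable M (\<lambda>x. \<bar>f x\<bar>)"
    by (rule integrable_const_bound[where B=2]) (use bdd in auto)
  have int1: "integrable M (\<lambda>x. D n x * indicator {c<..} (D n x))"
    by (rule Bochner_Integration.integrable_bound[OF integrable_D[of n]]) (auto simp: indicator_def)
  have "(\<integral>x. \<bar>f x\<bar> \<partial>cutm n) = (\<integral>x. D n x * \<bar>f x\<bar> \<partial>M)"
    by (subst integral_density) (use D0 in auto)
  also have "\<dots> \<le> (\<integral>x. 2 * (D n x * indicator {c<..} (D n x)) + c * \<bar>f x\<bar> \<partial>M)"
  proof (rule integral_mono_AE)
    show "integrable M (\<lambda>x. D n x * \<bar>f x\<bar>)"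
    proof (rule Bochner_Integration.integrable_bound[OF integrable_mult_right[OF integrable_D[of n], of 2]])
      show "AE x in M. norm (D n x * \<bar>f x\<bar>) \<le> norm (2 * D n x)"
        using bdd D0 by eventually_elim (simp add: abs_mult mult.commute[of 2] mult_left_mono)
    qed auto
    show "AE x in M. D n x * \<bar>f x\<bar> \<le> 2 * (D n x * indicator {c<..} (D n x)) + c * \<bar>f x\<bar>"
      using bdd D0
    proof eventually_elim
      case (elim x)
      show ?case
      proof (cases "c < D n x")
        case True
        have "D n x * \<bar>f x\<bar> \<le> D n x * 2" using elim by (intro mult_left_mono) auto
        moreover have "0 \<le> c * \<bar>f x\<bar>" using c by simp
        ultimately show ?thesis using True by (simp add: indicator_def)
      next
        case False
        then have "D n x * \<bar>f x\<bar> \<le> c * \<bar>f x\<bar>" by (intro mult_right_mono) auto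
        then show ?thesis using False by (simp add: indicator_def)
      qed
    qed
  qed (use intf int1 in auto)
  also have "\<dots> = 2 * (\<integral>x. D n x * indicator {c<..} (D n x) \<partial>M) + c * (\<integral>x. \<bar>f x\<bar> \<partial>M)"
    using intf int1 by simp
  finally show ?thesis .
qed

text \<open>The reverse comparison: the set where \<open>D n\<close> is below \<open>d\<close> has
  small probability and is estimated by the bound 2; elsewhere
  \<open>1 \<le> D n / d\<close>.\<close>

lemma integral_le_cutm:
  assumes [measurable]: "f \<in> borel_measurable M" and bdd: "AE x in M. \<bar>f x\<bar> \<le> 2" and d: "0 < d"
  shows "(\<integral>x. \<bar>f x\<bar> \<partial>M) \<le> 2 * prob {x\<in>space M. D n x < d} + (1 / d) * (\<integral>x. \<bar>f x\<bar> \<partial>cutm n)"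
proof -
  have D0: "AE x in M. 0 \<le> D n x" by (rule AE_I2) (simp add: D_pos less_imp_le)
  have intf: "integrable M (\<lambda>x. \<bar>f x\<bar>)"
    by (rule integrable_const_bound[where B=2]) (use bdd in auto)
  have intDf: "integrable M (\<lambda>x. D n x * \<bar>f x\<bar>)"
  proof (rule Bochner_Integration.integrable_bound[OF integrable_mult_right[OF integrable_D[of n], of 2]])
    show "AE x in M. norm (D n x * \<bar>f x\<bar>) \<le> norm (2 * D n x)"
      using bdd D0 by eventually_elim (simp add: abs_mult mult.commute[of 2] mult_left_mono)
  qed auto
  let ?A = "{x\<in>space M. D n x < d}"
  have intA: "integrable M (indicator ?A :: _ \<Rightarrow> real)"
    by (rule integrable_real_indicator) (auto simp: emeasure_eq_measure)
  have "(\<integral>x. \<bar>f x\<bar> \<partial>M) \<le> (\<integral>x. 2 * indicator ?A x + (1 / d) * (D n x * \<bar>f x\<bar>) \<partial>M)"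
  proof (rule integral_mono_AE)
    show "AE x in M. \<bar>f x\<bar> \<le> 2 * indicator ?A x + (1 / d) * (D n x * \<bar>f x\<bar>)"
      using bdd D0 AE_space
    proof eventually_elim
      case (elim x)
      show ?case
      proof (cases "D n x < d")
        case True
        have "0 \<le> (1 / d) * (D n x * \<bar>f x\<bar>)" using d elim by simp
        moreover have "indicator ?A x = (1::real)" using True elim by (simp add: indicator_def)
        ultimately show ?thesis using elim by linarith
      next
        case False
        then have "d * \<bar>f x\<bar> \<le> D n x * \<bar>f x\<bar>" by (intro mult_right_mono) auto
        then show ?thesis using False d by (simp add: indicator_def field_simps)
      qed
    qed
    show "integrable M (\<lambda>x. 2 * indicator ?A x + (1 / d) * (D n x * \<bar>f x\<bar>))"
      by (intro Bochner_Integration.integrable_add integrable_mult_right intDf intA)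
  qed (rule intf)
  also have "\<dots> = 2 * prob ?A + (1 / d) * (\<integral>x. D n x * \<bar>f x\<bar> \<partial>M)"
    by (subst Bochner_Integration.integral_add) (use intDf intA in auto)
  also have "(\<integral>x. D n x * \<bar>f x\<bar> \<partial>M) = (\<integral>x. \<bar>f x\<bar> \<partial>cutm n)"
    by (subst integral_density) (use D0 in auto)
  finally show ?thesis .
qed

text \<open>
  Under the cut measure the increment of the reverse martingale dominates its distance to a
  function measurable with respect to \<open>alg C\<close>, because its two terms lie on different sides of
  the cut. The cut densities are identically distributed, so smallness transfers uniformly between
  the cut measures and the original one.
\<close>

proposition tendsto_real_cond_exp_cut:
  assumes C: "C \<subseteq> T" and Y: "Y \<in> borel_measurable (alg (B k))" and bdd: "AE x in M. \<bar>Y x\<bar> \<le> 1"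
  shows "(\<lambda>n. \<integral>x. \<bar>real_cond_exp M (alg (C \<union> (T - B n))) Y x - real_cond_exp M (alg C) Y x\<bar> \<partial>M) \<longlonglongrightarrow> 0"
proof -
  define G where "G n = alg (C \<union> (T - B n))" for n
  define y where "y n = real_cond_exp M (G n) Y" for n
  define y' where "y' = real_cond_exp M (alg C) Y"
  have GM: "subalgebra M (G n)" for n unfolding G_def using C by (intro subalgebra_alg) auto
  have GS: "subalgebra (G n) (G (Suc n))" for n
    unfolding G_def using B_mono[of n] by (intro generated_alg_mono) auto
  have GC: "subalgebra (G n) (alg C)" for n unfolding G_def by (intro generated_alg_mono) auto
  have [measurable]: "y n \<in> borel_measurable M" "y' \<in> borel_measurable M" for n by (simp_all add: y_def y'_def)
  have YM[measurable]: "Y \<in> borel_measurable M"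
    by (rule measurable_from_subalg[OF subalgebra_alg[OF B_T] Y])
  have inc: "(\<lambda>n. \<integral>x. \<bar>y n x - y (Suc n) x\<bar> \<partial>M) \<longlonglongrightarrow> 0"
    unfolding y_def by (rule reverse_martingale_increments[of G, OF GM GS YM bdd])
  have y1: "AE x in M. \<bar>y n x\<bar> \<le> 1" for n
    unfolding y_def by (rule abs_real_cond_exp_le[OF GM YM bdd])
  have bi: "integrable M f" if [measurable]: "f \<in> borel_measurable M" and "AE x in M. \<bar>f x\<bar> \<le> b" for f :: "'w \<Rightarrow> real" and b
    by (rule integrable_const_bound[where B=b]) (use that in auto)
  have bi2: "integrable (cutm m) f" if [measurable]: "f \<in> borel_measurable M" and "AE x in M. \<bar>f x\<bar> \<le> b" for f :: "'w \<Rightarrow> real" and b m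
    by (rule finite_measure.integrable_const_bound[where B=b])
      (use that D_prob[of m] in \<open>auto simp: AE_cutm prob_space_def\<close>)
  have intY: "integrable M Y" by (rule bi[OF YM bdd])
  interpret C: sigma_finite_subalgebra M "alg C"
    by (rule sigma_finite_subalgebraI[OF subalgebra_alg[OF C]])
  have B_le: "m \<le> n \<Longrightarrow> B m \<subseteq> B n" for m n using lift_Suc_mono_le[of B m n] B_mono by blast
  have main: "(\<integral>x. \<bar>y (Suc n) x - y' x\<bar> \<partial>M) \<le>
      2 * (2 * prob {x\<in>space M. D (Suc n) x < d} + (1 / d) * (2 *
       (2 * (\<integral>x. D (Suc n) x * indicator {c<..} (D (Suc n) x) \<partial>M) + c * (\<integral>x. \<bar>y (Suc n) x - y (Suc (Suc n)) x\<bar> \<partial>M))))"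
    if n: "k \<le> Suc n" and d: "0 < d" and c: "0 < c" for n d c
  proof -
    \<comment> \<open>By the Markov property \<open>y (Suc n)\<close> agrees with \<open>z\<close>,
      which is measurable on \<open>B (Suc (Suc n))\<close>.\<close>
    define I where "I = B (Suc (Suc n)) \<inter> (C \<union> (T - B (Suc n)))"
    define z where "z = real_cond_exp M (alg I) Y"
    have YB: "Y \<in> borel_measurable (alg (B (Suc (Suc n))))"
      by (rule measurable_from_subalg[OF generated_alg_mono Y]) (use B_le n in auto)
    have yz: "AE x in M. y (Suc n) x = z x"
      unfolding y_def z_def G_def I_def by (rule cond_indep_alg_real_cond_exp[OF Markov_cut[OF C] YB])
    have zB: "z \<in> borel_measurable (alg (B (Suc (Suc n))))"
      unfolding z_def by (rule measurable_from_subalg[OF generated_alg_mono[of I]]) (auto simp: I_def)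
    have [measurable]: "z \<in> borel_measurable M" by (simp add: z_def)
    have z1: "AE x in M. \<bar>z x\<bar> \<le> 1" using yz y1[of "Suc n"] by eventually_elim simp
    \<comment> \<open>The cut is placed one layer later than the one behind the Markov property: it
      severs exactly \<open>B (Suc (Suc n))\<close>, so \<open>z\<close> lies before it, and
      \<open>y (Suc (Suc n))\<close> uses only \<open>C\<close> and what lies beyond it.\<close>
    let ?Q = "cutm (Suc n)"
    interpret Q: prob_space ?Q by (rule D_prob)
    have subQ: "subalgebra ?Q (G (Suc (Suc n)))" using GM by (simp add: subalgebra_density)
    interpret GQ: sigma_finite_subalgebra ?Q "G (Suc (Suc n))" by (rule Q.sigma_finite_subalgebraI[OF subQ])
    \<comment> \<open>Under the cut, predicting \<open>z\<close> from \<open>C\<close> and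
      everything beyond the cut reduces to the part of \<open>C\<close> before the cut. This is the
      desired function measurable with respect to \<open>alg C\<close>.\<close>
    define e where "e = real_cond_exp ?Q (alg (B (Suc (Suc n)) \<inter> C)) z"
    have eC: "e \<in> borel_measurable (alg C)"
      unfolding e_def by (rule measurable_from_subalg[OF generated_alg_mono[of "B (Suc (Suc n)) \<inter> C"]]) auto
    have [measurable]: "e \<in> borel_measurable M" by (rule measurable_from_subalg[OF C.subalg eC])
    have ee: "AE x in M. real_cond_exp ?Q (G (Suc (Suc n))) z x = e x"
      using cond_indep_alg_real_cond_exp[OF cond_indep_alg_cutm(1)[OF C] zB]
      unfolding e_def G_def AE_cutm .
    have e1: "AE x in M. \<bar>e x\<bar> \<le> 1"
    proof -
      have "AE x in ?Q. \<bar>real_cond_exp ?Q (G (Suc (Suc n))) z x\<bar> \<le> 1"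
        by (rule Q.abs_real_cond_exp_le[OF subQ]) (use z1 in \<open>auto simp: AE_cutm\<close>)
      then show ?thesis unfolding AE_cutm using ee by eventually_elim simp
    qed
    have zy2: "AE x in M. \<bar>z x - y (Suc (Suc n)) x\<bar> \<le> 2"
      using z1 y1[of "Suc (Suc n)"] by eventually_elim linarith
    have ze2: "AE x in M. \<bar>z x - e x\<bar> \<le> 2"
      using z1 e1 by eventually_elim linarith
    have 1: "(\<integral>x. \<bar>z x - y (Suc (Suc n)) x\<bar> \<partial>M) = (\<integral>x. \<bar>y (Suc n) x - y (Suc (Suc n)) x\<bar> \<partial>M)"
      by (rule integral_cong_AE) (use yz in auto)
    \<comment> \<open>Best approximation under the cut measure: \<open>e\<close> is the conditional
      expectation of \<open>z\<close> given \<open>G (Suc (Suc n))\<close>, and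
      \<open>y (Suc (Suc n))\<close> is a competitor.\<close>
    have 2: "(\<integral>x. \<bar>z x - e x\<bar> \<partial>?Q) \<le> 2 * (\<integral>x. \<bar>z x - y (Suc (Suc n)) x\<bar> \<partial>?Q)"
    proof -
      have "(\<integral>x. \<bar>z x - e x\<bar> \<partial>?Q) = (\<integral>x. \<bar>z x - real_cond_exp ?Q (G (Suc (Suc n))) z x\<bar> \<partial>?Q)"
        by (rule integral_cong_AE) (use ee in \<open>auto simp: AE_cutm\<close>)
      also have "\<dots> \<le> 2 * (\<integral>x. \<bar>z x - y (Suc (Suc n)) x\<bar> \<partial>?Q)"
        by (rule GQ.integral_abs_diff_real_cond_exp_le[OF bi2[OF _ z1] bi2[OF _ y1]])
          (auto simp: y_def[abs_def])
      finally show ?thesis .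
    qed
    \<comment> \<open>Best approximation under the original measure: by the tower property
      \<open>y'\<close> is the conditional expectation of \<open>z\<close> given
      \<open>alg C\<close>, and \<open>e\<close> is a competitor.\<close>
    have 3: "(\<integral>x. \<bar>y (Suc n) x - y' x\<bar> \<partial>M) \<le> 2 * (\<integral>x. \<bar>z x - e x\<bar> \<partial>M)"
    proof -
      have "AE x in M. real_cond_exp M (alg C) (y (Suc n)) x = y' x"
        unfolding y_def y'_def by (rule C.real_cond_exp_nested_subalg[OF GM GC intY])
      moreover have "AE x in M. real_cond_exp M (alg C) (y (Suc n)) x = real_cond_exp M (alg C) z x"
        by (rule C.real_cond_exp_cong[OF yz]) auto
      ultimately have "(\<integral>x. \<bar>y (Suc n) x - y' x\<bar> \<partial>M) = (\<integral>x. \<bar>z x - real_cond_exp M (alg C) z x\<bar> \<partial>M)"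
        using yz by (intro integral_cong_AE) auto
      also have "\<dots> \<le> 2 * (\<integral>x. \<bar>z x - e x\<bar> \<partial>M)"
        by (rule C.integral_abs_diff_real_cond_exp_le[OF bi[OF _ z1] bi[OF _ e1] eC]) auto
      finally show ?thesis .
    qed
    have 4: "(\<integral>x. \<bar>z x - e x\<bar> \<partial>M) \<le> 2 * prob {x\<in>space M. D (Suc n) x < d} + (1 / d) * (\<integral>x. \<bar>z x - e x\<bar> \<partial>?Q)"
      by (rule integral_le_cutm[OF _ ze2 d]) simp
    have 5: "(\<integral>x. \<bar>z x - y (Suc (Suc n)) x\<bar> \<partial>?Q) \<le>
        2 * (\<integral>x. D (Suc n) x * indicator {c<..} (D (Suc n) x) \<partial>M) + c * (\<integral>x. \<bar>y (Suc n) x - y (Suc (Suc n)) x\<bar> \<partial>M)"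
      unfolding 1[symmetric] by (rule integral_cutm_le[OF _ zy2 c]) simp
    have "(1 / d) * (\<integral>x. \<bar>z x - e x\<bar> \<partial>?Q) \<le> (1 / d) * (2 *
       (2 * (\<integral>x. D (Suc n) x * indicator {c<..} (D (Suc n) x) \<partial>M) + c * (\<integral>x. \<bar>y (Suc n) x - y (Suc (Suc n)) x\<bar> \<partial>M)))"
      using 2 5 d by (intro mult_left_mono) auto
    then have "2 * prob {x\<in>space M. D (Suc n) x < d} + (1 / d) * (\<integral>x. \<bar>z x - e x\<bar> \<partial>?Q) \<le>
      2 * prob {x\<in>space M. D (Suc n) x < d} + (1 / d) * (2 *
       (2 * (\<integral>x. D (Suc n) x * indicator {c<..} (D (Suc n) x) \<partial>M) + c * (\<integral>x. \<bar>y (Suc n) x - y (Suc (Suc n)) x\<bar> \<partial>M)))"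
      by (rule add_left_mono)
    from order_trans[OF 3 mult_left_mono[OF order_trans[OF 4 this]]] show ?thesis by simp
  qed
  have "(\<lambda>n. \<integral>x. \<bar>y (Suc n) x - y' x\<bar> \<partial>M) \<longlonglongrightarrow> 0"
  proof (rule LIMSEQ_I)
    fix r :: real assume r: "0 < r"
    \<comment> \<open>The order of choice matters: \<open>main\<close> divides the tail of the
      density by \<open>d\<close>, so \<open>c\<close> is chosen after \<open>d\<close>, and
      \<open>N\<close> after both. In total the bound is
      \<open>4 * (r / 16) + (4 / d) * 3 * (r * d / 32) = 5 * r / 8\<close>.\<close>
    have "0 < r / 16" using r by simp
    then obtain d c0 where d: "0 < d" and dP: "\<And>n. prob {x\<in>space M. D n x < d} \<le> r / 16"
      by (rule D_uniform) (rule that, assumption+)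
    have "0 < r * d / 32" using r d by simp
    then obtain d0 c where c: "0 < c" and cP: "\<And>n. (\<integral>x. D n x * indicator {c<..} (D n x) \<partial>M) \<le> r * d / 32"
      by (rule D_uniform) (rule that, assumption+)
    obtain N where N: "\<And>n. n \<ge> N \<Longrightarrow> norm ((\<integral>x. \<bar>y n x - y (Suc n) x\<bar> \<partial>M) - 0) < r * d / (32 * c)"
      using LIMSEQ_D[OF inc, of "r * d / (32 * c)"] r c d by auto
    show "\<exists>N. \<forall>n\<ge>N. norm ((\<integral>x. \<bar>y (Suc n) x - y' x\<bar> \<partial>M) - 0) < r"
    proof (intro exI allI impI)
      fix n assume n: "n \<ge> max N k"
      have "c * (\<integral>x. \<bar>y (Suc n) x - y (Suc (Suc n)) x\<bar> \<partial>M) \<le> c * (r * d / (32 * c))"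
        using N[of "Suc n"] n c by (intro mult_left_mono) auto
      then have inc': "c * (\<integral>x. \<bar>y (Suc n) x - y (Suc (Suc n)) x\<bar> \<partial>M) \<le> r * d / 32" using c by simp
      define q where "q = 2 * (\<integral>x. D (Suc n) x * indicator {c<..} (D (Suc n) x) \<partial>M) +
        c * (\<integral>x. \<bar>y (Suc n) x - y (Suc (Suc n)) x\<bar> \<partial>M)"
      have "q \<le> 3 * (r * d / 32)" using cP[of "Suc n"] inc' unfolding q_def by linarith
      then have h: "(1 / d) * (2 * q) \<le> (1 / d) * (2 * (3 * (r * d / 32)))"
        using d by (intro mult_left_mono) auto
      have "2 * (2 * prob {x\<in>space M. D (Suc n) x < d} + (1 / d) * (2 * q)) \<le>
          2 * (2 * (r / 16) + (1 / d) * (2 * (3 * (r * d / 32))))"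
        by (rule mult_left_mono[OF add_mono[OF mult_left_mono[OF dP[of "Suc n"]] h]]) auto
      moreover have "(\<integral>x. \<bar>y (Suc n) x - y' x\<bar> \<partial>M) \<le>
          2 * (2 * prob {x\<in>space M. D (Suc n) x < d} + (1 / d) * (2 * q))"
        unfolding q_def by (rule main) (use n d c in auto)
      ultimately have "(\<integral>x. \<bar>y (Suc n) x - y' x\<bar> \<partial>M) \<le> 2 * (2 * (r / 16) + (1 / d) * (2 * (3 * (r * d / 32))))"
        by (rule order_trans[rotated])
      also have "\<dots> = 5 * r / 8" using d by (simp add: field_simps)
      also have "\<dots> < r" using r by simp
      finally show "norm ((\<integral>x. \<bar>y (Suc n) x - y' x\<bar> \<partial>M) - 0) < r" by simp
    qed
  qed
  then show ?thesis unfolding y_def y'_def G_def by (rule LIMSEQ_imp_Suc)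
qed

end

section \<open>Iterated integrals along a chain\<close>

text \<open>The backward operator of an inhomogeneous chain: \<open>n\<close> steps from the state
  \<open>x\<close> at time \<open>m\<close>, with terminal function \<open>f\<close>. The kernel of
  a step is indexed by its arrival time.\<close>

primrec iterated_integral ::
    "'x measure \<Rightarrow> (int \<Rightarrow> 'x \<Rightarrow> 'x \<Rightarrow> ennreal) \<Rightarrow> ('x \<Rightarrow> ennreal) \<Rightarrow> nat \<Rightarrow> int \<Rightarrow> 'x \<Rightarrow> ennreal" where
  "iterated_integral N k f 0 m x = f x"
| "iterated_integral N k f (Suc n) m x = (\<integral>\<^sup>+y. k (m + 1) x y * iterated_integral N k f n (m + 1) y \<partial>N)"

lemma (in sigma_finite_measure) measurable_iterated_integral [measurable]:
  assumes [measurable]: "\<And>t. case_prod (k t) \<in> borel_measurable (M \<Otimes>\<^sub>M M)" "f \<in> borel_measurable M"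
  shows "iterated_integral M k f n m \<in> borel_measurable M"
proof (induction n arbitrary: m)
  case (Suc n)
  note [measurable] = Suc
  have "(\<lambda>x. \<integral>\<^sup>+y. case_prod (k (m + 1)) (x, y) * iterated_integral M k f n (m + 1) y \<partial>M) \<in> borel_measurable M"
    by measurable
  then show ?case by simp
next
  case 0
  have "iterated_integral M k f 0 m = f" for m by (simp add: fun_eq_iff)
  then show ?case by simp
qed

lemma iterated_integral_cong:
  assumes "\<And>t x y. m < t \<Longrightarrow> t \<le> m + int n \<Longrightarrow> x \<in> space N \<Longrightarrow> y \<in> space N \<Longrightarrow> k t x y = k' t x y"
    and "\<And>x. x \<in> space N \<Longrightarrow> f x = f' x" and "x \<in> space N"
  shows "iterated_integral N k f n m x = iterated_integral N k' f' n m x"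
  using assms
proof (induction n arbitrary: m x)
  case (Suc n)
  show ?case unfolding iterated_integral.simps
    by (intro nn_integral_cong arg_cong2[where f="(*)"] Suc.prems(1) Suc.IH)
      (use Suc.prems in auto)
qed simp

lemma iterated_integral_add:
  "iterated_integral N k f (n + j) m x = iterated_integral N k (iterated_integral N k f j (m + int n)) n m x"
  by (induction n arbitrary: m x) (simp_all add: add_ac)

lemma (in sigma_finite_measure) iterated_integral_multc:
  assumes [measurable]: "\<And>t. case_prod (k t) \<in> borel_measurable (M \<Otimes>\<^sub>M M)" "f \<in> borel_measurable M"
    and x: "x \<in> space M"
  shows "iterated_integral M k (\<lambda>x. f x * c) n m x = iterated_integral M k f n m x * c"
  using x
proof (induction n arbitrary: m x)
  case (Suc n)
  have "(\<integral>\<^sup>+y. k (m + 1) x y * iterated_integral M k (\<lambda>x. f x * c) n (m + 1) y \<partial>M) =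
      (\<integral>\<^sup>+y. (case_prod (k (m + 1)) (x, y) * iterated_integral M k f n (m + 1) y) * c \<partial>M)"
    by (rule nn_integral_cong) (simp add: Suc.IH mult.assoc)
  also have "\<dots> = (\<integral>\<^sup>+y. case_prod (k (m + 1)) (x, y) * iterated_integral M k f n (m + 1) y \<partial>M) * c"
    using Suc.prems by (intro nn_integral_multc) measurable
  finally show ?case by simp
qed simp

text \<open>This is how a cut decouples the chain: a step with kernel \<open>p x * q y\<close> makes
  the contribution of the future a constant, leaving \<open>p\<close> as the terminal function of
  the past and \<open>q\<close> as the initial weight of the future.\<close>

lemma (in sigma_finite_measure) nn_integral_iterated_integral_split:
  assumes k: "\<And>t. case_prod (k t) \<in> borel_measurable (M \<Otimes>\<^sub>M M)"
    and [measurable]: "f \<in> borel_measurable M" "F \<in> borel_measurable M" "p \<in> borel_measurable M" "q \<in> borel_measurable M"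
    and rank1: "\<And>x y. x \<in> space M \<Longrightarrow> y \<in> space M \<Longrightarrow> k (m + int n + 1) x y = p x * q y"
  shows "(\<integral>\<^sup>+x. F x * iterated_integral M k f (n + Suc j) m x \<partial>M) =
    (\<integral>\<^sup>+x. F x * iterated_integral M k p n m x \<partial>M) *
    (\<integral>\<^sup>+y. q y * iterated_integral M k f j (m + int n + 1) y \<partial>M)"
proof -
  note [measurable] = k
  let ?c = "\<integral>\<^sup>+y. q y * iterated_integral M k f j (m + int n + 1) y \<partial>M"
  have inner: "iterated_integral M k f (Suc j) (m + int n) x = p x * ?c" if "x \<in> space M" for x
  proof -
    have "iterated_integral M k f (Suc j) (m + int n) x =
        (\<integral>\<^sup>+y. p x * (q y * iterated_integral M k f j (m + int n + 1) y) \<partial>M)"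
      unfolding iterated_integral.simps
      by (rule nn_integral_cong) (simp add: rank1[OF that] mult.assoc)
    also have "\<dots> = p x * ?c" by (rule nn_integral_cmult) measurable
    finally show ?thesis .
  qed
  have "(\<integral>\<^sup>+x. F x * iterated_integral M k f (n + Suc j) m x \<partial>M) =
      (\<integral>\<^sup>+x. F x * iterated_integral M k p n m x * ?c \<partial>M)"
  proof (rule nn_integral_cong)
    fix x assume x: "x \<in> space M"
    have "iterated_integral M k f (n + Suc j) m x = iterated_integral M k (\<lambda>x. p x * ?c) n m x"
      unfolding iterated_integral_add by (rule iterated_integral_cong[OF _ inner x]) auto
    also have "\<dots> = iterated_integral M k p n m x * ?c"
      by (rule iterated_integral_multc[OF k _ x]) measurable
    finally show "F x * iterated_integral M k f (n + Suc j) m x = F x * iterated_integral M k p n m x * ?c"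
      by (simp add: mult.assoc)
  qed
  also have "\<dots> = (\<integral>\<^sup>+x. F x * iterated_integral M k p n m x \<partial>M) * ?c"
    by (rule nn_integral_multc) measurable
  finally show ?thesis .
qed

text \<open>Integrating out the last coordinate turns the terminal function \<open>f\<close> into
  \<open>f'\<close> and shortens the chain, hence the induction over all \<open>f\<close>.
  Coordinate \<open>t\<close> stands for time \<open>m + int t - 1\<close>.\<close>

lemma (in sigma_finite_measure) nn_integral_PiM_chain:
  assumes k: "\<And>t. case_prod (k t) \<in> borel_measurable (M \<Otimes>\<^sub>M M)"
    and F[measurable]: "F \<in> borel_measurable M" and f: "f \<in> borel_measurable M"
  shows "(\<integral>\<^sup>+x. F (x 1) * (\<Prod>t\<in>{2..Suc n}. k (m + int t - 1) (x (t - 1)) (x t)) * f (x (Suc n))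
      \<partial>PiM {1..Suc n} (\<lambda>_. M)) = (\<integral>\<^sup>+x. F x * iterated_integral M k f n m x \<partial>M)"
  using f
proof (induction n arbitrary: f)
  case 0
  interpret product_sigma_finite "\<lambda>_::nat. M" by standard
  note [measurable] = 0
  show ?case
    using product_nn_integral_singleton[of "\<lambda>x. F x * f x" 1] by simp
next
  case (Suc n)
  interpret product_sigma_finite "\<lambda>_::nat. M" by standard
  note [measurable] = Suc.prems
  have kk: "(\<lambda>x. k t (g x) (h x)) \<in> borel_measurable L"
    if "g \<in> measurable L M" "h \<in> measurable L M" for t g h and L :: "'z measure"
    using measurable_compose[OF measurable_Pair[OF that] k[of t]] by simp
  let ?P = "\<lambda>n x. \<Prod>t\<in>{2..Suc n}. k (m + int t - 1) (x (t - 1)) (x t)"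
  define f' where "f' x = (\<integral>\<^sup>+y. k (m + int n + 1) x y * f y \<partial>M)" for x
  have f': "f' \<in> borel_measurable M"
  proof -
    have "(\<lambda>x. \<integral>\<^sup>+y. case_prod (k (m + int n + 1)) (x, y) * f y \<partial>M) \<in> borel_measurable M"
      using k by measurable
    then show ?thesis by (simp add: f'_def[abs_def])
  qed
  have I: "{1..Suc (Suc n)} = insert (Suc (Suc n)) {1..Suc n}" by auto
  have P[measurable]: "?P n' \<in> borel_measurable (PiM {1..Suc n'} (\<lambda>_. M))" for n'
    by (intro borel_measurable_prod_ennreal kk measurable_component_singleton) auto
  have "(\<integral>\<^sup>+x. F (x 1) * ?P (Suc n) x * f (x (Suc (Suc n))) \<partial>PiM {1..Suc (Suc n)} (\<lambda>_. M)) =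
      (\<integral>\<^sup>+x. \<integral>\<^sup>+y. F ((x(Suc (Suc n) := y)) 1) * ?P (Suc n) (x(Suc (Suc n) := y)) *
        f ((x(Suc (Suc n) := y)) (Suc (Suc n))) \<partial>M \<partial>PiM {1..Suc n} (\<lambda>_. M))"
    unfolding I
  proof (rule product_nn_integral_insert)
    have "(\<lambda>x. F (x 1) * ?P (Suc n) x * f (x (Suc (Suc n)))) \<in> borel_measurable (PiM {1..Suc (Suc n)} (\<lambda>_. M))"
      by (intro borel_measurable_times_ennreal P measurable_compose[OF _ F] measurable_compose[OF _ Suc.prems]
          measurable_component_singleton) auto
    then show "(\<lambda>x. F (x 1) * ?P (Suc n) x * f (x (Suc (Suc n)))) \<in> borel_measurable (PiM (insert (Suc (Suc n)) {1..Suc n}) (\<lambda>_. M))"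
      unfolding I .
  qed auto
  also have "\<dots> = (\<integral>\<^sup>+x. F (x 1) * ?P n x * f' (x (Suc n)) \<partial>PiM {1..Suc n} (\<lambda>_. M))"
  proof (rule nn_integral_cong)
    fix x assume x: "x \<in> space (PiM {1..Suc n} (\<lambda>_. M))"
    have xn: "x (Suc n) \<in> space M" using x by (auto simp: space_PiM)
    have *: "F ((x(Suc (Suc n) := y)) 1) * ?P (Suc n) (x(Suc (Suc n) := y)) *
        f ((x(Suc (Suc n) := y)) (Suc (Suc n))) =
        (F (x 1) * ?P n x) * (k (m + int n + 1) (x (Suc n)) y * f y)" for y
    proof -
      have "{2..Suc (Suc n)} = insert (Suc (Suc n)) {2..Suc n}" by auto
      then have "?P (Suc n) (x(Suc (Suc n) := y)) =
          k (m + int n + 1) (x (Suc n)) y * (\<Prod>t\<in>{2..Suc n}. k (m + int t - 1) ((x(Suc (Suc n) := y)) (t - 1)) ((x(Suc (Suc n) := y)) t))"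
        by (simp add: add.assoc add.commute)
      also have "(\<Prod>t\<in>{2..Suc n}. k (m + int t - 1) ((x(Suc (Suc n) := y)) (t - 1)) ((x(Suc (Suc n) := y)) t)) = ?P n x"
        by (rule prod.cong) auto
      finally show ?thesis by (simp add: ac_simps)
    qed
    show "(\<integral>\<^sup>+y. F ((x(Suc (Suc n) := y)) 1) * ?P (Suc n) (x(Suc (Suc n) := y)) *
        f ((x(Suc (Suc n) := y)) (Suc (Suc n))) \<partial>M) = F (x 1) * ?P n x * f' (x (Suc n))"
      unfolding * f'_def
      by (intro nn_integral_cmult borel_measurable_times_ennreal kk) (use xn Suc.prems in auto)
  qed
  also have "\<dots> = (\<integral>\<^sup>+x. F x * iterated_integral M k f' n m x \<partial>M)"
    by (rule Suc.IH[OF f'])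
  also have "\<dots> = (\<integral>\<^sup>+x. F x * iterated_integral M k f (Suc n) m x \<partial>M)"
  proof -
    have "f' = iterated_integral M k f (Suc 0) (m + int n)" by (simp add: f'_def fun_eq_iff)
    then show ?thesis using iterated_integral_add[of M k f n "Suc 0" m] by simp
  qed
  finally show ?case .
qed

section \<open>Cutting a chain with positive kernel\<close>

text \<open>Positivity is required at every point, so that quotients by the kernel are defined
  without exceptional sets. The base measures are only sigma-finite; \<open>h\<close> turns each of
  them into a probability measure from which independent coordinates can be drawn.\<close>

locale positive_chain = prob_space M + product_sigma_finite \<mu>
  for M :: "'w measure" and \<mu> :: "'c \<Rightarrow> 'v measure" +
  fixes V :: "'c set" and X :: "int \<Rightarrow> 'w \<Rightarrow> 'c \<Rightarrow> 'v"
    and R :: "('c \<Rightarrow> 'v) \<Rightarrow> ('c \<Rightarrow> 'v) \<Rightarrow> real" and r :: real and v w :: "('c \<Rightarrow> 'v) \<Rightarrow> real"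
    and h :: "'c \<Rightarrow> 'v \<Rightarrow> real"
  assumes finite_V: "finite V"
    and X_meas: "\<And>t. X t \<in> measurable M (PiM V \<mu>)"
    and R_meas: "case_prod R \<in> borel_measurable (PiM V \<mu> \<Otimes>\<^sub>M PiM V \<mu>)"
    and v_meas: "v \<in> borel_measurable (PiM V \<mu>)" and w_meas: "w \<in> borel_measurable (PiM V \<mu>)"
    and R_pos: "\<And>x y. 0 < R x y" and v_pos: "\<And>x. 0 < v x" and w_pos: "\<And>x. 0 < w x" and r_pos: "0 < r"
    and block: "\<And>m n. 1 \<le> n \<Longrightarrow> distr M (\<Pi>\<^sub>M t\<in>{1..n}. PiM V \<mu>) (process_block X m n) =
      density (\<Pi>\<^sub>M t\<in>{1..n}. PiM V \<mu>) (\<lambda>x. ennreal (block_density R r v w n x))"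
    and h_meas: "\<And>c. c \<in> V \<Longrightarrow> h c \<in> borel_measurable (\<mu> c)"
    and h_pos: "\<And>c x. 0 < h c x"
    and h_one: "\<And>c. c \<in> V \<Longrightarrow> (\<integral>\<^sup>+x. ennreal (h c x) \<partial>\<mu> c) = 1"
begin

abbreviation N :: "('c \<Rightarrow> 'v) measure" where "N \<equiv> PiM V \<mu>"

sublocale N: sigma_finite_measure N
  by (rule sigma_finite[OF finite_V])

lemma kernel_measurable [measurable (raw)]:
  "f \<in> measurable L N \<Longrightarrow> g \<in> measurable L N \<Longrightarrow> (\<lambda>x. R (f x) (g x)) \<in> borel_measurable L"
  using measurable_compose[OF measurable_Pair R_meas, of f L g] by simp

declare v_meas [measurable] w_meas [measurable] X_meas [measurable]

lemma process_block_measurable [measurable]: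
  "process_block X m n \<in> measurable M (\<Pi>\<^sub>M t\<in>{1..n}. N)"
  unfolding process_block_def by measurable

text \<open>The site weights \<open>g\<close> serve as indicators of events, the transition weights
  \<open>c\<close> as the factors of a cut density. A block of \<open>Suc n\<close> times has
  \<open>n\<close> transitions, and each takes one of the \<open>n\<close> factors
  \<open>1 / r\<close> of the block density.\<close>

lemma block_expectation_nat:
  fixes g :: "int \<Rightarrow> ('c \<Rightarrow> 'v) \<Rightarrow> ennreal" and c :: "int \<Rightarrow> ('c \<Rightarrow> 'v) \<Rightarrow> ('c \<Rightarrow> 'v) \<Rightarrow> ennreal"
  assumes g[measurable]: "\<And>t. g t \<in> borel_measurable N"
    and c: "\<And>t. case_prod (c t) \<in> borel_measurable (N \<Otimes>\<^sub>M N)"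
  shows "(\<integral>\<^sup>+\<omega>. (\<Prod>t\<in>{1..Suc n}. g (m + int t - 1) (X (m + int t - 1) \<omega>)) *
      (\<Prod>t\<in>{2..Suc n}. c (m + int t - 1) (X (m + int t - 2) \<omega>) (X (m + int t - 1) \<omega>)) \<partial>M) =
    (\<integral>\<^sup>+x. (ennreal (v x) * g m x) * iterated_integral N
      (\<lambda>t x y. ennreal (R x y / r) * c t x y * g t y) (\<lambda>x. ennreal (w x)) n m x \<partial>N)"
proof -
  let ?PM = "PiM {1..Suc n} (\<lambda>_. N)"
  have cc: "(\<lambda>x. c t (a x) (b x)) \<in> borel_measurable L"
    if "a \<in> measurable L N" "b \<in> measurable L N" for t a b and L :: "'z measure"
    using measurable_compose[OF measurable_Pair[OF that] c[of t]] by simp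
  have k: "case_prod (\<lambda>x y. ennreal (R x y / r) * c t x y * g t y) \<in> borel_measurable (N \<Otimes>\<^sub>M N)" for t
    using c[of t] by (simp add: case_prod_beta') measurable
  define \<Psi> where "\<Psi> x = (\<Prod>t\<in>{1..Suc n}. g (m + int t - 1) (x t)) *
      (\<Prod>t\<in>{2..Suc n}. c (m + int t - 1) (x (t - 1)) (x t))" for x :: "nat \<Rightarrow> 'c \<Rightarrow> 'v"
  have comp: "(\<lambda>x. x t) \<in> measurable ?PM N" if "t \<in> {1..Suc n}" for t
    by (rule measurable_component_singleton[OF that])
  have \<Psi>[measurable]: "\<Psi> \<in> borel_measurable ?PM"
    unfolding \<Psi>_def
    by (intro borel_measurable_times_ennreal borel_measurable_prod_ennreal cc measurable_compose[OF comp g] comp) auto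
  have bd[measurable]: "(\<lambda>x. ennreal (block_density R r v w (Suc n) x)) \<in> borel_measurable ?PM"
    unfolding block_density_def
    by (intro measurable_compose[OF _ measurable_ennreal] borel_measurable_times borel_measurable_const
        borel_measurable_prod kernel_measurable measurable_compose[OF comp v_meas] measurable_compose[OF comp w_meas] comp) auto
  have "(\<integral>\<^sup>+\<omega>. (\<Prod>t\<in>{1..Suc n}. g (m + int t - 1) (X (m + int t - 1) \<omega>)) *
      (\<Prod>t\<in>{2..Suc n}. c (m + int t - 1) (X (m + int t - 2) \<omega>) (X (m + int t - 1) \<omega>)) \<partial>M) =
      (\<integral>\<^sup>+\<omega>. \<Psi> (process_block X m (Suc n) \<omega>) \<partial>M)"
  proof (rule nn_integral_cong, unfold \<Psi>_def, intro arg_cong2[where f="(*)"] prod.cong refl)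
    fix \<omega> t assume t: "t \<in> {2..Suc n}"
    have "m + int (t - 1) - 1 = m + int t - 2" using t by auto
    then show "c (m + int t - 1) (X (m + int t - 2) \<omega>) (X (m + int t - 1) \<omega>) =
        c (m + int t - 1) (process_block X m (Suc n) \<omega> (t - 1)) (process_block X m (Suc n) \<omega> t)"
      using t by (auto simp: process_block_def)
  qed (auto simp: process_block_def)
  also have "\<dots> = (\<integral>\<^sup>+x. \<Psi> x \<partial>distr M ?PM (process_block X m (Suc n)))"
    by (rule nn_integral_distr[symmetric]) measurable
  also have "\<dots> = (\<integral>\<^sup>+x. ennreal (block_density R r v w (Suc n) x) * \<Psi> x \<partial>?PM)"
  proof -
    have "distr M ?PM (process_block X m (Suc n)) = density ?PM (\<lambda>x. ennreal (block_density R r v w (Suc n) x))"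
      by (rule block) simp
    then show ?thesis by (simp only: nn_integral_density[OF bd \<Psi>])
  qed
  also have "\<dots> = (\<integral>\<^sup>+x. (ennreal (v (x 1)) * g m (x 1)) *
      (\<Prod>t\<in>{2..Suc n}. ennreal (R (x (t - 1)) (x t) / r) * c (m + int t - 1) (x (t - 1)) (x t) * g (m + int t - 1) (x t)) *
      ennreal (w (x (Suc n))) \<partial>?PM)"
  proof (rule nn_integral_cong)
    fix x :: "nat \<Rightarrow> 'c \<Rightarrow> 'v"
    define \<pi> where "\<pi> = (\<Prod>t\<in>{2..Suc n}. R (x (t - 1)) (x t) / r)"
    have "block_density R r v w (Suc n) x = v (x 1) * \<pi> * w (x (Suc n))"
      unfolding block_density_def \<pi>_def prod_dividef by simp
    moreover have "0 \<le> \<pi>" using R_pos r_pos by (simp add: \<pi>_def prod_nonneg less_imp_le)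
    moreover have "ennreal \<pi> = (\<Prod>t\<in>{2..Suc n}. ennreal (R (x (t - 1)) (x t) / r))"
      unfolding \<pi>_def by (rule prod_ennreal[symmetric]) (use R_pos r_pos in \<open>simp add: less_imp_le\<close>)
    ultimately have bd: "ennreal (block_density R r v w (Suc n) x) =
        ennreal (v (x 1)) * (\<Prod>t\<in>{2..Suc n}. ennreal (R (x (t - 1)) (x t) / r)) * ennreal (w (x (Suc n)))"
      using v_pos[of "x 1"] w_pos[of "x (Suc n)"] by (simp add: ennreal_mult less_imp_le)
    have "{1..Suc n} = insert 1 {2..Suc n}" by auto
    then have g: "(\<Prod>t\<in>{1..Suc n}. g (m + int t - 1) (x t)) =
        g m (x 1) * (\<Prod>t\<in>{2..Suc n}. g (m + int t - 1) (x t))"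
      by simp
    show "ennreal (block_density R r v w (Suc n) x) * \<Psi> x = (ennreal (v (x 1)) * g m (x 1)) *
      (\<Prod>t\<in>{2..Suc n}. ennreal (R (x (t - 1)) (x t) / r) * c (m + int t - 1) (x (t - 1)) (x t) * g (m + int t - 1) (x t)) *
      ennreal (w (x (Suc n)))"
      unfolding bd \<Psi>_def g by (simp only: prod.distrib ac_simps)
  qed
  also have "\<dots> = (\<integral>\<^sup>+x. (ennreal (v x) * g m x) * iterated_integral N
      (\<lambda>t x y. ennreal (R x y / r) * c t x y * g t y) (\<lambda>x. ennreal (w x)) n m x \<partial>N)"
    by (rule N.nn_integral_PiM_chain[OF k]) measurable
  finally show ?thesis .
qed

lemma block_expectation:
  fixes g :: "int \<Rightarrow> ('c \<Rightarrow> 'v) \<Rightarrow> ennreal" and c :: "int \<Rightarrow> ('c \<Rightarrow> 'v) \<Rightarrow> ('c \<Rightarrow> 'v) \<Rightarrow> ennreal"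
  assumes g: "\<And>t. g t \<in> borel_measurable N"
    and c: "\<And>t. case_prod (c t) \<in> borel_measurable (N \<Otimes>\<^sub>M N)" and m: "m \<le> m'"
  shows "(\<integral>\<^sup>+\<omega>. (\<Prod>t\<in>{m..m'}. g t (X t \<omega>)) * (\<Prod>t\<in>{m<..m'}. c t (X (t - 1) \<omega>) (X t \<omega>)) \<partial>M) =
    (\<integral>\<^sup>+x. (ennreal (v x) * g m x) * iterated_integral N
      (\<lambda>t x y. ennreal (R x y / r) * c t x y * g t y) (\<lambda>x. ennreal (w x)) (nat (m' - m)) m x \<partial>N)"
proof -
  define n where "n = nat (m' - m)"
  have m': "m' = m + int n" using m by (simp add: n_def)
  have 1: "(\<Prod>t\<in>{m..m'}. g t (X t \<omega>)) = (\<Prod>t\<in>{1..Suc n}. g (m + int t - 1) (X (m + int t - 1) \<omega>))" for \<omega>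
    by (rule prod.reindex_bij_witness[of _ "\<lambda>t. m + int t - 1" "\<lambda>t. nat (t - m + 1)"]) (auto simp: m')
  have 2: "(\<Prod>t\<in>{m<..m'}. c t (X (t - 1) \<omega>) (X t \<omega>)) =
      (\<Prod>t\<in>{2..Suc n}. c (m + int t - 1) (X (m + int t - 2) \<omega>) (X (m + int t - 1) \<omega>))" for \<omega>
    by (rule prod.reindex_bij_witness[of _ "\<lambda>t. m + int t - 1" "\<lambda>t. nat (t - m + 1)"]) (auto simp: m')
  show ?thesis unfolding 1 2 n_def[symmetric] by (rule block_expectation_nat[OF g c])
qed

section \<open>Cut densities and the product formula for the cut chain\<close>

definition href :: "('c \<Rightarrow> 'v) \<Rightarrow> real" where
  "href x = (\<Prod>c\<in>V. h c (x c))"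

lemma href_pos: "0 < href x" by (simp add: href_def prod_pos h_pos)

lemma href_meas [measurable]: "href \<in> borel_measurable N"
proof -
  have "(\<lambda>x. h c (x c)) \<in> borel_measurable N" if "c \<in> V" for c
    by (rule measurable_compose[OF measurable_component_singleton[OF that, of \<mu>] h_meas[OF that]])
  then show ?thesis unfolding href_def[abs_def] by (rule borel_measurable_prod)
qed

definition cut_left :: "int \<Rightarrow> int \<Rightarrow> ('c \<Rightarrow> 'v) \<Rightarrow> real" where
  "cut_left a t x = (if t = a then w x else 1)"

text \<open>Only the times strictly between \<open>a\<close> and \<open>b\<close> receive reference
  draws; for \<open>b = a + 1\<close> there are none and only the boundary factors \<open>w\<close>
  and \<open>v\<close> remain.\<close>

definition cut_right :: "int \<Rightarrow> int \<Rightarrow> ('c \<Rightarrow> 'v) \<Rightarrow> real" where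
  "cut_right b t x = (if t = b then v x else href x)"

text \<open>
  Multiplying the law of the chain by this density replaces the transitions between the times
  \<open>a\<close> and \<open>b\<close> by independent draws from the densities \<open>h\<close>; the boundary factors \<open>w\<close> and \<open>v\<close>
  restore the laws of the past of \<open>a\<close> and of the future of \<open>b\<close>.
\<close>

definition cut_density :: "int \<Rightarrow> int \<Rightarrow> 'w \<Rightarrow> real" where
  "cut_density a b \<omega> = (\<Prod>t\<in>{a<..b}.
     r * cut_left a (t - 1) (X (t - 1) \<omega>) * cut_right b t (X t \<omega>) / R (X (t - 1) \<omega>) (X t \<omega>))"

lemma cut_pos: "0 < cut_left a t x" "0 < cut_right b t x"
  by (simp_all add: cut_left_def cut_right_def w_pos v_pos href_pos)

lemma cut_meas [measurable]: "cut_left a t \<in> borel_measurable N" "cut_right b t \<in> borel_measurable N"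
  by (auto simp: cut_left_def[abs_def] cut_right_def[abs_def])

lemma cut_density_pos: "0 < cut_density a b \<omega>"
  unfolding cut_density_def by (intro prod_pos ballI) (simp add: cut_pos R_pos r_pos)

lemma cut_density_meas [measurable]: "cut_density a b \<in> borel_measurable M"
  unfolding cut_density_def by measurable

text \<open>The density cancels the kernel at every transition into a time of \<open>{a<..b}\<close>
  and leaves kernels of rank one, which are peeled off one after the other. The past is left with
  its terminal function \<open>w\<close> and the future with its initial function \<open>v\<close>,
  exactly as in the plain block densities.\<close>

lemma cut_formula:
  assumes G: "\<And>t. G t \<in> sets N" and ab: "m \<le> a" "a < b" "b \<le> m'"
  shows "(\<integral>\<^sup>+\<omega>. ennreal (cut_density a b \<omega>) * (\<Prod>t\<in>{m..m'}. indicator (G t) (X t \<omega>)) \<partial>M) =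
    (\<integral>\<^sup>+\<omega>. (\<Prod>t\<in>{m..a}. indicator (G t) (X t \<omega>)) \<partial>M) *
    (\<Prod>t\<in>{a<..<b}. \<integral>\<^sup>+x. ennreal (href x) * indicator (G t) x \<partial>N) *
    (\<integral>\<^sup>+\<omega>. (\<Prod>t\<in>{b..m'}. indicator (G t) (X t \<omega>)) \<partial>M)"
proof -
  define g :: "int \<Rightarrow> ('c \<Rightarrow> 'v) \<Rightarrow> ennreal" where "g t = indicator (G t)" for t
  have g[measurable]: "g t \<in> borel_measurable N" for t using G[of t] by (simp add: g_def)
  \<comment> \<open>Weight 1 outside the cut, so that there \<open>k\<close> is the plain kernel
    \<open>k1\<close>.\<close>
  define c :: "int \<Rightarrow> ('c \<Rightarrow> 'v) \<Rightarrow> ('c \<Rightarrow> 'v) \<Rightarrow> ennreal" where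
    "c t x y = (if t \<in> {a<..b} then ennreal (r * cut_left a (t - 1) x * cut_right b t y / R x y) else 1)" for t x y
  have c: "case_prod (c t) \<in> borel_measurable (N \<Otimes>\<^sub>M N)" for t
    unfolding c_def by (simp add: case_prod_beta') measurable
  define k where "k t x y = ennreal (R x y / r) * c t x y * g t y" for t x y
  define k1 where "k1 t x y = ennreal (R x y / r) * 1 * g t y" for t :: int and x y
  have k: "case_prod (k t) \<in> borel_measurable (N \<Otimes>\<^sub>M N)" for t
    using c[of t] unfolding k_def by (simp add: case_prod_beta') measurable
  have k_out: "k t x y = k1 t x y" if "t \<notin> {a<..b}" for t x y
    using that by (simp only: k_def k1_def c_def if_False)
  have k_in: "k t x y = ennreal (cut_left a (t - 1) x) * (ennreal (cut_right b t y) * g t y)" if "t \<in> {a<..b}" for t x y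
  proof -
    have "ennreal (R x y / r) * ennreal (r * cut_left a (t - 1) x * cut_right b t y / R x y) =
        ennreal (cut_left a (t - 1) x * cut_right b t y)"
      using R_pos[of x y] r_pos cut_pos[of a "t - 1" x] cut_pos[of b t y]
      by (subst ennreal_mult[symmetric]) (auto simp: less_imp_le)
    then show ?thesis
      using that cut_pos[of a "t - 1" x] by (simp add: k_def c_def ennreal_mult' mult.assoc less_imp_le)
  qed
  let ?W = "\<lambda>x. ennreal (w x)"
  \<comment> \<open>Everything from time \<open>t\<close> on, started with the weight that the
    preceding rank-one step hands over.\<close>
  define Z where "Z t = (\<integral>\<^sup>+y. (ennreal (cut_right b t y) * g t y) * iterated_integral N k ?W (nat (m' - t)) t y \<partial>N)" for t
  have plain: "(\<integral>\<^sup>+\<omega>. (\<Prod>t\<in>{i..j}. g t (X t \<omega>)) \<partial>M) =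
      (\<integral>\<^sup>+x. (ennreal (v x) * g i x) * iterated_integral N k1 ?W (nat (j - i)) i x \<partial>N)" if "i \<le> j" for i j
    using block_expectation[OF g, of "\<lambda>_ _ _. 1", OF _ that] by (simp add: k1_def[abs_def])
  have Zb: "Z b = (\<integral>\<^sup>+\<omega>. (\<Prod>t\<in>{b..m'}. g t (X t \<omega>)) \<partial>M)"
  proof -
    have "Z b = (\<integral>\<^sup>+y. (ennreal (v y) * g b y) * iterated_integral N k1 ?W (nat (m' - b)) b y \<partial>N)"
      unfolding Z_def
      by (intro nn_integral_cong arg_cong2[where f="(*)"] iterated_integral_cong k_out)
        (auto simp: cut_right_def)
    then show ?thesis using plain[OF ab(3)] by simp
  qed
  have Z_step: "Z t = (\<integral>\<^sup>+x. ennreal (href x) * g t x \<partial>N) * Z (t + 1)" if t: "t \<in> {a<..<b}" for t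
  proof -
    have nt: "nat (m' - t) = 0 + Suc (nat (m' - (t + 1)))" using t ab by auto
    have "Z t = (\<integral>\<^sup>+x. (ennreal (cut_right b t x) * g t x) * iterated_integral N k (\<lambda>x. ennreal (cut_left a t x)) 0 t x \<partial>N) *
        (\<integral>\<^sup>+y. (ennreal (cut_right b (t + 1) y) * g (t + 1) y) * iterated_integral N k ?W (nat (m' - (t + 1))) (t + int 0 + 1) y \<partial>N)"
      unfolding Z_def nt
    proof (rule N.nn_integral_iterated_integral_split[OF k])
      show "k (t + int 0 + 1) x y = ennreal (cut_left a t x) * (ennreal (cut_right b (t + 1) y) * g (t + 1) y)" for x y
        using k_in[of "t + 1" x y] t by simp
    qed measurable
    then show ?thesis using t by (simp add: Z_def cut_left_def cut_right_def)
  qed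
  \<comment> \<open>Induction backwards in time from \<open>b\<close>; the condition
    \<open>a < b - int i\<close> keeps every peeled step inside the cut.\<close>
  have Z_prod: "Z (b - int i) = (\<Prod>t\<in>{b - int i..<b}. \<integral>\<^sup>+x. ennreal (href x) * g t x \<partial>N) * Z b" if "a < b - int i" for i
    using that
  proof (induction i)
    case (Suc i)
    have "{b - int (Suc i)..<b} = insert (b - int (Suc i)) {b - int i..<b}" by auto
    moreover have "b - int (Suc i) + 1 = b - int i" by simp
    ultimately show ?case
      using Suc Z_step[of "b - int (Suc i)"] by (simp add: mult.assoc)
  qed simp
  have D: "ennreal (cut_density a b \<omega>) = (\<Prod>t\<in>{m<..m'}. c t (X (t - 1) \<omega>) (X t \<omega>))" for \<omega>
  proof -
    have "(\<Prod>t\<in>{m<..m'}. c t (X (t - 1) \<omega>) (X t \<omega>)) = (\<Prod>t\<in>{a<..b}. c t (X (t - 1) \<omega>) (X t \<omega>))"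
      by (rule prod.mono_neutral_right) (use ab in \<open>auto simp: c_def\<close>)
    also have "\<dots> = (\<Prod>t\<in>{a<..b}. ennreal (r * cut_left a (t - 1) (X (t - 1) \<omega>) * cut_right b t (X t \<omega>) / R (X (t - 1) \<omega>) (X t \<omega>)))"
      by (rule prod.cong) (auto simp: c_def)
    also have "\<dots> = ennreal (cut_density a b \<omega>)"
      unfolding cut_density_def
      by (rule prod_ennreal) (simp add: cut_pos R_pos r_pos less_imp_le)
    finally show ?thesis ..
  qed
  \<comment> \<open>The first separation is made at the step from \<open>a\<close> to
    \<open>a + 1\<close>.\<close>
  have nn: "nat (m' - m) = nat (a - m) + Suc (nat (m' - (a + 1)))" and ma: "m + int (nat (a - m)) + 1 = a + 1"
    using ab by auto
  have "(\<integral>\<^sup>+\<omega>. ennreal (cut_density a b \<omega>) * (\<Prod>t\<in>{m..m'}. g t (X t \<omega>)) \<partial>M) =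
      (\<integral>\<^sup>+x. (ennreal (v x) * g m x) * iterated_integral N k ?W (nat (m' - m)) m x \<partial>N)"
    unfolding D k_def[abs_def] using block_expectation[OF g c, of m m'] ab by (simp add: mult.commute)
  also have "\<dots> = (\<integral>\<^sup>+x. (ennreal (v x) * g m x) * iterated_integral N k (\<lambda>x. ennreal (cut_left a a x)) (nat (a - m)) m x \<partial>N) * Z (a + 1)"
    unfolding nn Z_def ma[symmetric]
  proof (rule N.nn_integral_iterated_integral_split[OF k])
    show "k (m + int (nat (a - m)) + 1) x y = ennreal (cut_left a a x) *
        (ennreal (cut_right b (m + int (nat (a - m)) + 1) y) * g (m + int (nat (a - m)) + 1) y)" for x y
      using k_in[of "a + 1" x y] ab unfolding ma by simp
  qed measurable
  also have "(\<integral>\<^sup>+x. (ennreal (v x) * g m x) * iterated_integral N k (\<lambda>x. ennreal (cut_left a a x)) (nat (a - m)) m x \<partial>N) =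
      (\<integral>\<^sup>+x. (ennreal (v x) * g m x) * iterated_integral N k1 ?W (nat (a - m)) m x \<partial>N)"
    by (intro nn_integral_cong arg_cong2[where f="(*)"] iterated_integral_cong k_out)
      (use ab in \<open>auto simp: cut_left_def\<close>)
  also have "\<dots> = (\<integral>\<^sup>+\<omega>. (\<Prod>t\<in>{m..a}. g t (X t \<omega>)) \<partial>M)"
    using plain[OF ab(1)] by simp
  also have "Z (a + 1) = (\<Prod>t\<in>{a<..<b}. \<integral>\<^sup>+x. ennreal (href x) * g t x \<partial>N) * Z b"
  proof -
    have "{a + 1..<b} = {a<..<b}" by auto
    then show ?thesis using Z_prod[of "nat (b - (a + 1))"] ab by simp
  qed
  finally show ?thesis unfolding Zb g_def by (simp add: mult.assoc)
qed

section \<open>Independence of the coordinates under a cut measure\<close>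

abbreviation coord_space :: "int \<times> 'c \<Rightarrow> 'v measure" where
  "coord_space i \<equiv> \<mu> (snd i)"

abbreviation coord :: "int \<times> 'c \<Rightarrow> 'w \<Rightarrow> 'v" where
  "coord i \<omega> \<equiv> X (fst i) \<omega> (snd i)"

abbreviation cutM :: "int \<Rightarrow> int \<Rightarrow> 'w measure" where
  "cutM a b \<equiv> density M (\<lambda>\<omega>. ennreal (cut_density a b \<omega>))"

sublocale rv_family M coord_space coord "UNIV \<times> V"
proof
  fix i :: "int \<times> 'c" assume "i \<in> UNIV \<times> V"
  then show "coord i \<in> measurable M (coord_space i)"
    using measurable_compose[OF X_meas measurable_component_singleton[of "snd i" V \<mu>]] by (cases i) simp
qed

lemma X_in_space: "\<omega> \<in> space M \<Longrightarrow> X t \<omega> \<in> space N"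
  using X_meas[of t] by (auto simp: measurable_def)

text \<open>As \<open>href\<close> is a product over components, the cut decouples more than the
  times: strictly between \<open>a\<close> and \<open>b\<close> every single coordinate becomes
  independent of all others.\<close>

lemma emeasure_cut_cylinder:
  assumes J: "finite J" "J \<subseteq> UNIV \<times> V" and U: "\<And>i. i \<in> J \<Longrightarrow> U i \<in> sets (coord_space i)" and ab: "a < b"
  shows "emeasure (cutM a b) {\<omega>\<in>space M. \<forall>i\<in>J. coord i \<omega> \<in> U i} =
    emeasure M {\<omega>\<in>space M. \<forall>i\<in>{i\<in>J. fst i \<le> a}. coord i \<omega> \<in> U i} *
    (\<Prod>i\<in>{i\<in>J. a < fst i \<and> fst i < b}. \<integral>\<^sup>+x. ennreal (h (snd i) x) * indicator (U i) x \<partial>\<mu> (snd i)) *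
    emeasure M {\<omega>\<in>space M. \<forall>i\<in>{i\<in>J. b \<le> fst i}. coord i \<omega> \<in> U i}"
proof -
  \<comment> \<open>Coordinates outside \<open>J\<close> are padded with the whole space; their
    reference integrals are 1 by \<open>h_one\<close> and disappear from the product.\<close>
  define U' where "U' i = (if i \<in> J then U i else space (coord_space i))" for i
  have U': "U' i \<in> sets (coord_space i)" for i using U by (auto simp: U'_def)
  define G where "G t = (\<Pi>\<^sub>E c\<in>V. U' (t, c))" for t
  have G: "G t \<in> sets N" for t
    unfolding G_def
  proof (rule sets_PiM_I_finite[OF finite_V])
    show "U' (t, c) \<in> sets (\<mu> c)" for c using U'[of "(t, c)"] by simp
  qed
  have XG: "X t \<omega> \<in> G t \<longleftrightarrow> (\<forall>i\<in>J. fst i = t \<longrightarrow> coord i \<omega> \<in> U i)" if "\<omega> \<in> space M" for t \<omega>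
    using X_in_space[OF that, of t] J(2) by (fastforce simp: G_def U'_def space_PiM PiE_iff)
  \<comment> \<open>A finite block of times that contains both the cut and all times occurring in
    \<open>J\<close>.\<close>
  define m m' where "m = Min (insert a (fst ` J))" and "m' = Max (insert b (fst ` J))"
  have mm: "m \<le> a" "b \<le> m'" "\<And>i. i \<in> J \<Longrightarrow> m \<le> fst i \<and> fst i \<le> m'"
    using J(1) by (auto simp: m_def m'_def)
  have cyl_eq: "(\<Prod>t\<in>{i..j}. indicator (G t) (X t \<omega>)) =
      (indicator {\<omega>\<in>space M. \<forall>l\<in>{l\<in>J. i \<le> fst l \<and> fst l \<le> j}. coord l \<omega> \<in> U l} \<omega> :: ennreal)"
    if "\<omega> \<in> space M" for i j \<omega>
  proof (cases "\<forall>t\<in>{i..j}. X t \<omega> \<in> G t")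
    case True
    have "coord l \<omega> \<in> U l" if "l \<in> J" "i \<le> fst l" "fst l \<le> j" for l
      using True XG[OF \<open>\<omega> \<in> space M\<close>, of "fst l"] that by simp
    then show ?thesis using True that by (auto simp: indicator_def)
  next
    case False
    then obtain t where t: "t \<in> {i..j}" "X t \<omega> \<notin> G t" by blast
    then have "(\<Prod>t\<in>{i..j}. indicator (G t) (X t \<omega>)) = (0::ennreal)"
      by (intro prod_zero) (auto intro!: bexI[of _ t])
    then show ?thesis using XG[OF that, of t] t by (auto simp: indicator_def)
  qed
  have ev: "{\<omega>\<in>space M. \<forall>l\<in>{l\<in>J. P l}. coord l \<omega> \<in> U l} \<in> events" for P
    by (rule cyl_events[of _ "UNIV \<times> V", OF cylinder_eventsI[of "{l\<in>J. P l}" _ U]]) (use J U in auto)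
  have ev': "{\<omega>\<in>space M. \<forall>l\<in>J. coord l \<omega> \<in> U l} \<in> events"
    using ev[of "\<lambda>_. True"] by simp
  have em: "(\<integral>\<^sup>+\<omega>. (\<Prod>t\<in>{i..j}. indicator (G t) (X t \<omega>)) \<partial>M) =
      emeasure M {\<omega>\<in>space M. \<forall>l\<in>{l\<in>J. i \<le> fst l \<and> fst l \<le> j}. coord l \<omega> \<in> U l}" for i j
  proof -
    have "(\<integral>\<^sup>+\<omega>. (\<Prod>t\<in>{i..j}. indicator (G t) (X t \<omega>)) \<partial>M) =
        (\<integral>\<^sup>+\<omega>. indicator {\<omega>\<in>space M. \<forall>l\<in>{l\<in>J. i \<le> fst l \<and> fst l \<le> j}. coord l \<omega> \<in> U l} \<omega> \<partial>M)"
      by (rule nn_integral_cong) (rule cyl_eq)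
    then show ?thesis by (simp only: nn_integral_indicator[OF ev])
  qed
  have mid: "(\<integral>\<^sup>+x. ennreal (href x) * indicator (G t) x \<partial>N) =
      (\<Prod>c\<in>V. \<integral>\<^sup>+x. ennreal (h c x) * indicator (U' (t, c)) x \<partial>\<mu> c)" for t
  proof -
    have "(\<integral>\<^sup>+x. ennreal (href x) * indicator (G t) x \<partial>N) =
        (\<integral>\<^sup>+x. (\<Prod>c\<in>V. ennreal (h c (x c)) * indicator (U' (t, c)) (x c)) \<partial>N)"
    proof (rule nn_integral_cong)
      fix x assume x: "x \<in> space N"
      have "ennreal (href x) = (\<Prod>c\<in>V. ennreal (h c (x c)))"
        unfolding href_def by (rule prod_ennreal[symmetric]) (simp add: h_pos less_imp_le)
      moreover have "indicator (G t) x = (\<Prod>c\<in>V. indicator (U' (t, c)) (x c) :: ennreal)"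
      proof (cases "\<forall>c\<in>V. x c \<in> U' (t, c)")
        case True
        then show ?thesis using x by (auto simp: G_def indicator_def space_PiM PiE_iff)
      next
        case False
        then obtain c where c: "c \<in> V" "x c \<notin> U' (t, c)" by blast
        then have "(\<Prod>c\<in>V. indicator (U' (t, c)) (x c)) = (0::ennreal)"
          using finite_V by (intro prod_zero) (auto intro!: bexI[of _ c])
        then show ?thesis using c by (auto simp: G_def indicator_def PiE_iff)
      qed
      ultimately show "ennreal (href x) * indicator (G t) x =
          (\<Prod>c\<in>V. ennreal (h c (x c)) * indicator (U' (t, c)) (x c))"
        by (simp add: prod.distrib)
    qed
    also have "\<dots> = (\<Prod>c\<in>V. \<integral>\<^sup>+x. ennreal (h c x) * indicator (U' (t, c)) x \<partial>\<mu> c)"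
    proof (rule product_nn_integral_prod[OF finite_V])
      fix c assume c: "c \<in> V"
      have [measurable]: "h c \<in> borel_measurable (\<mu> c)" "U' (t, c) \<in> sets (\<mu> c)"
        using h_meas[OF c] U'[of "(t, c)"] by auto
      show "(\<lambda>x. ennreal (h c x) * indicator (U' (t, c)) x) \<in> borel_measurable (\<mu> c)" by measurable
    qed
    finally show ?thesis .
  qed
  have mids: "(\<Prod>t\<in>{a<..<b}. \<integral>\<^sup>+x. ennreal (href x) * indicator (G t) x \<partial>N) =
    (\<Prod>i\<in>{i\<in>J. a < fst i \<and> fst i < b}. \<integral>\<^sup>+x. ennreal (h (snd i) x) * indicator (U i) x \<partial>\<mu> (snd i))"
  proof -
    have "(\<Prod>t\<in>{a<..<b}. \<integral>\<^sup>+x. ennreal (href x) * indicator (G t) x \<partial>N) =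
        (\<Prod>i\<in>{a<..<b} \<times> V. \<integral>\<^sup>+x. ennreal (h (snd i) x) * indicator (U' i) x \<partial>\<mu> (snd i))"
      unfolding mid by (subst prod.cartesian_product) (simp add: case_prod_beta')
    also have "\<dots> = (\<Prod>i\<in>{i\<in>J. a < fst i \<and> fst i < b}. \<integral>\<^sup>+x. ennreal (h (snd i) x) * indicator (U' i) x \<partial>\<mu> (snd i))"
    proof (rule prod.mono_neutral_right)
      show "\<forall>i\<in>{a<..<b} \<times> V - {i \<in> J. a < fst i \<and> fst i < b}.
          (\<integral>\<^sup>+x. ennreal (h (snd i) x) * indicator (U' i) x \<partial>\<mu> (snd i)) = 1"
      proof
        fix i assume i: "i \<in> {a<..<b} \<times> V - {i \<in> J. a < fst i \<and> fst i < b}"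
        then have "U' i = space (\<mu> (snd i))" "snd i \<in> V" by (auto simp: U'_def)
        then show "(\<integral>\<^sup>+x. ennreal (h (snd i) x) * indicator (U' i) x \<partial>\<mu> (snd i)) = 1"
          using h_one[of "snd i"] by (simp add: nn_set_integral_space)
      qed
    qed (use J finite_V in auto)
    also have "\<dots> = (\<Prod>i\<in>{i\<in>J. a < fst i \<and> fst i < b}. \<integral>\<^sup>+x. ennreal (h (snd i) x) * indicator (U i) x \<partial>\<mu> (snd i))"
      by (rule prod.cong) (auto simp: U'_def)
    finally show ?thesis .
  qed
  have all: "{l\<in>J. m \<le> fst l \<and> fst l \<le> m'} = J" "{l\<in>J. m \<le> fst l \<and> fst l \<le> a} = {l\<in>J. fst l \<le> a}"
    "{l\<in>J. b \<le> fst l \<and> fst l \<le> m'} = {l\<in>J. b \<le> fst l}"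
    using mm(3) by auto
  have "emeasure (cutM a b) {\<omega>\<in>space M. \<forall>i\<in>J. coord i \<omega> \<in> U i} =
      (\<integral>\<^sup>+\<omega>. ennreal (cut_density a b \<omega>) * indicator {\<omega>\<in>space M. \<forall>i\<in>J. coord i \<omega> \<in> U i} \<omega> \<partial>M)"
    using ev' by (simp add: emeasure_density)
  also have "\<dots> = (\<integral>\<^sup>+\<omega>. ennreal (cut_density a b \<omega>) * (\<Prod>t\<in>{m..m'}. indicator (G t) (X t \<omega>)) \<partial>M)"
    by (rule nn_integral_cong) (simp only: cyl_eq all)
  also note cut_formula[of G m a b m', OF G mm(1) ab mm(2)]
  finally show ?thesis unfolding em all mids .
qed

lemma prob_space_cutM:
  assumes "a < b" shows "prob_space (cutM a b)"
proof
  show "emeasure (cutM a b) (space (cutM a b)) = 1"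
    using emeasure_cut_cylinder[of "{}" "\<lambda>_. {}" a b] assms by (simp add: emeasure_space_1)
qed

text \<open>The past up to \<open>a\<close> is one block of dependent coordinates, and so is the
  future from \<open>b\<close>. By \<open>le\<close> and \<open>ge\<close> each block is touched by
  at most one of \<open>L\<close> and \<open>H\<close>; the coordinates in between may be shared out
  freely.\<close>

lemma indep_alg_cutM:
  assumes ab: "a < b" and LH: "L \<inter> H = {}" "L \<subseteq> UNIV \<times> V" "H \<subseteq> UNIV \<times> V"
    and le: "(\<forall>i\<in>L. a < fst i) \<or> (\<forall>i\<in>H. a < fst i)"
    and ge: "(\<forall>i\<in>L. fst i < b) \<or> (\<forall>i\<in>H. fst i < b)"
  shows "indep_alg (cutM a b) (alg L) (alg H)"
proof -
  interpret Q: prob_space "cutM a b" by (rule prob_space_cutM[OF ab])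
  interpret Q: rv_family "cutM a b" coord_space coord "UNIV \<times> V"
    by unfold_locales (simp add: rv)
  have "indep_alg (cutM a b) (Q.alg L) (Q.alg H)"
  proof (rule Q.indep_algI_cyl[OF LH(2,3)])
    fix A B assume AB: "A \<in> Q.cyl L" "B \<in> Q.cyl H"
    obtain J1 U1 where A: "A = {\<omega>\<in>space M. \<forall>i\<in>J1. coord i \<omega> \<in> U1 i}" "finite J1" "J1 \<subseteq> L"
        "\<And>i. i \<in> J1 \<Longrightarrow> U1 i \<in> sets (coord_space i)"
      using AB(1) unfolding space_density by (rule cylinder_eventsE) blast
    obtain J2 U2 where B: "B = {\<omega>\<in>space M. \<forall>i\<in>J2. coord i \<omega> \<in> U2 i}" "finite J2" "J2 \<subseteq> H"
        "\<And>i. i \<in> J2 \<Longrightarrow> U2 i \<in> sets (coord_space i)"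
      using AB(2) unfolding space_density by (rule cylinder_eventsE) blast
    define U where "U i = (if i \<in> J1 then U1 i else U2 i)" for i
    have J12: "J1 \<inter> J2 = {}" using A(3) B(3) LH(1) by blast
    have UJ: "U i \<in> sets (coord_space i)" if "i \<in> J1 \<union> J2" for i
      using that A(4)[of i] B(4)[of i] by (auto simp: U_def)
    have A': "A = {\<omega>\<in>space M. \<forall>i\<in>J1. coord i \<omega> \<in> U i}"
      and B': "B = {\<omega>\<in>space M. \<forall>i\<in>J2. coord i \<omega> \<in> U i}"
      using J12 by (auto simp: A(1) B(1) U_def)
    have AB': "A \<inter> B = {\<omega>\<in>space M. \<forall>i\<in>J1 \<union> J2. coord i \<omega> \<in> U i}"
      unfolding A' B' by blast
    let ?E = "\<lambda>J. emeasure M {\<omega>\<in>space M. \<forall>i\<in>J. coord i \<omega> \<in> U i}"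
    let ?m = "\<lambda>i. \<integral>\<^sup>+x. ennreal (h (snd i) x) * indicator (U i) x \<partial>\<mu> (snd i)"
    \<comment> \<open>An empty index set gives the whole space, of probability 1, so the product
      formula costs nothing when only one side meets the block.\<close>
    have split1: "?E (J \<union> J') = ?E J * ?E J'" if "J = {} \<or> J' = {}" for J J'
      using that by (auto simp: emeasure_space_1)
    have l: "?E {i\<in>J1 \<union> J2. fst i \<le> a} = ?E {i\<in>J1. fst i \<le> a} * ?E {i\<in>J2. fst i \<le> a}"
    proof -
      have "{i\<in>J1 \<union> J2. fst i \<le> a} = {i\<in>J1. fst i \<le> a} \<union> {i\<in>J2. fst i \<le> a}" by auto
      moreover have "{i\<in>J1. fst i \<le> a} = {} \<or> {i\<in>J2. fst i \<le> a} = {}"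
        using le A(3) B(3) by fastforce
      ultimately show ?thesis by (simp only: split1)
    qed
    have g: "?E {i\<in>J1 \<union> J2. b \<le> fst i} = ?E {i\<in>J1. b \<le> fst i} * ?E {i\<in>J2. b \<le> fst i}"
    proof -
      have "{i\<in>J1 \<union> J2. b \<le> fst i} = {i\<in>J1. b \<le> fst i} \<union> {i\<in>J2. b \<le> fst i}" by auto
      moreover have "{i\<in>J1. b \<le> fst i} = {} \<or> {i\<in>J2. b \<le> fst i} = {}"
        using ge A(3) B(3) by fastforce
      ultimately show ?thesis by (simp only: split1)
    qed
    have mi: "prod ?m {i\<in>J1 \<union> J2. a < fst i \<and> fst i < b} =
        prod ?m {i\<in>J1. a < fst i \<and> fst i < b} * prod ?m {i\<in>J2. a < fst i \<and> fst i < b}"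
    proof -
      have "{i\<in>J1 \<union> J2. a < fst i \<and> fst i < b} =
          {i\<in>J1. a < fst i \<and> fst i < b} \<union> {i\<in>J2. a < fst i \<and> fst i < b}" by auto
      then show ?thesis using prod.union_disjoint[of "{i\<in>J1. a < fst i \<and> fst i < b}"
            "{i\<in>J2. a < fst i \<and> fst i < b}" ?m] A(2) B(2) J12 by auto
    qed
    have 1: "emeasure (cutM a b) A = ?E {i\<in>J1. fst i \<le> a} * prod ?m {i\<in>J1. a < fst i \<and> fst i < b} * ?E {i\<in>J1. b \<le> fst i}"
      unfolding A' by (rule emeasure_cut_cylinder[OF _ _ _ ab]) (use A LH UJ in auto)
    have 2: "emeasure (cutM a b) B = ?E {i\<in>J2. fst i \<le> a} * prod ?m {i\<in>J2. a < fst i \<and> fst i < b} * ?E {i\<in>J2. b \<le> fst i}"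
      unfolding B' by (rule emeasure_cut_cylinder[OF _ _ _ ab]) (use B LH UJ in auto)
    have 3: "emeasure (cutM a b) (A \<inter> B) = ?E {i\<in>J1 \<union> J2. fst i \<le> a} *
        prod ?m {i\<in>J1 \<union> J2. a < fst i \<and> fst i < b} * ?E {i\<in>J1 \<union> J2. b \<le> fst i}"
      unfolding AB' by (rule emeasure_cut_cylinder[OF _ _ _ ab]) (use A B LH UJ in auto)
    show "emeasure (cutM a b) (A \<inter> B) = emeasure (cutM a b) A * emeasure (cutM a b) B"
      unfolding 1 2 3 l g mi by (simp only: ac_simps)
  qed
  then show ?thesis by simp
qed

lemma X_meas_alg: "{t} \<times> V \<subseteq> I \<Longrightarrow> I \<subseteq> UNIV \<times> V \<Longrightarrow> X t \<in> measurable (alg I) N"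
proof (rule measurable_PiM_single)
  show "X t \<in> space (alg I) \<rightarrow> (\<Pi>\<^sub>E i\<in>V. space (\<mu> i))"
    using X_in_space by (auto simp: space_PiM)
  assume I: "{t} \<times> V \<subseteq> I" "I \<subseteq> UNIV \<times> V"
  fix A c assume A: "c \<in> V" "A \<in> sets (\<mu> c)"
  have "(\<lambda>\<omega>. X t \<omega> c) \<in> measurable (alg I) (\<mu> c)"
    using rv_measurable_alg[of "(t, c)" I] I A by auto
  then show "{\<omega> \<in> space (alg I). X t \<omega> c \<in> A} \<in> sets (alg I)"
    using measurable_sets[OF _ A(2), of "\<lambda>\<omega>. X t \<omega> c" "alg I"] by (simp add: vimage_def Int_def conj_commute)
qed

lemma cut_density_one_step:
  "cut_density n (n + 1) = (\<lambda>\<omega>. r * w (X n \<omega>) * v (X (n + 1) \<omega>) / R (X n \<omega>) (X (n + 1) \<omega>))"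
proof -
  have "{n<..n + 1} = {n + 1}" by auto
  then show ?thesis by (simp add: cut_density_def fun_eq_iff cut_left_def cut_right_def)
qed

lemma cut_density_meas_alg:
  assumes "{n, n + 1} \<times> V \<subseteq> I" "I \<subseteq> UNIV \<times> V"
  shows "cut_density n (n + 1) \<in> borel_measurable (alg I)"
proof -
  have [measurable]: "X n \<in> measurable (alg I) N" "X (n + 1) \<in> measurable (alg I) N"
    using assms by (auto intro!: X_meas_alg)
  show ?thesis unfolding cut_density_one_step by measurable
qed

text \<open>A one-step cut density is the same function \<open>d\<close> of two consecutive states
  for every starting time, and the block density of length 2 does not depend on the starting
  time.\<close>

lemma cut_density_distr:
  "distr M borel (cut_density n (n + 1)) = distr M borel (cut_density m (m + 1))"
proof -
  let ?PM = "PiM {1..2::nat} (\<lambda>_. N)"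
  define d where "d x = r * w (x 1) * v (x 2) / R (x 1) (x 2)" for x :: "nat \<Rightarrow> 'c \<Rightarrow> 'v"
  have comp[measurable]: "(\<lambda>x. x (1::nat)) \<in> measurable ?PM N" "(\<lambda>x. x (2::nat)) \<in> measurable ?PM N"
    by (rule measurable_component_singleton; simp)+
  have d[measurable]: "d \<in> borel_measurable ?PM" unfolding d_def[abs_def] by measurable
  have "distr M borel (cut_density n (n + 1)) = distr (density ?PM (\<lambda>x. ennreal (block_density R r v w 2 x))) borel d" for n
  proof -
    have "cut_density n (n + 1) = d \<circ> process_block X n 2"
      unfolding cut_density_one_step by (simp add: d_def process_block_def fun_eq_iff add.commute)
    then have "distr M borel (cut_density n (n + 1)) = distr (distr M ?PM (process_block X n 2)) borel d"
      by (simp only: distr_distr[OF d process_block_measurable])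
    also have "distr M ?PM (process_block X n 2) = density ?PM (\<lambda>x. ennreal (block_density R r v w 2 x))"
      by (rule block) simp
    finally show ?thesis .
  qed
  then show ?thesis by metis
qed

section \<open>The families of cuts forward and backward in time\<close>

definition upto_time :: "int \<Rightarrow> (int \<times> 'c) set" where "upto_time t = {..t} \<times> V"
definition from_time :: "int \<Rightarrow> (int \<times> 'c) set" where "from_time t = {t..} \<times> V"

text \<open>The set to be severed is \<open>upto_time (int n + 1)\<close>, so the transition from
  \<open>int n + 1\<close> to \<open>int n + 2\<close> is cut; these two times form the layers that
  the density may read.\<close>

sublocale forward: cut_family M coord_space coord "UNIV \<times> V"
  "\<lambda>n. upto_time (int n)" "\<lambda>n. cut_density (int n + 1) (int n + 2)"
proof (intro cut_family.intro cut_family_axioms.intro)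
  show "rv_family M coord_space coord (UNIV \<times> V)" by unfold_locales
next
  fix n
  have 2: "int n + 2 = (int n + 1) + 1" by simp
  show "upto_time (int n) \<subseteq> upto_time (int (Suc n))" "upto_time (int n) \<subseteq> UNIV \<times> V"
    by (auto simp: upto_time_def)
  show "0 < cut_density (int n + 1) (int n + 2) x" for x by (rule cut_density_pos)
  show "cut_density (int n + 1) (int n + 2) \<in> borel_measurable (alg (upto_time (int (Suc (Suc n))) - upto_time (int n)))"
    unfolding 2 by (rule cut_density_meas_alg) (auto simp: upto_time_def)
  show "distr M borel (cut_density (int n + 1) (int n + 2)) = distr M borel (cut_density (int 0 + 1) (int 0 + 2))"
    using cut_density_distr[of "int n + 1" 1] by (simp add: 2 del: of_nat_Suc)
  show "prob_space (cutM (int n + 1) (int n + 2))" by (rule prob_space_cutM) simp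
  show "indep_alg (cutM (int n + 1) (int n + 2)) (alg (upto_time (int (Suc n)))) (alg (UNIV \<times> V - upto_time (int (Suc n))))"
    by (rule indep_alg_cutM) (auto simp: upto_time_def)
qed

text \<open>The mirror image: the set to be severed is \<open>from_time (- int n - 1)\<close>, and
  the cut transition is the one that enters it from \<open>- int n - 2\<close>.\<close>

sublocale backward: cut_family M coord_space coord "UNIV \<times> V"
  "\<lambda>n. from_time (- int n)" "\<lambda>n. cut_density (- int n - 2) (- int n - 1)"
proof (intro cut_family.intro cut_family_axioms.intro)
  show "rv_family M coord_space coord (UNIV \<times> V)" by unfold_locales
next
  fix n
  have 2: "- int n - 1 = (- int n - 2) + 1" by simp
  show "from_time (- int n) \<subseteq> from_time (- int (Suc n))" "from_time (- int n) \<subseteq> UNIV \<times> V"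
    by (auto simp: from_time_def)
  show "0 < cut_density (- int n - 2) (- int n - 1) x" for x by (rule cut_density_pos)
  show "cut_density (- int n - 2) (- int n - 1) \<in> borel_measurable (alg (from_time (- int (Suc (Suc n))) - from_time (- int n)))"
    unfolding 2 by (rule cut_density_meas_alg) (auto simp: from_time_def)
  show "distr M borel (cut_density (- int n - 2) (- int n - 1)) = distr M borel (cut_density (- int 0 - 2) (- int 0 - 1))"
    using cut_density_distr[of "- int n - 2" "- 2"] by (simp add: 2)
  show "prob_space (cutM (- int n - 2) (- int n - 1))" by (rule prob_space_cutM) simp
  show "indep_alg (cutM (- int n - 2) (- int n - 1)) (alg (from_time (- int (Suc n)))) (alg (UNIV \<times> V - from_time (- int (Suc n))))"
    by (rule indep_alg_cutM) (auto simp: from_time_def)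
qed

end

section \<open>Passing from finite windows to the whole process\<close>

text \<open>Multiplication is Lipschitz in L1 on functions bounded by 1, so a product identity
  passes to L1 limits; L1 distance 0 gives equality almost everywhere.\<close>

lemma (in prob_space) AE_product_of_L1_limits:
  fixes x y z :: "nat \<Rightarrow> 'a \<Rightarrow> real"
  assumes [measurable]: "\<And>n. x n \<in> borel_measurable M" "\<And>n. y n \<in> borel_measurable M" "\<And>n. z n \<in> borel_measurable M"
      "x' \<in> borel_measurable M" "y' \<in> borel_measurable M" "z' \<in> borel_measurable M"
    and bdd: "\<And>n. AE \<omega> in M. \<bar>x n \<omega>\<bar> \<le> 1" "\<And>n. AE \<omega> in M. \<bar>y n \<omega>\<bar> \<le> 1" "\<And>n. AE \<omega> in M. \<bar>z n \<omega>\<bar> \<le> 1"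
      "AE \<omega> in M. \<bar>x' \<omega>\<bar> \<le> 1" "AE \<omega> in M. \<bar>y' \<omega>\<bar> \<le> 1" "AE \<omega> in M. \<bar>z' \<omega>\<bar> \<le> 1"
    and lim: "(\<lambda>n. \<integral>\<omega>. \<bar>x n \<omega> - x' \<omega>\<bar> \<partial>M) \<longlonglongrightarrow> 0" "(\<lambda>n. \<integral>\<omega>. \<bar>y n \<omega> - y' \<omega>\<bar> \<partial>M) \<longlonglongrightarrow> 0"
      "(\<lambda>n. \<integral>\<omega>. \<bar>z n \<omega> - z' \<omega>\<bar> \<partial>M) \<longlonglongrightarrow> 0"
    and eq: "\<forall>\<^sub>F n in sequentially. AE \<omega> in M. z n \<omega> = x n \<omega> * y n \<omega>"
  shows "AE \<omega> in M. z' \<omega> = x' \<omega> * y' \<omega>"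
proof -
  have int: "integrable M (\<lambda>\<omega>. \<bar>f \<omega> - g \<omega>\<bar>)"
    if [measurable]: "f \<in> borel_measurable M" "g \<in> borel_measurable M"
      and "AE \<omega> in M. \<bar>f \<omega>\<bar> \<le> 1" "AE \<omega> in M. \<bar>g \<omega>\<bar> \<le> 1" for f g :: "'a \<Rightarrow> real"
  proof (rule integrable_const_bound[where B=2])
    show "AE \<omega> in M. norm \<bar>f \<omega> - g \<omega>\<bar> \<le> 2"
      using that(3,4) by eventually_elim simp
  qed measurable
  have xy1: "AE \<omega> in M. \<bar>x' \<omega> * y' \<omega>\<bar> \<le> 1"
    using bdd(4,5) by eventually_elim (simp add: abs_mult mult_le_one)
  let ?d = "\<integral>\<omega>. \<bar>z' \<omega> - x' \<omega> * y' \<omega>\<bar> \<partial>M"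
  have "?d \<le> (\<integral>\<omega>. \<bar>z n \<omega> - z' \<omega>\<bar> \<partial>M) + (\<integral>\<omega>. \<bar>x n \<omega> - x' \<omega>\<bar> \<partial>M) + (\<integral>\<omega>. \<bar>y n \<omega> - y' \<omega>\<bar> \<partial>M)"
    if n: "AE \<omega> in M. z n \<omega> = x n \<omega> * y n \<omega>" for n
  proof -
    have i: "integrable M (\<lambda>\<omega>. \<bar>z n \<omega> - z' \<omega>\<bar>)" "integrable M (\<lambda>\<omega>. \<bar>x n \<omega> - x' \<omega>\<bar>)"
        "integrable M (\<lambda>\<omega>. \<bar>y n \<omega> - y' \<omega>\<bar>)" "integrable M (\<lambda>\<omega>. \<bar>z' \<omega> - x' \<omega> * y' \<omega>\<bar>)"
      using int[OF _ _ bdd(3)[of n] bdd(6)] int[OF _ _ bdd(1)[of n] bdd(4)] int[OF _ _ bdd(2)[of n] bdd(5)]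
        int[OF _ _ bdd(6) xy1] by simp_all
    have "?d \<le> (\<integral>\<omega>. \<bar>z n \<omega> - z' \<omega>\<bar> + \<bar>x n \<omega> - x' \<omega>\<bar> + \<bar>y n \<omega> - y' \<omega>\<bar> \<partial>M)"
    proof (rule integral_mono_AE)
      show "AE \<omega> in M. \<bar>z' \<omega> - x' \<omega> * y' \<omega>\<bar> \<le> \<bar>z n \<omega> - z' \<omega>\<bar> + \<bar>x n \<omega> - x' \<omega>\<bar> + \<bar>y n \<omega> - y' \<omega>\<bar>"
        using n bdd(2)[of n] bdd(4)
      proof eventually_elim
        case (elim \<omega>)
        have "z' \<omega> - x' \<omega> * y' \<omega> = - (z n \<omega> - z' \<omega>) + (x n \<omega> - x' \<omega>) * y n \<omega> + x' \<omega> * (y n \<omega> - y' \<omega>)"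
          using elim(1) by (simp add: algebra_simps)
        also have "\<bar>\<dots>\<bar> \<le> \<bar>z n \<omega> - z' \<omega>\<bar> + \<bar>(x n \<omega> - x' \<omega>) * y n \<omega>\<bar> + \<bar>x' \<omega> * (y n \<omega> - y' \<omega>)\<bar>"
          by linarith
        also have "\<bar>(x n \<omega> - x' \<omega>) * y n \<omega>\<bar> \<le> \<bar>x n \<omega> - x' \<omega>\<bar>"
          unfolding abs_mult by (rule mult_left_le) (use elim in auto)
        also have "\<bar>x' \<omega> * (y n \<omega> - y' \<omega>)\<bar> \<le> \<bar>y n \<omega> - y' \<omega>\<bar>"
          unfolding abs_mult by (rule mult_left_le_one_le) (use elim in auto)
        finally show ?case by simp
      qed
    qed (use i in auto)
    then show ?thesis using i by simp
  qed
  then have "\<forall>\<^sub>F n in sequentially. ?d \<le>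
      (\<integral>\<omega>. \<bar>z n \<omega> - z' \<omega>\<bar> \<partial>M) + (\<integral>\<omega>. \<bar>x n \<omega> - x' \<omega>\<bar> \<partial>M) + (\<integral>\<omega>. \<bar>y n \<omega> - y' \<omega>\<bar> \<partial>M)"
    using eq by (auto elim: eventually_mono)
  moreover have "(\<lambda>n. (\<integral>\<omega>. \<bar>z n \<omega> - z' \<omega>\<bar> \<partial>M) + (\<integral>\<omega>. \<bar>x n \<omega> - x' \<omega>\<bar> \<partial>M) + (\<integral>\<omega>. \<bar>y n \<omega> - y' \<omega>\<bar> \<partial>M)) \<longlonglongrightarrow> 0"
    using tendsto_add[OF tendsto_add[OF lim(3) lim(1)] lim(2)] by simp
  ultimately have "?d \<le> 0"
    by (intro tendsto_lowerbound[OF _ _ sequentially_bot])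
  then have "?d = 0" by (intro antisym) auto
  moreover have "integrable M (\<lambda>\<omega>. \<bar>z' \<omega> - x' \<omega> * y' \<omega>\<bar>)"
    using int[OF _ _ bdd(6) xy1] by simp
  ultimately have "AE \<omega> in M. \<bar>z' \<omega> - x' \<omega> * y' \<omega>\<bar> = 0"
    by (subst integral_nonneg_eq_0_iff_AE[symmetric]) auto
  then show ?thesis by eventually_elim simp
qed

lemma (in prob_space) ennreal_real_cond_exp_indicator:
  assumes F: "subalgebra M F" and A[measurable]: "A \<in> events"
  shows "AE \<omega> in M. ennreal (real_cond_exp M F (indicator A) \<omega>) = nn_cond_exp M F (indicator A) \<omega>"
proof -
  interpret F: sigma_finite_subalgebra M F by (rule sigma_finite_subalgebraI[OF F])
  have "(\<integral>\<^sup>+\<omega>. nn_cond_exp M F (indicator A) \<omega> \<partial>M) = (\<integral>\<^sup>+\<omega>. indicator A \<omega> \<partial>M)"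
    using F.nn_cond_exp_intg[of "\<lambda>_. 1" "indicator A"] by simp
  then have "AE \<omega> in M. nn_cond_exp M F (indicator A) \<omega> \<noteq> \<infinity>"
    by (intro nn_integral_PInf_AE) auto
  moreover have "AE \<omega> in M. 0 = nn_cond_exp M F (\<lambda>_. 0) \<omega>"
    by (rule F.nn_cond_exp_F_meas) simp
  moreover have "(\<lambda>\<omega>. ennreal (indicator A \<omega>)) = indicator A" "(\<lambda>\<omega>. ennreal (- indicator A \<omega>)) = (\<lambda>_. 0)"
    by (auto simp: fun_eq_iff indicator_def ennreal_neg)
  ultimately show ?thesis
    unfolding real_cond_exp_def by (auto simp: less_top elim: eventually_elim2)
qed

text \<open>Here \<open>A\<close> is the saturated set of components, so its complement contains the
  separator. That \<open>RA\<close> depends on the components in \<open>A \<union> S\<close> only,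
  and \<open>RB\<close> on those outside \<open>A\<close> only, is expressed by measurability with
  respect to the generated algebras.\<close>

locale separated_chain = positive_chain M \<mu> V X R r v w h
  for M :: "'w measure" and \<mu> :: "'c \<Rightarrow> 'v measure" and V X R r v w h +
  fixes A S :: "'c set" and RA RB :: "('c \<Rightarrow> 'v) \<Rightarrow> ('c \<Rightarrow> 'v) \<Rightarrow> real"
  assumes A_V: "A \<subseteq> V" and S_V: "S \<subseteq> V" and A_S: "A \<inter> S = {}"
    and R_factor: "\<And>x y. R x y = RA x y * RB x y"
    and RA_pos: "\<And>x y. 0 < RA x y" and RB_pos: "\<And>x y. 0 < RB x y"
    and RA_meas: "\<And>t I. {t, t + 1} \<times> (A \<union> S) \<subseteq> I \<Longrightarrow> I \<subseteq> UNIV \<times> V \<Longrightarrow>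
      (\<lambda>\<omega>. RA (X t \<omega>) (X (t + 1) \<omega>)) \<in> borel_measurable (alg I)"
    and RB_meas: "\<And>t I. {t, t + 1} \<times> (V - A) \<subseteq> I \<Longrightarrow> I \<subseteq> UNIV \<times> V \<Longrightarrow>
      (\<lambda>\<omega>. RB (X t \<omega>) (X (t + 1) \<omega>)) \<in> borel_measurable (alg I)"
begin

definition outer :: "int \<Rightarrow> int \<Rightarrow> (int \<times> 'c) set" where
  "outer a b = upto_time a \<union> from_time b \<union> UNIV \<times> S"

lemma h_meas_alg:
  assumes "{t} \<times> C \<subseteq> I" "I \<subseteq> UNIV \<times> V"
  shows "(\<lambda>\<omega>. \<Prod>c\<in>C. h c (X t \<omega> c)) \<in> borel_measurable (alg I)"
proof (rule borel_measurable_prod)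
  fix c assume c: "c \<in> C"
  then have tc: "(t, c) \<in> I" "c \<in> V" using assms by auto
  have "(\<lambda>\<omega>. X t \<omega> c) \<in> measurable (alg I) (\<mu> c)"
    using rv_measurable_alg[OF tc(1) assms(2)] by simp
  then show "(\<lambda>\<omega>. h c (X t \<omega> c)) \<in> borel_measurable (alg I)"
    by (rule measurable_compose[OF _ h_meas[OF tc(2)]])
qed

text \<open>Under the cut the coordinates of \<open>A\<close> inside the window are independent of
  all others, so the claim holds there. The inverse of the cut density is a product
  \<open>KA * KB\<close> with one factor measurable on each side, and such a density preserves
  conditional independence.\<close>

lemma cond_indep_alg_window:
  assumes ab: "a < b"
  shows "cond_indep_alg M (alg ({a<..<b} \<times> A \<union> outer a b)) (alg (UNIV \<times> V - {a<..<b} \<times> A)) (alg (outer a b))"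
proof -
  let ?L = "{a<..<b} \<times> A" and ?T = "UNIV \<times> V :: (int \<times> 'c) set"
  interpret Q: prob_space "cutM a b" by (rule prob_space_cutM[OF ab])
  interpret Q: rv_family "cutM a b" coord_space coord ?T
    by unfold_locales (simp add: rv)
  have LT: "?L \<subseteq> ?T" using A_V by auto
  have GT: "outer a b \<subseteq> ?T" using S_V by (auto simp: outer_def upto_time_def from_time_def)
  have GL: "outer a b \<inter> ?L = {}" using A_S by (auto simp: outer_def upto_time_def from_time_def)
  have ind: "indep_alg (cutM a b) (Q.alg ?L) (Q.alg (?T - ?L))"
    unfolding space_density by (rule indep_alg_cutM[OF ab]) (use LT in auto)
  have int: "(?L \<union> outer a b) \<inter> (?T - ?L) = outer a b" using GT GL by blast
  have ci: "cond_indep_alg (cutM a b) (alg (?L \<union> outer a b)) (alg (?T - ?L)) (alg (outer a b))"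
    using Q.cond_indep_alg_of_indep_alg[OF ind LT, of "?L \<union> outer a b" "?T - ?L"] LT GT
    unfolding int space_density by auto
  \<comment> \<open>Inside the window the reference density splits over the components. At
    \<open>b\<close> the eigenfunction \<open>v\<close> need not split and is assigned entirely to
    \<open>rB\<close>; this is possible because \<open>X b\<close> lies outside the open window and
    is therefore known to the second algebra. The factors \<open>w\<close> and \<open>r\<close> join
    it in \<open>KB\<close> for the same reason.\<close>
  define rA where "rA t x = (if t = b then 1 else \<Prod>c\<in>A. h c (x c))" for t and x :: "'c \<Rightarrow> 'v"
  define rB where "rB t x = (if t = b then v x else \<Prod>c\<in>V - A. h c (x c))" for t and x :: "'c \<Rightarrow> 'v"
  have rAB: "cut_right b t x = rA t x * rB t x" for t x
    using prod.subset_diff[OF A_V finite_V, of "\<lambda>c. h c (x c)"]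
    by (simp add: rA_def rB_def cut_right_def href_def mult.commute)
  have r_pos': "0 < rA t x" "0 < rB t x" for t x
    by (simp_all add: rA_def rB_def prod_pos h_pos v_pos)
  define KA where "KA \<omega> = (\<Prod>t\<in>{a<..b}. RA (X (t - 1) \<omega>) (X t \<omega>) / rA t (X t \<omega>))" for \<omega>
  define KB where "KB \<omega> = (\<Prod>t\<in>{a<..b}. RB (X (t - 1) \<omega>) (X t \<omega>) / (r * cut_left a (t - 1) (X (t - 1) \<omega>) * rB t (X t \<omega>)))" for \<omega>
  have KA_pos: "0 < KA \<omega>" for \<omega> unfolding KA_def by (intro prod_pos) (simp add: RA_pos r_pos')
  have KB_pos: "0 < KB \<omega>" for \<omega> unfolding KB_def by (intro prod_pos) (simp add: RB_pos r_pos' r_pos cut_pos)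
  have DK: "cut_density a b \<omega> * (KA \<omega> * KB \<omega>) = 1" for \<omega>
  proof -
    have "cut_density a b \<omega> * (KA \<omega> * KB \<omega>) = (\<Prod>t\<in>{a<..b}. 1)"
      unfolding cut_density_def KA_def KB_def prod.distrib[symmetric]
    proof (rule prod.cong[OF refl])
      fix t
      have nz: "RA (X (t - 1) \<omega>) (X t \<omega>) \<noteq> 0" "RB (X (t - 1) \<omega>) (X t \<omega>) \<noteq> 0"
          "r * cut_left a (t - 1) (X (t - 1) \<omega>) \<noteq> 0" "rA t (X t \<omega>) \<noteq> 0" "rB t (X t \<omega>) \<noteq> 0"
        using RA_pos[of "X (t - 1) \<omega>" "X t \<omega>"] RB_pos[of "X (t - 1) \<omega>" "X t \<omega>"] r_pos
          cut_pos(1)[of a "t - 1" "X (t - 1) \<omega>"] r_pos'[of t "X t \<omega>"] by auto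
      have "d * (e * f) / (p * q) * (p / e * (q / (d * f))) = 1"
        if "p \<noteq> 0" "q \<noteq> 0" "d \<noteq> 0" "e \<noteq> 0" "f \<noteq> 0" for p q d e f :: real
        using that by (simp add: field_simps)
      from this[OF nz] show "r * cut_left a (t - 1) (X (t - 1) \<omega>) * cut_right b t (X t \<omega>) / R (X (t - 1) \<omega>) (X t \<omega>) *
          (RA (X (t - 1) \<omega>) (X t \<omega>) / rA t (X t \<omega>) *
           (RB (X (t - 1) \<omega>) (X t \<omega>) / (r * cut_left a (t - 1) (X (t - 1) \<omega>) * rB t (X t \<omega>)))) = 1"
        unfolding rAB R_factor .
    qed
    then show ?thesis by simp
  qed
  have RA_m: "(\<lambda>\<omega>. RA (X (t - 1) \<omega>) (X t \<omega>)) \<in> borel_measurable (alg (?L \<union> outer a b))" if "t \<in> {a<..b}" for t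
  proof -
    \<comment> \<open>A component of \<open>A\<close> is covered inside the window by
      \<open>?L\<close> and elsewhere by \<open>outer a b\<close>; a component of \<open>S\<close>
      is always covered. So \<open>RA\<close> is measurable on the first side even at transitions
      across the boundary.\<close>
    have "(i, c) \<in> ?L \<union> outer a b" if "c \<in> A \<union> S" for i c
      using that A_V S_V by (cases "i \<le> a"; cases "b \<le> i") (auto simp: outer_def upto_time_def from_time_def)
    then have "{t - 1, t - 1 + 1} \<times> (A \<union> S) \<subseteq> ?L \<union> outer a b" by blast
    from RA_meas[OF this] show ?thesis using LT GT by simp
  qed
  have rA_m: "(\<lambda>\<omega>. rA t (X t \<omega>)) \<in> borel_measurable (alg (?L \<union> outer a b))" if "t \<in> {a<..b}" for t
  proof (cases "t = b")
    case False
    then have "{t} \<times> A \<subseteq> ?L \<union> outer a b" using that by auto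
    from h_meas_alg[OF this] show ?thesis using False LT GT by (simp add: rA_def)
  qed (simp add: rA_def)
  have KA_m: "KA \<in> borel_measurable (alg (?L \<union> outer a b))"
    unfolding KA_def by (intro borel_measurable_prod borel_measurable_divide RA_m rA_m)
  have RB_m: "(\<lambda>\<omega>. RB (X (t - 1) \<omega>) (X t \<omega>)) \<in> borel_measurable (alg (?T - ?L))" if "t \<in> {a<..b}" for t
    using RB_meas[of "t - 1" "?T - ?L"] that by auto
  have rB_m: "(\<lambda>\<omega>. rB t (X t \<omega>)) \<in> borel_measurable (alg (?T - ?L))" if "t \<in> {a<..b}" for t
  proof (cases "t = b")
    case True
    have "X b \<in> measurable (alg (?T - ?L)) N" by (rule X_meas_alg) auto
    then show ?thesis using True measurable_compose[OF _ v_meas] by (simp add: rB_def)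
  next
    case False
    then show ?thesis using h_meas_alg[of t "V - A" "?T - ?L"] that by (auto simp: rB_def)
  qed
  have cl_m: "(\<lambda>\<omega>. cut_left a (t - 1) (X (t - 1) \<omega>)) \<in> borel_measurable (alg (?T - ?L))" if "t \<in> {a<..b}" for t
  proof (cases "t - 1 = a")
    case True
    have "X a \<in> measurable (alg (?T - ?L)) N" by (rule X_meas_alg) auto
    then show ?thesis using True measurable_compose[OF _ w_meas] by (simp add: cut_left_def)
  qed (simp add: cut_left_def)
  have KB_m: "KB \<in> borel_measurable (alg (?T - ?L))"
    unfolding KB_def
    by (intro borel_measurable_prod borel_measurable_divide borel_measurable_times borel_measurable_const RB_m rB_m cl_m)
  have KM[measurable]: "KA \<in> borel_measurable M" "KB \<in> borel_measurable M"
    using measurable_from_subalg[OF subalgebra_alg KA_m] measurable_from_subalg[OF subalgebra_alg KB_m] LT GT by auto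
  have dens: "density (cutM a b) (\<lambda>\<omega>. ennreal (KA \<omega>) * ennreal (KB \<omega>)) = M"
  proof -
    have "ennreal (cut_density a b \<omega>) * (ennreal (KA \<omega>) * ennreal (KB \<omega>)) = 1" for \<omega>
      using DK[of \<omega>] KA_pos[of \<omega>] KB_pos[of \<omega>] cut_density_pos[of a b \<omega>]
      by (simp add: ennreal_mult[symmetric] less_imp_le)
    then show ?thesis by (simp add: density_density_eq density_1)
  qed
  have "cond_indep_alg (density (cutM a b) (\<lambda>\<omega>. ennreal (KA \<omega>) * ennreal (KB \<omega>)))
      (alg (?L \<union> outer a b)) (alg (?T - ?L)) (alg (outer a b))"
    by (rule Q.cond_indep_alg_density[OF ci])
      (use KA_m KB_m KA_pos KB_pos prob_space_axioms in \<open>auto simp: dens\<close>)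
  then show ?thesis unfolding dens .
qed

text \<open>The ends of the window are sent to infinity one after the other. For fixed
  \<open>a\<close> the forward cuts remove the future, with the past up to \<open>a\<close> and
  \<open>S\<close> as the retained coordinates; then the backward cuts remove the past, with
  \<open>S\<close> alone retained.\<close>

theorem cond_indep_alg_separated:
  "cond_indep_alg M (alg (UNIV \<times> (A \<union> S))) (alg (UNIV \<times> (V - A))) (alg (UNIV \<times> S))"
proof -
  let ?T = "UNIV \<times> V :: (int \<times> 'c) set" and ?S = "UNIV \<times> S :: (int \<times> 'c) set"
  have ST: "?S \<subseteq> ?T" using S_V by auto
  have sub: "subalgebra M (alg (UNIV \<times> (A \<union> S)))" "subalgebra M (alg (UNIV \<times> (V - A)))" "subalgebra M (alg ?S)"
    using A_V S_V by (auto intro!: subalgebra_alg)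
  interpret S: sigma_finite_subalgebra M "alg ?S" by (rule sigma_finite_subalgebraI[OF sub(3)])
  show ?thesis
  proof (rule cond_indep_algI_generator[OF sub(1) sets_generated_alg sub(2) sets_generated_alg
        generated_alg_mono generated_alg_mono Int_stable_cylinder_events cylinder_events_subset
        space_in_cylinder_events Int_stable_cylinder_events cylinder_events_subset space_in_cylinder_events])
    fix E1 E2 assume E: "E1 \<in> cyl (UNIV \<times> (A \<union> S))" "E2 \<in> cyl (UNIV \<times> (V - A))"
    obtain J1 U1 where E1: "E1 = {\<omega>\<in>space M. \<forall>i\<in>J1. coord i \<omega> \<in> U1 i}" "finite J1" "J1 \<subseteq> UNIV \<times> (A \<union> S)"
        "\<And>i. i \<in> J1 \<Longrightarrow> U1 i \<in> sets (coord_space i)"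
      using E(1) by (rule cylinder_eventsE) blast
    obtain J2 U2 where E2: "E2 = {\<omega>\<in>space M. \<forall>i\<in>J2. coord i \<omega> \<in> U2 i}" "finite J2" "J2 \<subseteq> UNIV \<times> (V - A)"
        "\<And>i. i \<in> J2 \<Longrightarrow> U2 i \<in> sets (coord_space i)"
      using E(2) by (rule cylinder_eventsE) blast
    define k where "k = Max (insert 0 ((\<lambda>i. nat \<bar>fst i\<bar>) ` (J1 \<union> J2)))"
    have k: "\<bar>fst i\<bar> \<le> int k" if "i \<in> J1 \<union> J2" for i
    proof -
      have "nat \<bar>fst i\<bar> \<le> k" unfolding k_def using that E1(2) E2(2) by (intro Max_ge) auto
      then show ?thesis by linarith
    qed
    define W where "W = {- int k..int k} \<times> V"
    have J1W: "J1 \<subseteq> W \<inter> UNIV \<times> (A \<union> S)"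
      using k E1(3) A_V S_V by (fastforce simp: W_def abs_le_iff)
    have J2W: "J2 \<subseteq> W \<inter> UNIV \<times> (V - A)"
      using k E2(3) by (fastforce simp: W_def abs_le_iff)
    have E1_alg: "E1 \<in> sets (alg I)" if "J1 \<subseteq> I" for I
      by (rule cylinder_in_generated_alg, rule cylinder_eventsI[of J1 _ U1]) (use E1 that in auto)
    have E2_alg: "E2 \<in> sets (alg I)" if "J2 \<subseteq> I" for I
      by (rule cylinder_in_generated_alg, rule cylinder_eventsI[of J2 _ U2]) (use E2 that in auto)
    have [measurable]: "E1 \<in> events" "E2 \<in> events"
      using cyl_events[OF E(1)] cyl_events[OF E(2)] A_V S_V by auto
    let ?f = "indicator E1 :: _ \<Rightarrow> real" and ?g = "indicator E2 :: _ \<Rightarrow> real"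
    let ?fg = "indicator (E1 \<inter> E2) :: _ \<Rightarrow> real"
    have fg: "?fg = (\<lambda>\<omega>. ?f \<omega> * ?g \<omega>)" by (auto simp: indicator_def)
    have window: "AE \<omega> in M. real_cond_exp M (alg (outer a b)) ?fg \<omega> =
        real_cond_exp M (alg (outer a b)) ?f \<omega> * real_cond_exp M (alg (outer a b)) ?g \<omega>"
      if ab: "a < - int k" "int k < b" for a b
      unfolding fg
    proof (rule real_cond_exp_prod_of_cond_indep_alg[OF cond_indep_alg_window, where C=1 and C'=1])
      show "a < b" using ab by linarith
      have "J1 \<subseteq> {a<..<b} \<times> A \<union> outer a b" using J1W ab by (auto simp: W_def outer_def)
      then show "?f \<in> borel_measurable (alg ({a<..<b} \<times> A \<union> outer a b))"
        using E1_alg by simp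
      have "J2 \<subseteq> UNIV \<times> V - {a<..<b} \<times> A" using J2W by (auto simp: W_def)
      then show "?g \<in> borel_measurable (alg (UNIV \<times> V - {a<..<b} \<times> A))"
        using E2_alg by simp
    qed (auto simp: indicator_def)
    \<comment> \<open>The convergence result asks for events that are determined by one fixed member
      of the family, here number \<open>k\<close> in both directions.\<close>
    have W_bdd: "J1 \<subseteq> upto_time (int k)" "J2 \<subseteq> upto_time (int k)"
        "J1 \<subseteq> from_time (- int k)" "J2 \<subseteq> from_time (- int k)"
      using J1W J2W by (auto simp: W_def upto_time_def from_time_def)
    have fw_meas: "f \<in> borel_measurable (alg (upto_time (int k)))" "f \<in> borel_measurable (alg (from_time (- int k)))"
      if "f \<in> {?f, ?g, ?fg}" for f
      using that W_bdd E1_alg E2_alg by auto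
    have bdd: "AE \<omega> in M. \<bar>real_cond_exp M F f \<omega>\<bar> \<le> 1" if "f \<in> {?f, ?g, ?fg}" "subalgebra M F" for f F
      by (rule abs_real_cond_exp_le) (use that in \<open>auto simp: indicator_def\<close>)
    have bdd1: "AE \<omega> in M. \<bar>f \<omega>\<bar> \<le> 1" if "f \<in> {?f, ?g, ?fg}" for f
      using that by (auto simp: indicator_def)
    have one_sided: "AE \<omega> in M. real_cond_exp M (alg (upto_time a \<union> ?S)) ?fg \<omega> =
        real_cond_exp M (alg (upto_time a \<union> ?S)) ?f \<omega> * real_cond_exp M (alg (upto_time a \<union> ?S)) ?g \<omega>"
      if a: "a < - int k" for a
    proof -
      \<comment> \<open>With these coordinates retained, the algebras of the forward family are
        exactly those of the windows that end at \<open>int n + 1\<close>.\<close>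
      let ?C = "upto_time a \<union> ?S"
      have CT: "?C \<subseteq> ?T" using ST by (auto simp: upto_time_def)
      have o: "?C \<union> (?T - upto_time (int n)) = outer a (int n + 1)" for n
        by (auto simp: outer_def upto_time_def from_time_def)
      have oT: "outer a (int n + 1) \<subseteq> ?T" for n using CT unfolding o[symmetric] by auto
      have lim: "(\<lambda>n. \<integral>\<omega>. \<bar>real_cond_exp M (alg (outer a (int n + 1))) f \<omega> - real_cond_exp M (alg ?C) f \<omega>\<bar> \<partial>M) \<longlonglongrightarrow> 0"
        if "f \<in> {?f, ?g, ?fg}" for f
        using forward.tendsto_real_cond_exp_cut[OF CT fw_meas(1)[OF that] bdd1[OF that]] unfolding o .
      show ?thesis
      proof (rule AE_product_of_L1_limits[OF _ _ _ _ _ _ _ _ _ _ _ _ lim lim lim])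
        show "\<forall>\<^sub>F n in sequentially. AE \<omega> in M. real_cond_exp M (alg (outer a (int n + 1))) ?fg \<omega> =
            real_cond_exp M (alg (outer a (int n + 1))) ?f \<omega> * real_cond_exp M (alg (outer a (int n + 1))) ?g \<omega>"
          by (rule eventually_sequentiallyI[of k], rule window) (use a in auto)
      qed (use bdd subalgebra_alg[OF oT] subalgebra_alg[OF CT] in simp_all)
    qed
    have final: "AE \<omega> in M. real_cond_exp M (alg ?S) ?fg \<omega> = real_cond_exp M (alg ?S) ?f \<omega> * real_cond_exp M (alg ?S) ?g \<omega>"
    proof -
      have o: "?S \<union> (?T - from_time (- int n)) = upto_time (- int n - 1) \<union> ?S" for n
        by (auto simp: upto_time_def from_time_def)
      have oT: "upto_time (- int n - 1) \<union> ?S \<subseteq> ?T" for n using ST unfolding o[symmetric] by auto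
      have lim: "(\<lambda>n. \<integral>\<omega>. \<bar>real_cond_exp M (alg (upto_time (- int n - 1) \<union> ?S)) f \<omega> - real_cond_exp M (alg ?S) f \<omega>\<bar> \<partial>M) \<longlonglongrightarrow> 0"
        if "f \<in> {?f, ?g, ?fg}" for f
        using backward.tendsto_real_cond_exp_cut[OF ST fw_meas(2)[OF that] bdd1[OF that]] unfolding o .
      show ?thesis
      proof (rule AE_product_of_L1_limits[OF _ _ _ _ _ _ _ _ _ _ _ _ lim lim lim])
        show "\<forall>\<^sub>F n in sequentially. AE \<omega> in M. real_cond_exp M (alg (upto_time (- int n - 1) \<union> ?S)) ?fg \<omega> =
            real_cond_exp M (alg (upto_time (- int n - 1) \<union> ?S)) ?f \<omega> * real_cond_exp M (alg (upto_time (- int n - 1) \<union> ?S)) ?g \<omega>"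
          by (rule eventually_sequentiallyI[of k], rule one_sided) auto
      qed (use bdd subalgebra_alg[OF oT] subalgebra_alg[OF ST] in simp_all)
    qed
    have "emeasure M (E1 \<inter> E2) = (\<integral>\<^sup>+\<omega>. nn_cond_exp M (alg ?S) (indicator (E1 \<inter> E2)) \<omega> \<partial>M)"
      using S.nn_cond_exp_intg[of "\<lambda>_. 1" "indicator (E1 \<inter> E2)"] by simp
    also have "\<dots> = (\<integral>\<^sup>+\<omega>. nn_cond_exp M (alg ?S) (indicator E1) \<omega> * nn_cond_exp M (alg ?S) (indicator E2) \<omega> \<partial>M)"
    proof (rule nn_integral_cong_AE)
      have ev: "E1 \<in> events" "E2 \<in> events" "E1 \<inter> E2 \<in> events" by simp_all
      have pos: "AE \<omega> in M. 0 \<le> real_cond_exp M (alg ?S) ?f \<omega>"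
        by (rule S.real_cond_exp_pos) auto
      show "AE \<omega> in M. nn_cond_exp M (alg ?S) (indicator (E1 \<inter> E2)) \<omega> =
          nn_cond_exp M (alg ?S) (indicator E1) \<omega> * nn_cond_exp M (alg ?S) (indicator E2) \<omega>"
        using final pos ennreal_real_cond_exp_indicator[OF sub(3) ev(1)]
          ennreal_real_cond_exp_indicator[OF sub(3) ev(2)] ennreal_real_cond_exp_indicator[OF sub(3) ev(3)]
      proof eventually_elim
        case (elim \<omega>)
        show ?case
          unfolding elim(3)[symmetric] elim(4)[symmetric] elim(5)[symmetric] elim(1)
          by (rule ennreal_mult'[OF elim(2)])
      qed
    qed
    finally show "emeasure M (E1 \<inter> E2) = (\<integral>\<^sup>+\<omega>. nn_cond_exp M (alg ?S) (indicator E1) \<omega> *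
        nn_cond_exp M (alg ?S) (indicator E2) \<omega> \<partial>M)" .
  qed (use A_S S_V in auto)
qed

end

section \<open>Factorization of the kernel along a separator\<close>

text \<open>\<open>A'\<close> is defined by walks because these remain walks when an arc is
  appended; when separation is invoked, erasing loops yields a path within the same vertices.
  \<open>A\<close> is only contained in \<open>A' \<union> S\<close>, since the separator may meet
  \<open>A\<close>.\<close>

lemma separates_obtains_component:
  assumes sep: "separates G S A B"
  obtains A' where "A' \<subseteq> verts G" "A \<subseteq> A' \<union> S" "A' \<inter> S = {}" "A' \<inter> B = {}"
    "\<And>a b. \<lbrakk>a \<in> A'; (a, b) \<in> arcs_ends G; b \<in> verts G; b \<notin> S\<rbrakk> \<Longrightarrow> b \<in> A'"
proof
  define A' where "A' = {b. \<exists>q. vwalk q G \<and> hd q \<in> A \<and> last q = b \<and> set q \<inter> S = {}}"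
  have AV: "A \<subseteq> verts G" using sep by (simp add: separates_def)
  show "A' \<subseteq> verts G" by (auto simp: A'_def vwalk_def)
  show "A' \<inter> S = {}" using last_in_set by (fastforce simp: A'_def vwalk_def)
  show "A \<subseteq> A' \<union> S"
  proof
    fix a assume a: "a \<in> A"
    have "vwalk [a] G" using a AV by (auto simp: vwalk_def)
    then have "a \<in> A'" if "a \<notin> S" using a that by (auto simp: A'_def intro!: exI[of _ "[a]"])
    then show "a \<in> A' \<union> S" by blast
  qed
  show "A' \<inter> B = {}"
  proof (rule ccontr)
    assume "A' \<inter> B \<noteq> {}"
    then obtain q where q: "vwalk q G" "hd q \<in> A" "last q \<in> B" "set q \<inter> S = {}"
      by (auto simp: A'_def)
    have "vpath (vwalk_to_vpath q) G \<and> hd (vwalk_to_vpath q) \<in> A \<and> last (vwalk_to_vpath q) \<in> B"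
      using q vwalk_to_vpath_vpath[OF q(1)] by (simp add: vwalk_to_vpath_hd vwalk_to_vpath_last)
    then have "set (vwalk_to_vpath q) \<inter> S \<noteq> {}" using sep by (simp add: separates_def)
    then show False using q(4) by (auto dest: vwalk_to_vpath_subset)
  qed
  fix a b assume ab: "a \<in> A'" "(a, b) \<in> arcs_ends G" "b \<in> verts G" "b \<notin> S"
  then obtain q where q: "vwalk q G" "hd q \<in> A" "last q = a" "set q \<inter> S = {}"
    by (auto simp: A'_def)
  then have "q \<noteq> []" by (auto simp: vwalk_def)
  then have "vwalk (q @ [b]) G"
    using q ab by (auto simp: vwalk_def set_vwalk_arcs_snoc)
  then show "b \<in> A'"
    unfolding A'_def using q ab \<open>q \<noteq> []\<close> by (auto intro!: exI[of _ "q @ [b]"])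
qed

text \<open>
  The part of the exponent of the interaction kernel carried by the components in \<open>P\<close> and by the
  index pairs in \<open>D\<close>.
\<close>

definition interaction_energy ::
    "nat \<Rightarrow> (nat \<Rightarrow> nat) \<Rightarrow> (nat \<Rightarrow> real \<Rightarrow> nat \<Rightarrow> real) \<Rightarrow> (nat \<Rightarrow> real \<Rightarrow> real) \<Rightarrow> (nat \<Rightarrow> nat \<Rightarrow> real)
      \<Rightarrow> (int \<Rightarrow> nat \<Rightarrow> nat \<Rightarrow> nat \<Rightarrow> nat \<Rightarrow> real) \<Rightarrow> nat set \<Rightarrow> ((nat \<times> nat) \<times> (nat \<times> nat)) set
      \<Rightarrow> (nat \<Rightarrow> real) \<Rightarrow> (nat \<Rightarrow> real) \<Rightarrow> real" where
  "interaction_energy p K s c \<theta> \<Phi> P D x y =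
     (\<Sum>i\<in>{i\<in>stacked_index p K. fst i \<in> P}. stacked_theta \<theta> i * (stacked_stat s x i + stacked_stat s y i) / 2) +
     (\<Sum>a\<in>P. (c a (x a) + c a (y a)) / 2) +
     (\<Sum>(i, j)\<in>D. stacked_stat s x i * block_matrix \<Phi> 0 i j * stacked_stat s x j / 4 +
        stacked_stat s y i * block_matrix \<Phi> 0 i j * stacked_stat s y j / 4 +
        stacked_stat s x i * block_matrix \<Phi> 1 i j * stacked_stat s y j)"

lemma finite_stacked_index [simp]: "finite (stacked_index p K)"
  by (simp add: stacked_index_def)

text \<open>The square roots halve the exponent of \<open>kernel_G\<close> at each of the two
  states: this accounts for the divisor 2 in the linear terms and, with the factor 1/2 already
  present, for the divisor 4 in the quadratic ones.\<close>

lemma interaction_kernel_eq_exp_energy: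
  "interaction_kernel p K s c \<theta> \<Phi> x y =
    exp (interaction_energy p K s c \<theta> \<Phi> {1..p} (stacked_index p K \<times> stacked_index p K) x y)"
proof -
  let ?I = "stacked_index p K"
  have I: "{i\<in>?I. fst i \<in> {1..p}} = ?I" by (auto simp: stacked_index_def)
  have sqrt_exp: "sqrt (exp z) = exp (z / 2)" for z :: real
    by (rule real_sqrt_unique) (simp_all add: power2_eq_square flip: exp_add)
  have bil: "bilinear_on ?I u M v = (\<Sum>(i, j)\<in>?I \<times> ?I. u i * M i j * v j)" for u M v
    by (simp add: bilinear_on_def sum.cartesian_product)
  have "interaction_energy p K s c \<theta> \<Phi> {1..p} (?I \<times> ?I) x y =
      (dot_on ?I (stacked_theta \<theta>) (stacked_stat s x) + 1 / 2 * bilinear_on ?I (stacked_stat s x) (block_matrix \<Phi> 0) (stacked_stat s x) + (\<Sum>a\<in>{1..p}. c a (x a))) / 2 +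
      bilinear_on ?I (stacked_stat s x) (block_matrix \<Phi> 1) (stacked_stat s y) +
      (dot_on ?I (stacked_theta \<theta>) (stacked_stat s y) + 1 / 2 * bilinear_on ?I (stacked_stat s y) (block_matrix \<Phi> 0) (stacked_stat s y) + (\<Sum>a\<in>{1..p}. c a (y a))) / 2"
    unfolding interaction_energy_def I bil dot_on_def
    by (simp add: case_prod_beta' sum.distrib distrib_left add_divide_distrib flip: sum_divide_distrib)
  then show ?thesis
    unfolding interaction_kernel_def kernel_G_def kernel_H_def sqrt_exp by (simp add: exp_add)
qed

lemma interaction_energy_Un:
  assumes "finite P" "finite P'" "P \<inter> P' = {}" "finite D" "finite D'" "D \<inter> D' = {}"
  shows "interaction_energy p K s c \<theta> \<Phi> (P \<union> P') (D \<union> D') x y =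
    interaction_energy p K s c \<theta> \<Phi> P D x y + interaction_energy p K s c \<theta> \<Phi> P' D' x y"
proof -
  have I: "{i\<in>stacked_index p K. fst i \<in> P \<union> P'} =
      {i\<in>stacked_index p K. fst i \<in> P} \<union> {i\<in>stacked_index p K. fst i \<in> P'}" by auto
  have "{i\<in>stacked_index p K. fst i \<in> P} \<inter> {i\<in>stacked_index p K. fst i \<in> P'} = {}"
    using assms(3) by auto
  then show ?thesis
    unfolding interaction_energy_def I using assms by (simp add: sum.union_disjoint)
qed

lemma interaction_energy_cong_neutral:
  assumes "finite D" "D' \<subseteq> D"
    and "\<And>i j. (i, j) \<in> D - D' \<Longrightarrow> block_matrix \<Phi> 0 i j = 0 \<and> block_matrix \<Phi> 1 i j = 0"
  shows "interaction_energy p K s c \<theta> \<Phi> P D x y = interaction_energy p K s c \<theta> \<Phi> P D' x y"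
  unfolding interaction_energy_def
  by (intro arg_cong2[where f="(+)"] refl sum.mono_neutral_right) (use assms in auto)

lemma measurable_interaction_energy:
  assumes f: "\<And>a. a \<in> W \<Longrightarrow> (\<lambda>\<omega>. f \<omega> a) \<in> measurable F (\<mu> a)"
    and g: "\<And>a. a \<in> W \<Longrightarrow> (\<lambda>\<omega>. g \<omega> a) \<in> measurable F (\<mu> a)"
    and s: "\<And>a i. \<lbrakk>a \<in> W; i < K a\<rbrakk> \<Longrightarrow> (\<lambda>u. s a u i) \<in> borel_measurable (\<mu> a)"
    and c: "\<And>a. a \<in> W \<Longrightarrow> c a \<in> borel_measurable (\<mu> a)"
    and P: "P \<subseteq> W" and D: "\<And>i j. (i, j) \<in> D \<Longrightarrow> i \<in> stacked_index p K \<and> j \<in> stacked_index p K \<and> fst i \<in> W \<and> fst j \<in> W"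
  shows "(\<lambda>\<omega>. interaction_energy p K s c \<theta> \<Phi> P D (f \<omega>) (g \<omega>)) \<in> borel_measurable F"
proof -
  have st: "(\<lambda>\<omega>. stacked_stat s (f \<omega>) i) \<in> borel_measurable F" "(\<lambda>\<omega>. stacked_stat s (g \<omega>) i) \<in> borel_measurable F"
    if "i \<in> stacked_index p K" "fst i \<in> W" for i
    using that measurable_compose[OF f[of "fst i"] s[of "fst i" "snd i"]]
      measurable_compose[OF g[of "fst i"] s[of "fst i" "snd i"]]
    by (auto simp: stacked_stat_def stacked_index_def case_prod_beta')
  have cm: "(\<lambda>\<omega>. c a (f \<omega> a)) \<in> borel_measurable F" "(\<lambda>\<omega>. c a (g \<omega> a)) \<in> borel_measurable F" if "a \<in> P" for a
    using that P measurable_compose[OF f[of a] c[of a]] measurable_compose[OF g[of a] c[of a]] by auto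
  have DD: "fst x \<in> stacked_index p K" "fst (fst x) \<in> W" "snd x \<in> stacked_index p K" "fst (snd x) \<in> W"
    if "x \<in> D" for x
    using D[of "fst x" "snd x"] that by auto
  show ?thesis
    unfolding interaction_energy_def case_prod_beta'
    by (intro borel_measurable_add borel_measurable_sum borel_measurable_divide borel_measurable_times
        borel_measurable_const st cm DD) (use P in auto)
qed

section \<open>Markov property of the stationary process\<close>

text \<open>The cylinder over a null set is null even if other factors have infinite measure, since
  a product in \<open>ennreal\<close> with a factor 0 is 0.\<close>

lemma (in product_sigma_finite) AE_PiM_coordinate:
  assumes "finite I" "i \<in> I" and P: "AE x in M i. P x"
  shows "AE x in PiM I M. P (x i)"
proof -
  obtain Z where Z: "{x\<in>space (M i). \<not> P x} \<subseteq> Z" "Z \<in> sets (M i)" "emeasure (M i) Z = 0"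
    using P by (rule AE_E)
  let ?Z = "\<Pi>\<^sub>E j\<in>I. if j = i then Z else space (M j)"
  have "emeasure (PiM I M) ?Z = (\<Prod>j\<in>I. emeasure (M j) (if j = i then Z else space (M j)))"
    by (rule emeasure_PiM) (use assms Z in auto)
  also have "\<dots> = 0" by (rule prod_zero) (use assms Z in \<open>auto intro!: bexI[of _ i]\<close>)
  finally have 0: "emeasure (PiM I M) ?Z = 0" .
  have m: "?Z \<in> sets (PiM I M)" by (rule sets_PiM_I_finite) (use assms Z in auto)
  show ?thesis
  proof (rule AE_I[OF _ 0 m])
    show "{x\<in>space (PiM I M). \<not> P (x i)} \<subseteq> ?Z"
    proof
      fix x assume x: "x \<in> {x\<in>space (PiM I M). \<not> P (x i)}"
      then have "x i \<in> Z" using Z(1) assms(2) by (auto simp: space_PiM)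
      then show "x \<in> ?Z" using x by (auto simp: space_PiM PiE_iff)
    qed
  qed
qed

text \<open>Sigma-finiteness provides a positive integrable function, and a nonzero measure allows
  it to be normalized. The value 1 outside the space makes the density positive everywhere.\<close>

lemma (in sigma_finite_measure) ex_positive_prob_density:
  assumes nz: "emeasure M (space M) \<noteq> 0"
  obtains h :: "'a \<Rightarrow> real" where "h \<in> borel_measurable M" "\<And>x. 0 < h x" "(\<integral>\<^sup>+x. ennreal (h x) \<partial>M) = 1"
proof -
  obtain f where [measurable]: "f \<in> borel_measurable M" and fin: "integral\<^sup>N M f \<noteq> \<infinity>"
    and f: "\<And>x. x \<in> space M \<Longrightarrow> 0 < f x \<and> f x < \<infinity>"
    using Ex_finite_integrable_function by blast
  define I where "I = integral\<^sup>N M f"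
  have I0: "I \<noteq> 0"
  proof
    assume "I = 0"
    then have "AE x in M. f x = 0" by (simp add: I_def nn_integral_0_iff_AE)
    then have "AE x in M. False" using AE_space by eventually_elim (use f in force)
    then show False using nz AE_E2[where M=M and P="\<lambda>_. False"] by simp
  qed
  have It: "I \<noteq> \<top>" using fin by (simp add: I_def)
  define h where "h x = (if x \<in> space M then enn2real (f x / I) else 1)" for x
  have fI: "f x / I \<noteq> \<top>" "f x / I \<noteq> 0" if "x \<in> space M" for x
    using f[OF that] I0 It by (auto simp: ennreal_divide_eq_top_iff ennreal_divide_eq_0_iff)
  show thesis
  proof
    have "(\<lambda>x. enn2real (f x / I)) \<in> borel_measurable M" by measurable
    then show "h \<in> borel_measurable M" by (simp add: h_def cong: measurable_cong_simp)
    show "0 < h x" for x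
      using fI[of x] by (auto simp: h_def enn2real_positive_iff zero_less_iff_neq_zero less_top)
    have "(\<integral>\<^sup>+x. ennreal (h x) \<partial>M) = (\<integral>\<^sup>+x. f x / I \<partial>M)"
      by (rule nn_integral_cong) (simp add: h_def fI ennreal_enn2real_if)
    also have "\<dots> = I / I" by (simp add: nn_integral_divide I_def)
    also have "\<dots> = 1" using I0 It by (simp add: ennreal_divide_self less_top)
    finally show "(\<integral>\<^sup>+x. ennreal (h x) \<partial>M) = 1" .
  qed
qed

theorem theorem2p5:
  fixes p :: nat
    and \<mu> :: "nat \<Rightarrow> real measure"
    and K :: "nat \<Rightarrow> nat"
    and s :: "nat \<Rightarrow> real \<Rightarrow> nat \<Rightarrow> real"
    and c :: "nat \<Rightarrow> real \<Rightarrow> real"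
    and \<theta> :: "nat \<Rightarrow> nat \<Rightarrow> real"
    and \<Phi> :: "int \<Rightarrow> nat \<Rightarrow> nat \<Rightarrow> nat \<Rightarrow> nat \<Rightarrow> real"
    and M :: "'w measure"
    and X :: "int \<Rightarrow> 'w \<Rightarrow> nat \<Rightarrow> real"
    and A B S :: "nat set"
  assumes p: "1 \<le> p"
    and space_borel: "\<And>a. a \<in> {1..p} \<Longrightarrow> space (\<mu> a) \<in> sets borel"
    and sets_base: "\<And>a. a \<in> {1..p} \<Longrightarrow> sets (\<mu> a) = sets (restrict_space borel (space (\<mu> a)))"
    and sigma_finite_base: "\<And>a. a \<in> {1..p} \<Longrightarrow> sigma_finite_measure (\<mu> a)"
    and K: "\<And>a. a \<in> {1..p} \<Longrightarrow> 1 \<le> K a"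
    and s: "\<And>a i. \<lbrakk>a \<in> {1..p}; i < K a\<rbrakk> \<Longrightarrow> (\<lambda>u. s a u i) \<in> borel_measurable (\<mu> a)"
    and c: "\<And>a. a \<in> {1..p} \<Longrightarrow> c a \<in> borel_measurable (\<mu> a)"
    and Phi0_diag: "\<And>a i j. \<lbrakk>a \<in> {1..p}; i < K a; j < K a\<rbrakk> \<Longrightarrow> \<Phi> 0 a a i j = 0"
    and Phi0_transpose: "\<And>a b i j. \<lbrakk>a \<in> {1..p}; b \<in> {1..p}; i < K a; j < K b\<rbrakk>
      \<Longrightarrow> \<Phi> 0 a b i j = \<Phi> 0 b a j i"
    and Phi1_transpose: "\<And>a b i j. \<lbrakk>a \<in> {1..p}; b \<in> {1..p}; i < K a; j < K b\<rbrakk>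
      \<Longrightarrow> \<Phi> (-1) a b i j = \<Phi> 1 b a j i"
    and hilbert_schmidt:
      "hilbert_schmidt_kernel (\<Pi>\<^sub>M a\<in>{1..p}. \<mu> a) (interaction_kernel p K s c \<theta> \<Phi>)"
    and process:
      "cestgm_process M (\<Pi>\<^sub>M a\<in>{1..p}. \<mu> a) (interaction_kernel p K s c \<theta> \<Phi>) X"
    and subsets: "A \<subseteq> {1..p}" "B \<subseteq> {1..p}" "S \<subseteq> {1..p}"
    and separation: "separates (with_proj (cestgm_graph p K \<Phi>)) S A B"
  shows "cond_indep M (component_sigma M \<mu> X A) (component_sigma M \<mu> X B) (component_sigma M \<mu> X S)"
proof -
  note One_nat_def [simp del]
  let ?V = "{1..p}" and ?R = "interaction_kernel p K s c \<theta> \<Phi>" and ?N = "PiM {1..p} \<mu>"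
  \<comment> \<open>Outside \<open>{1..p}\<close> the measures are unconstrained, whereas the product locales require all of them to be sigma-finite.\<close>
  define \<nu> where "\<nu> a = (if a \<in> ?V then \<mu> a else count_space {})" for a
  have \<nu>: "\<nu> a = \<mu> a" if "a \<in> ?V" for a using that by (simp add: \<nu>_def)
  have N: "PiM ?V \<nu> = ?N" by (rule PiM_cong) (simp_all add: \<nu>)
  have sf: "sigma_finite_measure (\<nu> a)" for a
    by (cases "a \<in> ?V") (auto simp: \<nu>_def sigma_finite_base intro: sigma_finite_measure_count_space_finite)
  interpret \<nu>: product_sigma_finite \<nu> by (rule product_sigma_finite.intro) (rule sf)
  have "sigma_finite_measure (PiM ?V \<nu>)" by (rule \<nu>.sigma_finite) simp
  then interpret N: sigma_finite_measure ?N by (simp only: N)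
  interpret NN: product_sigma_finite "\<lambda>_::nat. ?N" by (rule product_sigma_finite.intro) (rule N.sigma_finite_measure_axioms)

  obtain r v w where M: "prob_space M" and X: "\<And>t. X t \<in> measurable M ?N"
    and eig: "principal_eigendata ?N ?R r v w"
    and dist: "\<And>m n. 1 \<le> n \<Longrightarrow> distributed M (\<Pi>\<^sub>M t\<in>{1..n}. ?N) (process_block X m n)
      (\<lambda>x. ennreal (block_density ?R r v w n x))"
    using process unfolding cestgm_process_def by blast
  have r: "0 < r" and v: "AE x in ?N. 0 < v x" and w: "AE x in ?N. 0 < w x"
    and vm: "v \<in> borel_measurable ?N" and wm: "w \<in> borel_measurable ?N" and vw: "(LINT x|?N. v x * w x) = 1"
    using eig by (auto simp: principal_eigendata_def L2_eigenfunction_def L2_fun_def L2_fun_inner_def)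
  \<comment> \<open>The eigenfunctions are positive almost everywhere only. Changing them on a null
    set makes them positive everywhere and alters the block densities only on null sets.\<close>
  define v' where "v' x = (if 0 < v x then v x else 1)" for x
  define w' where "w' x = (if 0 < w x then w x else 1)" for x
  have vm': "v' \<in> borel_measurable ?N" and wm': "w' \<in> borel_measurable ?N"
    using vm wm unfolding v'_def[abs_def] w'_def[abs_def] by measurable
  have R_pos: "0 < ?R x y" for x y by (simp add: interaction_kernel_eq_exp_energy)

  have kernel_meas: "(\<lambda>\<omega>. exp (interaction_energy p K s c \<theta> \<Phi> P D (f \<omega>) (g \<omega>))) \<in> borel_measurable F"
    if "\<And>a. a \<in> W \<Longrightarrow> (\<lambda>\<omega>. f \<omega> a) \<in> measurable F (\<mu> a)" "\<And>a. a \<in> W \<Longrightarrow> (\<lambda>\<omega>. g \<omega> a) \<in> measurable F (\<mu> a)"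
      "W \<subseteq> ?V" "P \<subseteq> W" "D \<subseteq> {i\<in>stacked_index p K. fst i \<in> W} \<times> {i\<in>stacked_index p K. fst i \<in> W}"
    for F :: "'z measure" and f g W P D
    by (rule measurable_compose[OF measurable_interaction_energy[where W=W and \<mu>=\<mu>] borel_measurable_exp])
      (use that s c in auto)
  have R_meas: "case_prod ?R \<in> borel_measurable (?N \<Otimes>\<^sub>M ?N)"
    unfolding interaction_kernel_eq_exp_energy case_prod_beta'
  proof (rule kernel_meas[of ?V])
    show "(\<lambda>\<omega>. fst \<omega> a) \<in> measurable (?N \<Otimes>\<^sub>M ?N) (\<mu> a)" "(\<lambda>\<omega>. snd \<omega> a) \<in> measurable (?N \<Otimes>\<^sub>M ?N) (\<mu> a)"
      if "a \<in> ?V" for a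
      using measurable_compose[OF measurable_fst measurable_component_singleton[OF that]]
        measurable_compose[OF measurable_snd measurable_component_singleton[OF that]] .
  qed (auto simp: stacked_index_def)

  have block: "distr M (\<Pi>\<^sub>M t\<in>{1..n}. ?N) (process_block X m n) =
      density (\<Pi>\<^sub>M t\<in>{1..n}. ?N) (\<lambda>x. ennreal (block_density ?R r v' w' n x))" if n: "1 \<le> n" for m n
  proof -
    let ?PM = "\<Pi>\<^sub>M t\<in>{1..n}. ?N"
    have n1: "1 \<in> {1..n}" "n \<in> {1..n}" using n by auto
    have comp: "(\<lambda>x. x t) \<in> measurable ?PM ?N" if "t \<in> {1..n}" for t
      using that by (rule measurable_component_singleton)
    have bm: "(\<lambda>x. ennreal (block_density ?R r v' w' n x)) \<in> borel_measurable ?PM"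
      unfolding block_density_def
    proof (intro measurable_compose[OF _ measurable_ennreal] borel_measurable_times borel_measurable_const
        borel_measurable_prod measurable_compose[OF comp vm'] measurable_compose[OF comp wm'] n1)
      fix t assume "t \<in> {2..n}"
      then have "(\<lambda>x. (x (t - 1), x t)) \<in> measurable ?PM (?N \<Otimes>\<^sub>M ?N)"
        by (intro measurable_Pair comp) auto
      from measurable_compose[OF this R_meas] show "(\<lambda>x. ?R (x (t - 1)) (x t)) \<in> borel_measurable ?PM"
        by simp
    qed
    have "AE x in ?PM. 0 < v (x 1)" "AE x in ?PM. 0 < w (x n)"
      by (rule NN.AE_PiM_coordinate[OF _ n1(1) v] NN.AE_PiM_coordinate[OF _ n1(2) w]; simp)+
    then have ae: "AE x in ?PM. ennreal (block_density ?R r v w n x) = ennreal (block_density ?R r v' w' n x)"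
      by eventually_elim (simp add: block_density_def v'_def w'_def)
    have d: "distr M ?PM (process_block X m n) = density ?PM (\<lambda>x. ennreal (block_density ?R r v w n x))"
      and dm: "(\<lambda>x. ennreal (block_density ?R r v w n x)) \<in> borel_measurable ?PM"
      using dist[OF n, of m] unfolding distributed_def by blast+
    show ?thesis unfolding d by (rule density_cong[OF dm bm ae])
  qed

  have "\<exists>h :: real \<Rightarrow> real. h \<in> borel_measurable (\<mu> a) \<and> (\<forall>x. 0 < h x) \<and> (\<integral>\<^sup>+x. ennreal (h x) \<partial>\<mu> a) = 1" if a: "a \<in> ?V" for a
  proof -
    interpret a: sigma_finite_measure "\<mu> a" by (rule sigma_finite_base[OF a])
    \<comment> \<open>If one factor vanished, the product measure would vanish too, contrary to the
      normalization \<open>vw\<close>.\<close>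
    have "emeasure (\<mu> a) (space (\<mu> a)) \<noteq> 0"
    proof
      assume 0: "emeasure (\<mu> a) (space (\<mu> a)) = 0"
      have "emeasure (PiM ?V \<nu>) (\<Pi>\<^sub>E i\<in>?V. space (\<nu> i)) = (\<Prod>i\<in>?V. emeasure (\<nu> i) (space (\<nu> i)))"
        by (rule \<nu>.emeasure_PiM) auto
      also have "\<dots> = 0" by (rule prod_zero) (use a 0 \<nu> in \<open>auto intro!: bexI[of _ a]\<close>)
      finally have "emeasure ?N (space ?N) = 0" by (simp only: space_PiM[symmetric] N)
      then have "AE x in ?N. v x * w x = 0" by (intro AE_I[of _ _ "space ?N"]) auto
      then have "(LINT x|?N. v x * w x) = 0" by (rule integral_eq_zero_AE)
      then show False using vw by simp
    qed
    from a.ex_positive_prob_density[OF this] show ?thesis by metis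
  qed
  then obtain h0 :: "nat \<Rightarrow> real \<Rightarrow> real" where h0: "\<And>a. a \<in> ?V \<Longrightarrow> h0 a \<in> borel_measurable (\<mu> a) \<and>
      (\<forall>x. 0 < h0 a x) \<and> (\<integral>\<^sup>+x. ennreal (h0 a x) \<partial>\<mu> a) = 1"
    by metis
  \<comment> \<open>The default 1 keeps \<open>h\<close> positive at all indices, as the locale
    demands.\<close>
  define h where "h a = (if a \<in> ?V then h0 a else (\<lambda>_. 1))" for a

  have chain: "positive_chain M \<nu> ?V X ?R r v' w' h"
  proof (intro positive_chain.intro positive_chain_axioms.intro M \<nu>.product_sigma_finite_axioms, unfold N)
    show "0 < v' x" "0 < w' x" for x by (simp_all add: v'_def w'_def)
    show "h a \<in> borel_measurable (\<nu> a)" "(\<integral>\<^sup>+x. ennreal (h a x) \<partial>\<nu> a) = 1" if "a \<in> ?V" for a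
      using h0[OF that] that by (simp_all add: h_def \<nu>)
    show "0 < h a x" for a x using h0[of a] by (simp add: h_def)
  qed (rule X R_meas vm' wm' R_pos r block finite_atLeastAtMost; assumption?)+

  obtain A' where A': "A' \<subseteq> ?V" "A \<subseteq> A' \<union> S" "A' \<inter> S = {}" "A' \<inter> B = {}"
    and closed: "\<And>a b. \<lbrakk>a \<in> A'; b \<in> neighbourhood p K \<Phi> a; b \<in> ?V; b \<notin> S\<rbrakk> \<Longrightarrow> b \<in> A'"
  proof (rule separates_obtains_component[OF separation], goal_cases)
    case (1 A')
    have "b \<in> A'" if "a \<in> A'" "b \<in> neighbourhood p K \<Phi> a" "b \<in> ?V" "b \<notin> S" for a b
    proof (rule 1(6)[OF that(1) _ _ that(4)])
      show "(a, b) \<in> arcs_ends (with_proj (cestgm_graph p K \<Phi>))"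
        using 1(2) that by (auto simp: cestgm_graph_def)
      show "b \<in> verts (with_proj (cestgm_graph p K \<Phi>))"
        using that by (simp add: cestgm_graph_def)
    qed
    then show thesis using 1 by (intro 1(1)[of A']) (simp_all add: cestgm_graph_def)
  qed
  have no_edge: "\<Phi> l a b i j = 0"
    if "a \<in> A'" "b \<in> ?V" "b \<notin> A'" "b \<notin> S" "l \<in> {-1, 0, 1}" "i < K a" "j < K b" for a b l i j
  proof (rule ccontr)
    assume "\<Phi> l a b i j \<noteq> 0"
    then have "b \<in> neighbourhood p K \<Phi> a"
      using that unfolding neighbourhood_def by blast
    then show False using closed that by blast
  qed
  let ?I = "stacked_index p K"
  \<comment> \<open>Index pairs that touch \<open>A'\<close> go to \<open>RA\<close>, all others to
    \<open>RB\<close>. \<open>DA'\<close> drops the pairs whose partner lies outside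
    \<open>A' \<union> S\<close>: they belong to non-adjacent components and carry zero
    coefficients, and without them \<open>RA\<close> depends on \<open>A' \<union> S\<close>
    only.\<close>
  define DA where "DA = {(i, j) \<in> ?I \<times> ?I. fst i \<in> A' \<or> fst j \<in> A'}"
  define DA' where "DA' = {(i, j) \<in> DA. fst i \<in> A' \<union> S \<and> fst j \<in> A' \<union> S}"
  define DB where "DB = {(i, j) \<in> ?I \<times> ?I. fst i \<notin> A' \<and> fst j \<notin> A'}"
  have fin: "finite DA" "finite DB"
    by (rule finite_subset[of _ "?I \<times> ?I"]; force simp: DA_def DB_def)+
  define RA where "RA x y = exp (interaction_energy p K s c \<theta> \<Phi> A' DA' x y)" for x y
  define RB where "RB x y = exp (interaction_energy p K s c \<theta> \<Phi> (?V - A') DB x y)" for x y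
  have R_factor: "?R x y = RA x y * RB x y" for x y
  proof -
    have V: "A' \<union> (?V - A') = ?V" and D: "DA \<union> DB = ?I \<times> ?I" "DA \<inter> DB = {}"
      using A'(1) by (auto simp: DA_def DB_def)
    have "interaction_energy p K s c \<theta> \<Phi> (A' \<union> (?V - A')) (DA \<union> DB) x y =
        interaction_energy p K s c \<theta> \<Phi> A' DA x y + interaction_energy p K s c \<theta> \<Phi> (?V - A') DB x y"
      by (rule interaction_energy_Un[OF finite_subset[OF A'(1)] _ _ fin D(2)]) auto
    then have "interaction_energy p K s c \<theta> \<Phi> ?V (?I \<times> ?I) x y =
        interaction_energy p K s c \<theta> \<Phi> A' DA x y + interaction_energy p K s c \<theta> \<Phi> (?V - A') DB x y"
      by (simp only: V D(1))
    also have "interaction_energy p K s c \<theta> \<Phi> A' DA x y = interaction_energy p K s c \<theta> \<Phi> A' DA' x y"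
    proof (rule interaction_energy_cong_neutral[OF fin(1)])
      show "DA' \<subseteq> DA" by (auto simp: DA'_def)
      fix i j assume ij: "(i, j) \<in> DA - DA'"
      obtain a i' b j' where i: "i = (a, i')" and j: "j = (b, j')" by (cases i, cases j)
      have *: "a \<in> ?V" "b \<in> ?V" "i' < K a" "j' < K b"
        using ij by (auto simp: i j DA_def stacked_index_def)
      have "(a \<in> A' \<and> b \<notin> A' \<and> b \<notin> S) \<or> (b \<in> A' \<and> a \<notin> A' \<and> a \<notin> S)"
        using ij by (auto simp: i j DA_def DA'_def)
      then show "block_matrix \<Phi> 0 i j = 0 \<and> block_matrix \<Phi> 1 i j = 0"
      proof
        assume "a \<in> A' \<and> b \<notin> A' \<and> b \<notin> S"
        then show ?thesis using no_edge[of a b _ i' j'] * by (simp add: i j block_matrix_def)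
      next
        \<comment> \<open>The set \<open>A'\<close> was shown to be closed along arcs that leave it,
          whereas here its element is the second index. Transposition exchanges the indices and
          turns lag 1 into lag -1.\<close>
        assume "b \<in> A' \<and> a \<notin> A' \<and> a \<notin> S"
        then have "\<Phi> 0 b a j' i' = 0" "\<Phi> (-1) b a j' i' = 0" using no_edge[of b a _ j' i'] * by auto
        then show ?thesis
          using Phi0_transpose[of a b i' j'] Phi1_transpose[of b a j' i'] * by (simp add: i j block_matrix_def)
      qed
    qed
    finally show ?thesis by (simp add: interaction_kernel_eq_exp_energy RA_def RB_def exp_add)
  qed

  interpret pc: positive_chain M \<nu> ?V X ?R r v' w' h by (rule chain)
  have coord_meas: "(\<lambda>\<omega>. X t \<omega> a) \<in> measurable (pc.alg I) (\<mu> a)"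
    if I: "(t, a) \<in> I" "I \<subseteq> UNIV \<times> ?V" for t I a
  proof -
    have "a \<in> ?V" using I by auto
    then show ?thesis using pc.rv_measurable_alg[OF I] by (simp only: fst_conv snd_conv \<nu>)
  qed
  interpret sc: separated_chain M \<nu> ?V X ?R r v' w' h A' S RA RB
  proof (intro separated_chain.intro chain separated_chain_axioms.intro)
    show "(\<lambda>\<omega>. RA (X t \<omega>) (X (t + 1) \<omega>)) \<in> borel_measurable (pc.alg I)"
      if I: "{t, t + 1} \<times> (A' \<union> S) \<subseteq> I" "I \<subseteq> UNIV \<times> ?V" for t I
      unfolding RA_def
      by (rule kernel_meas[of "A' \<union> S"])
        (use A'(1) subsets(3) I in \<open>auto simp: DA'_def DA_def intro!: coord_meas\<close>)
    show "(\<lambda>\<omega>. RB (X t \<omega>) (X (t + 1) \<omega>)) \<in> borel_measurable (pc.alg I)"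
      if I: "{t, t + 1} \<times> (?V - A') \<subseteq> I" "I \<subseteq> UNIV \<times> ?V" for t I
      unfolding RB_def
      by (rule kernel_meas[of "?V - A'"])
        (use I in \<open>auto simp: DB_def stacked_index_def intro!: coord_meas\<close>)
  qed (use A' subsets R_factor in \<open>auto simp: RA_def RB_def\<close>)

  have comp_sets: "sets (component_sigma M \<mu> X C) = sets (pc.alg (UNIV \<times> C))" if C: "C \<subseteq> ?V" for C
  proof -
    let ?E = "{(\<lambda>\<omega>. X t \<omega> b) -` U \<inter> space M | t b U. b \<in> C \<and> U \<in> sets (\<mu> b)}"
    have sp: "space (component_sigma M \<mu> X C) = space M"
      by (simp add: component_sigma_def space_measure_of_conv)
    have se: "sets (component_sigma M \<mu> X C) = sigma_sets (space M) ?E"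
      unfolding component_sigma_def by (rule sets_measure_of) auto
    have "?E \<subseteq> sets (pc.alg (UNIV \<times> C))"
    proof
      fix E assume "E \<in> ?E"
      then obtain t b U where E: "E = (\<lambda>\<omega>. X t \<omega> b) -` U \<inter> space M" "b \<in> C" "U \<in> sets (\<mu> b)" by blast
      have "(\<lambda>\<omega>. X t \<omega> b) \<in> measurable (pc.alg (UNIV \<times> C)) (\<mu> b)"
        by (rule coord_meas) (use E C in auto)
      from measurable_sets[OF this E(3)] show "E \<in> sets (pc.alg (UNIV \<times> C))" by (simp add: E(1))
    qed
    then have "sets (component_sigma M \<mu> X C) \<subseteq> sets (pc.alg (UNIV \<times> C))"
      unfolding se using sets.sigma_sets_subset[of ?E "pc.alg (UNIV \<times> C)"] by simp
    moreover have "sets (pc.alg (UNIV \<times> C)) \<subseteq> sets (component_sigma M \<mu> X C)"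
    proof (rule sets_generated_alg_least[OF sp])
      fix i :: "int \<times> nat" assume i: "i \<in> UNIV \<times> C"
      then have iV: "snd i \<in> ?V" using C by auto
      show "(\<lambda>\<omega>. X (fst i) \<omega> (snd i)) \<in> measurable (component_sigma M \<mu> X C) (\<nu> (snd i))"
      proof (rule measurableI)
        fix \<omega> assume "\<omega> \<in> space (component_sigma M \<mu> X C)"
        then show "X (fst i) \<omega> (snd i) \<in> space (\<nu> (snd i))"
          using pc.X_in_space[of \<omega> "fst i"] iV by (auto simp: sp space_PiM)
      next
        fix U assume "U \<in> sets (\<nu> (snd i))"
        then have "U \<in> sets (\<mu> (snd i))" "snd i \<in> C" using i \<nu>[OF iV] by auto
        then have "(\<lambda>\<omega>. X (fst i) \<omega> (snd i)) -` U \<inter> space M \<in> ?E"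
          by blast
        then show "(\<lambda>\<omega>. X (fst i) \<omega> (snd i)) -` U \<inter> space (component_sigma M \<mu> X C) \<in> sets (component_sigma M \<mu> X C)"
          unfolding sp se by (rule sigma_sets.Basic)
      qed
    qed
    ultimately show ?thesis by blast
  qed
  \<comment> \<open>The conditional expectation takes the algebra as a measure, so equality of the
    sets must become equality of measures; both carry the zero measure.\<close>
  have comp_eq: "component_sigma M \<mu> X S = pc.alg (UNIV \<times> S)"
    by (rule measure_eqI[OF comp_sets[OF subsets(3)]])
      (simp add: component_sigma_def generated_alg_def emeasure_sigma)
  have comp_meas: "f \<in> borel_measurable (pc.alg (UNIV \<times> C'))"
    if f: "f \<in> borel_measurable (component_sigma M \<mu> X C)" and C: "C \<subseteq> C'" "C' \<subseteq> ?V" for f :: "'w \<Rightarrow> real" and C C'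
  proof -
    have "C \<subseteq> ?V" using C by blast
    with f have fC: "f \<in> borel_measurable (pc.alg (UNIV \<times> C))"
      using measurable_cong_sets[OF comp_sets refl] by blast
    have "UNIV \<times> C \<subseteq> UNIV \<times> C'" using C(1) by blast
    from measurable_from_subalg[OF generated_alg_mono[OF this] fC] show ?thesis .
  qed
  show ?thesis
    unfolding cond_indep_def comp_eq
  proof (intro ballI impI)
    fix m1 m2 :: "'w \<Rightarrow> real"
    assume m: "m1 \<in> borel_measurable (component_sigma M \<mu> X A)" "m2 \<in> borel_measurable (component_sigma M \<mu> X B)"
    assume "\<exists>C. \<forall>\<omega>\<in>space M. 0 \<le> m1 \<omega> \<and> m1 \<omega> \<le> C" "\<exists>C. \<forall>\<omega>\<in>space M. 0 \<le> m2 \<omega> \<and> m2 \<omega> \<le> C"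
    then obtain C1 C2 where C: "\<And>\<omega>. \<omega> \<in> space M \<Longrightarrow> 0 \<le> m1 \<omega> \<and> m1 \<omega> \<le> C1"
        "\<And>\<omega>. \<omega> \<in> space M \<Longrightarrow> 0 \<le> m2 \<omega> \<and> m2 \<omega> \<le> C2" by blast
    show "AE \<omega> in M. real_cond_exp M (pc.alg (UNIV \<times> S)) (\<lambda>\<omega>. m1 \<omega> * m2 \<omega>) \<omega> =
        real_cond_exp M (pc.alg (UNIV \<times> S)) m1 \<omega> * real_cond_exp M (pc.alg (UNIV \<times> S)) m2 \<omega>"
    \<comment> \<open>The sets \<open>A\<close> and \<open>B\<close> are contained in the two larger
      sides: \<open>A\<close> in \<open>A' \<union> S\<close>, and \<open>B\<close> in the
      complement of \<open>A'\<close>, because \<open>A'\<close> does not meet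
      \<open>B\<close>.\<close>
    proof (rule pc.real_cond_exp_prod_of_cond_indep_alg[OF sc.cond_indep_alg_separated, where C=C1 and C'=C2])
      show "m1 \<in> borel_measurable (pc.alg (UNIV \<times> (A' \<union> S)))"
        by (rule comp_meas[OF m(1)]) (use A' subsets in auto)
      show "m2 \<in> borel_measurable (pc.alg (UNIV \<times> (?V - A')))"
        by (rule comp_meas[OF m(2)]) (use A' subsets in auto)
    qed (use C in auto)
  qed
qed

end
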